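(* Let $n\ge 1$ and let $H=T+V$ with $$T=\sum_{j,k=0}^{n-1}\tau_{j,k}A_j^\dagger A_k,\qquad V=\sum_{l,m=0}^{n-1}\nu_{l,m}N_lN_m,$$ where $\tau,\nu$ are complex $n\times n$ coefficient matrices such that $T$ and $V$ are Hermitian. Let $\mathscr{S}_p(t)$ be a $p$th-order product formula for $H=T+V$, and let $0\le \eta\le n$. Then there is a constant $C>0$, depending only on $p$ and on the chosen formula (and not on $n,\eta,t,\tau,\nu$), such that for all $t\ge 0$ $$\big\|\mathscr{S}_p(t)-e^{-itH}\big\|_{\eta}\le C\left(\|\tau\|+\|\nu\|_{\max}\eta\right)^{p-1}\|\tau\|\,\|\nu\|_{\max}\,\eta^2\, t^{p+1}.$$ Furthermore, if the interactions are $d$-sparse, i.e., every row and every column of $\tau$ and of $\nu$ contains at most $d$ nonzero entries, then (with $C$ again depending only on $p$ and the formula) $$\big\|\mathscr{S}_p(t)-e^{-itH}\big\|_{\eta}\le C\left(\|\tau\|_{\max}+\|\nu\|_{\max}\right)^{p-1}\|\tau\|_{\max}\|\nu\|_{\max}\, d^{p+1}\,\eta\, t^{p+1}.$$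
   Context: Fermionic Fock space on $n$ spin orbitals: the $2^n$-dimensional Hilbert space with orthonormal basis $|c_0,c_1,\dots,c_{n-1}\rangle$, $c_j\in\{0,1\}$. Creation operators: $A_j^\dagger|c_0,\dots,0_j,\dots,c_{n-1}\rangle=(-1)^{\sum_{k<j}c_k}|c_0,\dots,1_j,\dots,c_{n-1}\rangle$ and $A_j^\dagger|c_0,\dots,1_j,\dots,c_{n-1}\rangle=0$; the annihilation operator $A_j$ is the adjoint of $A_j^\dagger$. Occupation-number operators $N_j=A_j^\dagger A_j$. The $\eta$-electron subspace is spanned by basis vectors with $\sum_j c_j=\eta$; an $\eta$-electron state is a unit vector in it. For an operator $X$ commuting with $N=\sum_jN_j$, the fermionic $\eta$-seminorm is $\|X\|_\eta=\max_{|\psi_\eta\rangle,|\phi_\eta\rangle}|\langle\phi_\eta|X|\psi_\eta\rangle|$, the maximum over $\eta$-electron states. $\|\tau\|$ is the spectral norm; $\|\tau\|_{\max}=\max_{j,k}|\tau_{j,k}|$. A $p$th-order product formula is an operator $\mathscr{S}_p(t)=\prod_{\upsilon=1}^{\Upsilon}e^{-ita_\upsilon T}e^{-itb_\upsilon V}$ with fixed real coefficients $a_\upsilon,b_\upsilon$ (e.g. the Lie–Trotter formula $e^{-itT}e^{-itV}$ for $p=1$ or Suzuki formulas) such that $\mathscr{S}_p(t)=e^{-it(T+V)}+O(t^{p+1})$ as $t\to0$ for arbitrary operators $T,V$. *)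

theory Defs
  imports Complex_Main "Jordan_Normal_Form.Matrix"
begin

text \<open>Operators are complex matrices (Jordan_Normal_Form). The Fock space on n spin
orbitals is C^(2^n); the basis vector with index s (s < 2^n) is |c_0,...,c_(n-1)>
with c_j = (s div 2^j) mod 2.\<close>

definition occ :: "nat \<Rightarrow> nat \<Rightarrow> nat" where
  "occ s j = (s div 2 ^ j) mod 2"

definition num_el :: "nat \<Rightarrow> nat \<Rightarrow> nat" where
  "num_el n s = (\<Sum>j<n. occ s j)"

definition adj :: "complex mat \<Rightarrow> complex mat" where
  "adj A = mat (dim_col A) (dim_row A) (\<lambda>(i,j). cnj (A $$ (j,i)))"

definition cre :: "nat \<Rightarrow> nat \<Rightarrow> complex mat" where
  "cre n j = mat (2 ^ n) (2 ^ n) (\<lambda>(r, s).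
     if occ s j = 0 \<and> r = s + 2 ^ j then (-1) ^ (\<Sum>k<j. occ s k) else 0)"

definition ann :: "nat \<Rightarrow> nat \<Rightarrow> complex mat" where
  "ann n j = adj (cre n j)"

definition numop :: "nat \<Rightarrow> nat \<Rightarrow> complex mat" where
  "numop n j = cre n j * ann n j"

definition msum :: "nat \<Rightarrow> ('i \<Rightarrow> complex mat) \<Rightarrow> 'i set \<Rightarrow> complex mat" where
  "msum m f I = Finite_Set.fold (\<lambda>i acc. f i + acc) (0\<^sub>m m m) I"

definition hop_op :: "nat \<Rightarrow> complex mat \<Rightarrow> complex mat" where
  "hop_op n \<tau> = msum (2 ^ n) (\<lambda>(j, k). \<tau> $$ (j, k) \<cdot>\<^sub>m (cre n j * ann n k))
                   ({0..<n} \<times> {0..<n})"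

definition int_op :: "nat \<Rightarrow> complex mat \<Rightarrow> complex mat" where
  "int_op n \<nu> = msum (2 ^ n) (\<lambda>(l, m). \<nu> $$ (l, m) \<cdot>\<^sub>m (numop n l * numop n m))
                   ({0..<n} \<times> {0..<n})"

definition mexp :: "complex mat \<Rightarrow> complex mat" where
  "mexp M = mat (dim_row M) (dim_col M)
     (\<lambda>ij. \<Sum>k. (M ^\<^sub>m k) $$ ij / of_nat (fact k))"

fun prod_formula :: "nat \<Rightarrow> (real \<times> real) list \<Rightarrow> real \<Rightarrow> complex mat \<Rightarrow> complex mat \<Rightarrow> complex mat" where
  "prod_formula m [] t T V = 1\<^sub>m m"
| "prod_formula m ((a, b) # cs) t T V =
     mexp ((- \<i> * of_real (t * a)) \<cdot>\<^sub>m T) * mexp ((- \<i> * of_real (t * b)) \<cdot>\<^sub>m V)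
     * prod_formula m cs t T V"

text \<open>cs is a p-th order product formula: for arbitrary operators T, V (of any finite
dimension m), S(t) = e^(-it(T+V)) + O(t^(p+1)) as t -> 0 (entrywise, equivalently in
any norm since the dimension is finite).\<close>
definition is_product_formula :: "nat \<Rightarrow> (real \<times> real) list \<Rightarrow> bool" where
  "is_product_formula p cs \<longleftrightarrow>
     (\<forall>m T V. T \<in> carrier_mat m m \<longrightarrow> V \<in> carrier_mat m m \<longrightarrow>
        (\<exists>c. \<forall>\<^sub>F t in at (0::real). \<forall>i<m. \<forall>j<m.
           cmod ((prod_formula m cs t T V - mexp ((- \<i> * of_real t) \<cdot>\<^sub>m (T + V))) $$ (i, j))
             \<le> c * \<bar>t\<bar> ^ (p + 1)))"

definition eta_state :: "nat \<Rightarrow> nat \<Rightarrow> complex vec \<Rightarrow> bool" where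
  "eta_state n \<eta> \<psi> \<longleftrightarrow> \<psi> \<in> carrier_vec (2 ^ n)
     \<and> (\<forall>s<2 ^ n. num_el n s \<noteq> \<eta> \<longrightarrow> \<psi> $ s = 0)
     \<and> (\<Sum>s<2 ^ n. (cmod (\<psi> $ s))\<^sup>2) = 1"

definition eta_seminorm :: "nat \<Rightarrow> nat \<Rightarrow> complex mat \<Rightarrow> real" where
  "eta_seminorm n \<eta> X = Sup {cmod (\<Sum>s<2 ^ n. cnj (\<phi> $ s) * (X *\<^sub>v \<psi>) $ s) | \<phi> \<psi>.
      eta_state n \<eta> \<phi> \<and> eta_state n \<eta> \<psi>}"

definition vnorm :: "complex vec \<Rightarrow> real" where
  "vnorm x = sqrt (\<Sum>i<dim_vec x. (cmod (x $ i))\<^sup>2)"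

definition spec_norm :: "complex mat \<Rightarrow> real" where
  "spec_norm A = Sup {vnorm (A *\<^sub>v x) | x. x \<in> carrier_vec (dim_col A) \<and> vnorm x = 1}"

definition max_norm :: "complex mat \<Rightarrow> real" where
  "max_norm A = Max (insert 0 {cmod (A $$ (j, k)) | j k. j < dim_row A \<and> k < dim_col A})"

definition sparse_mat :: "nat \<Rightarrow> complex mat \<Rightarrow> bool" where
  "sparse_mat d A \<longleftrightarrow>
     (\<forall>j<dim_row A. card {k. k < dim_col A \<and> A $$ (j, k) \<noteq> 0} \<le> d)
   \<and> (\<forall>k<dim_col A. card {j. j < dim_row A \<and> A $$ (j, k) \<noteq> 0} \<le> d)"

end

theory Submission
  imports Defs "HOL-Complex_Analysis.Complex_Analysis"
begin

text \<open>
  Write \<open>S'(t) = S(t) W(t)\<close>, where \<open>W\<close> is a sum of generators conjugated by tails of the product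
  formula. By Duhamel's formula the error is an integral of \<open>R = W + iH\<close> between unitaries. Expanding
  the conjugations from the inside out expresses \<open>R\<close> as a polynomial of degree less than \<open>p\<close> plus a
  remainder of size \<open>t^p\<close> times the largest \<open>p\<close>-fold nested commutator of \<open>T\<close> and \<open>V\<close>; the order
  condition for this particular pair \<open>T, V\<close> kills the polynomial. It remains to bound nested
  commutators on the sector with \<open>\<eta>\<close> electrons.

  For the first bound, the sector is embedded isometrically (up to the factor \<open>\<eta>!\<close>) into functions of
  \<open>\<eta>\<close> positions. There \<open>T\<close> is a sum of one-body and \<open>V\<close> a sum of two-body terms, and a commutator with
  a \<open>k\<close>-body term only sees the \<open>O(k)\<close> terms of \<open>T\<close> and the \<open>O(k \<eta>)\<close> terms of \<open>V\<close> touching its particles.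

  For the second bound, a nested commutator of monomials vanishes unless the monomials are linked
  through common orbitals, and it annihilates basis states in which no orbital involved is occupied. Hence
  each column of the nested commutator is a sum over linked families through one of the \<open>\<eta>\<close> occupied
  orbitals, of which there are \<open>O(d^(p+1))\<close>; Schur's test turns this into a norm bound.
\<close>

text \<open>The obstacle is uniformity. The constant in the order condition may depend on T and V,
  hence on n, so only its qualitative content is used: vanishing Taylor coefficients at 0.
  Everything quantitative sits in Taylor remainders, which hold for every t \<ge> 0 because unitary
  conjugation preserves the bound on the p-th derivative; no smallness of t and no convergent
  commutator series is involved.

  The two bounds need different pictures. Summing norms of the monomials
  \<open>fcre j * fann k\<close> sees the entries of \<tau> but not its spectral norm; that norm
  appears once T acts as \<tau> on single positions of distinguishable particles. Antisymmetric
  functions form a subspace there, so bounds on the whole space restrict to it. The position picture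
  counts pairs and gives the square of \<eta>; the linear \<eta> of the sparse bound comes from
  rooting each linked family at an occupied orbital.

  In both pictures the innermost commutator is 0 or [T,V] up to sign, which gives the product of the
  two interaction strengths; the other p - 1 commutators give the power of their sum.\<close>

unbundle no vec_syntax and no fps_syntax

section \<open>Linear operators on spaces of functions\<close>

text \<open>Linear operators get a type of their own so that \<open>ring_1\<close> reasoning applies to commutators
  without carrier conditions.\<close>

typedef 'i lop = "{P :: ('i \<Rightarrow> complex) \<Rightarrow> ('i \<Rightarrow> complex).
    (\<forall>f g. P (\<lambda>x. f x + g x) = (\<lambda>x. P f x + P g x)) \<and> (\<forall>c f. P (\<lambda>x. c * f x) = (\<lambda>x. c * P f x))}"
  morphisms ap Lop
  by (rule exI[of _ "\<lambda>f. f"]) simp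

setup_lifting type_definition_lop

instantiation lop :: (type) ring_1
begin
lift_definition zero_lop :: "'a lop" is "\<lambda>f x. 0" by simp
lift_definition one_lop :: "'a lop" is "\<lambda>f. f" by simp
lift_definition plus_lop :: "'a lop \<Rightarrow> 'a lop \<Rightarrow> 'a lop" is "\<lambda>P Q f x. P f x + Q f x"
  by (auto simp: algebra_simps)
lift_definition minus_lop :: "'a lop \<Rightarrow> 'a lop \<Rightarrow> 'a lop" is "\<lambda>P Q f x. P f x - Q f x"
  by (auto simp: algebra_simps)
lift_definition uminus_lop :: "'a lop \<Rightarrow> 'a lop" is "\<lambda>P f x. - P f x"
  by (auto simp: algebra_simps)
lift_definition times_lop :: "'a lop \<Rightarrow> 'a lop \<Rightarrow> 'a lop" is "\<lambda>P Q f. P (Q f)"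
  by auto
instance
proof
  show "(0::'a lop) \<noteq> 1"
    by transfer (auto simp: fun_eq_iff intro!: exI[of _ "\<lambda>_. 1::complex"])
qed (transfer; auto simp: fun_eq_iff)+
end

lemma ap_simps [simp]:
  "ap 0 f x = 0" "ap 1 f x = f x" "ap (A + B) f x = ap A f x + ap B f x"
  "ap (A - B) f x = ap A f x - ap B f x" "ap (- A) f x = - ap A f x" "ap (A * B) f = ap A (ap B f)"
  by (transfer; simp)+

lemma lop_eqI: "(\<And>f x. ap A f x = ap B f x) \<Longrightarrow> A = B"
  by (metis ap_inject ext)

lemma ap_add: "ap A (\<lambda>x. f x + g x) y = ap A f y + ap A g y"
  by transfer simp

lemma ap_scale: "ap A (\<lambda>x. c * f x) y = c * ap A f y"
  by transfer simp

lemma ap_zero: "ap A (\<lambda>x. 0) y = 0"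
  using ap_scale[of A 0 "\<lambda>_. 0" y] by simp

lemma ap_sum: "ap (sum F I) f x = (\<Sum>i\<in>I. ap (F i) f x)"
  by (induction I rule: infinite_finite_induct) auto

lift_definition mulop :: "('i \<Rightarrow> complex) \<Rightarrow> 'i lop" is "\<lambda>g f x. g x * f x"
  by (auto simp: algebra_simps)

lemma ap_mulop [simp]: "ap (mulop g) f x = g x * f x"
  by transfer simp

text \<open>Scalars are elements of the operator ring itself, so no vector space structure on
  \<open>lop\<close> is required: homogeneity of an operator becomes the ring identity
  \<open>scop_central\<close>.\<close>

abbreviation scop :: "complex \<Rightarrow> 'i lop" where "scop c \<equiv> mulop (\<lambda>_. c)"

lemma scop_central: "A * scop c = scop c * A"
  by (rule lop_eqI) (simp add: ap_scale mulop.rep_eq)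

section \<open>Commutators with sums of one-body and two-body terms\<close>

abbreviation comm :: "'r::ring \<Rightarrow> 'r \<Rightarrow> 'r" where "comm x y \<equiv> x * y - y * x"

lemma comm_sum_left: "comm (\<Sum>i\<in>I. f i) (x::'r::ring) = (\<Sum>i\<in>I. comm (f i) x)"
  by (simp add: sum_distrib_left sum_distrib_right sum_subtractf)

lemma comm_sum_right: "comm (x::'r::ring) (\<Sum>i\<in>I. f i) = (\<Sum>i\<in>I. comm x (f i))"
  by (simp add: sum_distrib_left sum_distrib_right sum_subtractf)

text \<open>\<open>bnd c x\<close> stands for a norm bound; the closure rules listed are all that
  commutator estimates ask of a norm. The index pairs of \<open>v\<close> are ordered and include i
  = j, so diagonal interactions are covered by the same terms.\<close>

locale few_body =
  fixes bnd :: "real \<Rightarrow> 'r::ring \<Rightarrow> bool" and t :: "nat \<Rightarrow> 'r" and v :: "nat \<Rightarrow> nat \<Rightarrow> 'r"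
    and \<alpha> \<beta> :: real and \<eta> :: nat
  assumes bnd_zero: "bnd 0 0"
    and bnd_mult: "\<lbrakk>bnd c x; bnd d y; 0 \<le> c; 0 \<le> d\<rbrakk> \<Longrightarrow> bnd (c * d) (x * y)"
    and bnd_add: "\<lbrakk>bnd c x; bnd d y\<rbrakk> \<Longrightarrow> bnd (c + d) (x + y)"
    and bnd_minus: "bnd c x \<Longrightarrow> bnd c (- x)"
    and bnd_mono: "\<lbrakk>bnd c x; c \<le> d\<rbrakk> \<Longrightarrow> bnd d x"
    and nonneg: "0 \<le> \<alpha>" "0 \<le> \<beta>"
    and bnd_t: "i < \<eta> \<Longrightarrow> bnd \<alpha> (t i)"
    and bnd_v: "\<lbrakk>i < \<eta>; j < \<eta>\<rbrakk> \<Longrightarrow> bnd \<beta> (v i j)"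
    and t_comm: "i \<noteq> l \<Longrightarrow> t i * t l = t l * t i"
    and tv_comm: "\<lbrakk>l \<noteq> i; l \<noteq> j\<rbrakk> \<Longrightarrow> t l * v i j = v i j * t l"
    and v_comm: "v i j * v i' j' = v i' j' * v i j"
begin

definition T where "T = (\<Sum>i<\<eta>. t i)"
definition V where "V = (\<Sum>(i,j)\<in>{..<\<eta>}\<times>{..<\<eta>}. v i j)"

text \<open>The support of an operator is expressed by commutation alone, which spares any tensor
  product structure. A pair term with just one index in S is left unconstrained: it may fail to
  commute with x.\<close>

definition acts_on :: "nat set \<Rightarrow> 'r \<Rightarrow> bool" where
  "acts_on S x \<longleftrightarrow> (\<forall>l. l \<notin> S \<longrightarrow> t l * x = x * t l) \<and>
     (\<forall>i j. i \<notin> S \<longrightarrow> j \<notin> S \<longrightarrow> v i j * x = x * v i j)"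

text \<open>\<open>loc k c x\<close>: \<open>x\<close> is a sum of terms acting on at most \<open>k\<close> particles each, of total norm at most \<open>c\<close>.\<close>

inductive loc :: "nat \<Rightarrow> real \<Rightarrow> 'r \<Rightarrow> bool" where
  base: "\<lbrakk>acts_on S x; S \<subseteq> {..<\<eta>}; card S \<le> k; bnd c x; 0 \<le> c\<rbrakk> \<Longrightarrow> loc k c x"
| add: "\<lbrakk>loc k c x; loc k d y\<rbrakk> \<Longrightarrow> loc k (c + d) (x + y)"

lemma loc_bnd: "loc k c x \<Longrightarrow> bnd c x"
  by (induction rule: loc.induct) (auto intro: bnd_add)

lemma loc_nonneg: "loc k c x \<Longrightarrow> 0 \<le> c"
  by (induction rule: loc.induct) auto

lemma loc_mono: "loc k c x \<Longrightarrow> k \<le> k' \<Longrightarrow> c \<le> c' \<Longrightarrow> loc k' c' x"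
proof (induction arbitrary: c' rule: loc.induct)
  case (base S x k c)
  then show ?case by (intro loc.base[of S]) (auto intro: bnd_mono)
next
  case (add k c x d y)
  \<comment> \<open>All slack goes to the first summand; its induction hypothesis admits any larger
    bound.\<close>
  have "loc k' ((c' - d) + d) (x + y)"
    by (rule loc.add) (use add in auto)
  then show ?case by simp
qed

lemma loc_zero: "0 \<le> c \<Longrightarrow> loc k c 0"
  by (rule loc.base[of "{}"]) (auto simp: acts_on_def intro: bnd_mono[OF bnd_zero])

lemma loc_sum:
  assumes "finite A" "\<And>a. a \<in> A \<Longrightarrow> loc k (c a) (x a)"
  shows "loc k (\<Sum>a\<in>A. c a) (\<Sum>a\<in>A. x a)"
  using assms by (induction A rule: finite_induct) (auto intro: loc_zero loc.add)

lemma acts_on_comm: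
  assumes "acts_on S x" "acts_on S' y"
  shows "acts_on (S \<union> S') (comm x y)"
proof -
  have *: "a * comm x y = comm x y * a" if "a * x = x * a" "a * y = y * a" for a
  proof -
    have "a * (x * y) = (x * y) * a" "a * (y * x) = (y * x) * a"
      by (metis that mult.assoc)+
    then show ?thesis by (simp add: right_diff_distrib left_diff_distrib)
  qed
  show ?thesis using assms unfolding acts_on_def by (auto intro!: *)
qed

lemma bnd_comm: "\<lbrakk>bnd c x; bnd d y; 0 \<le> c; 0 \<le> d\<rbrakk> \<Longrightarrow> bnd (2 * c * d) (comm x y)"
  using bnd_add[OF bnd_mult[of c x d y] bnd_minus[OF bnd_mult[of d y c x]]] by (simp add: algebra_simps)

lemma acts_on_t: "acts_on {i} (t i)"
  unfolding acts_on_def using t_comm[of _ i] tv_comm[of i] by auto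

lemma acts_on_v: "acts_on {i, j} (v i j)"
  unfolding acts_on_def using tv_comm v_comm by auto

text \<open>Only the terms \<open>t i\<close> with i in the support survive, at most k of them, each
  at a cost of 2 \<alpha> c. Since i already lies in S, the support does not grow.\<close>

lemma loc_comm_T:
  assumes "loc k c x" shows "loc k (2 * real k * \<alpha> * c) (comm T x)"
  using assms
proof (induction rule: loc.induct)
  case (base S x k c)
  have L: "loc k (\<Sum>i<\<eta>. if i \<in> S then 2 * \<alpha> * c else 0) (\<Sum>i<\<eta>. comm (t i) x)"
  proof (rule loc_sum)
    fix i assume i: "i \<in> {..<\<eta>}"
    show "loc k (if i \<in> S then 2 * \<alpha> * c else 0) (comm (t i) x)"
    proof (cases "i \<in> S")
      case True
      have "acts_on ({i} \<union> S) (comm (t i) x)" by (rule acts_on_comm[OF acts_on_t base(1)])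
      with True have "acts_on S (comm (t i) x)" by (simp add: insert_absorb)
      with True show ?thesis using base i nonneg
        by (auto intro!: loc.base[of S] bnd_comm bnd_t)
    next
      case False
      then show ?thesis using base(1) by (simp add: acts_on_def loc_zero)
    qed
  qed simp
  have E: "(\<Sum>i<\<eta>. if i \<in> S then 2 * \<alpha> * c else 0) = card S * (2 * \<alpha> * c)"
    using base(2) by (subst sum.If_cases) (auto simp: Int_absorb1 inf.absorb2)
  have B: "real (card S) * (2 * \<alpha> * c) \<le> k * (2 * \<alpha> * c)"
    using base nonneg by (intro mult_right_mono) auto
  have "loc k (k * (2 * \<alpha> * c)) (comm T x)" unfolding T_def comm_sum_left
    by (rule loc_mono[OF L order_refl]) (use E B in linarith)
  then show ?case by (simp add: ac_simps)
next
  case (add k c x d y)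
  have "comm T (x + y) = comm T x + comm T y" by (simp add: algebra_simps)
  then show ?case using loc.add[OF add.IH] by (simp only: distrib_left)
qed

text \<open>A surviving pair has one index in the support (k choices) and the other anywhere (\<eta>
  choices), in two orders, and costs 2 \<beta> c. Its second index adds at most one particle to the
  support.\<close>

lemma loc_comm_V:
  assumes "loc k c x" shows "loc (k + 1) (4 * real k * real \<eta> * \<beta> * c) (comm V x)"
  using assms
proof (induction rule: loc.induct)
  case (base S x k c)
  have fS: "finite S" using base(2) finite_subset by blast
  \<comment> \<open>Each pair is charged \<open>g i + g j\<close>, which dominates its cost
    whichever index meets S; the double sum then becomes 2 \<eta> times the single sum of
    \<open>g\<close>.\<close>
  define g where "g = (\<lambda>i. if i \<in> S then 2 * \<beta> * c else 0)"
  have g0: "g i \<ge> 0" for i using base nonneg by (auto simp: g_def)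
  have L: "loc (k + 1) (\<Sum>(i,j)\<in>{..<\<eta>}\<times>{..<\<eta>}. g i + g j) (\<Sum>(i,j)\<in>{..<\<eta>}\<times>{..<\<eta>}. comm (v i j) x)"
    unfolding split_def
  proof (rule loc_sum)
    fix e assume e: "e \<in> {..<\<eta>}\<times>{..<\<eta>}"
    obtain i j where ij: "e = (i, j)" "i < \<eta>" "j < \<eta>" using e by auto
    have "loc (k + 1) (g i + g j) (comm (v i j) x)"
    proof (cases "i \<in> S \<or> j \<in> S")
      case True
      have "acts_on ({i,j} \<union> S) (comm (v i j) x)" by (rule acts_on_comm[OF acts_on_v base(1)])
      moreover have "card ({i,j} \<union> S) \<le> k + 1"
        using True fS base(3) by (auto simp: insert_absorb card_insert_if)
      ultimately have "loc (k + 1) (2 * \<beta> * c) (comm (v i j) x)" using base ij nonneg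
        by (auto intro!: loc.base[of "{i,j} \<union> S"] bnd_comm bnd_v)
      moreover have "2 * \<beta> * c \<le> g i + g j" using True g0[of i] g0[of j] by (auto simp: g_def)
      ultimately show ?thesis by (auto intro: loc_mono)
    next
      case False
      then show ?thesis using base(1) g0[of i] g0[of j] by (simp add: acts_on_def loc_zero)
    qed
    then show "loc (k + 1) (g (fst e) + g (snd e)) (comm (v (fst e) (snd e)) x)" using ij by simp
  qed simp
  have "(\<Sum>i<\<eta>. g i) = card S * (2 * \<beta> * c)"
    using base(2) unfolding g_def by (subst sum.If_cases) (auto simp: Int_absorb1 inf.absorb2)
  then have E: "(\<Sum>(i,j)\<in>{..<\<eta>}\<times>{..<\<eta>}. g i + g j) = 2 * real \<eta> * (real (card S) * (2 * \<beta> * c))"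
    by (subst sum.cartesian_product[symmetric]) (simp add: sum.distrib flip: sum_distrib_left)
  have B: "2 * real \<eta> * (real (card S) * (2 * \<beta> * c)) \<le> 2 * real \<eta> * (real k * (2 * \<beta> * c))"
    using base nonneg by (intro mult_left_mono mult_right_mono) auto
  have "comm V x = (\<Sum>(i,j)\<in>{..<\<eta>}\<times>{..<\<eta>}. comm (v i j) x)"
    unfolding V_def comm_sum_left split_def ..
  with L E B have "loc (k + 1) (2 * real \<eta> * (real k * (2 * \<beta> * c))) (comm V x)"
    by (simp add: loc_mono)
  then show ?case by (simp add: ac_simps)
next
  case (add k c x d y)
  have "comm V (x + y) = comm V x + comm V y" by (simp add: algebra_simps)
  then show ?case using loc.add[OF add.IH] by (simp only: distrib_left)
qed

text \<open>A common, slightly wasteful bound for both generators lets nested commutators be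
  estimated by their depth alone, without following which letter occurs where.\<close>

lemma loc_comm:
  assumes "loc k c x"
  shows "loc (k + 1) (4 * real k * (\<alpha> + real \<eta> * \<beta>) * c) (comm T x)"
    and "loc (k + 1) (4 * real k * (\<alpha> + real \<eta> * \<beta>) * c) (comm V x)"
proof -
  have c: "0 \<le> c" using assms by (rule loc_nonneg)
  have "0 \<le> real k * \<alpha>" "0 \<le> real k * (real \<eta> * \<beta>)" using nonneg by simp_all
  then have "2 * real k * \<alpha> \<le> 4 * real k * (\<alpha> + real \<eta> * \<beta>)"
    by (simp only: distrib_left)
  then have "2 * real k * \<alpha> * c \<le> 4 * real k * (\<alpha> + real \<eta> * \<beta>) * c"
    using c by (rule mult_right_mono)
  then show "loc (k + 1) (4 * real k * (\<alpha> + real \<eta> * \<beta>) * c) (comm T x)"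
    using loc_mono[OF loc_comm_T[OF assms]] by simp
  have "4 * real k * real \<eta> * \<beta> * c \<le> 4 * real k * (\<alpha> + real \<eta> * \<beta>) * c"
    using c nonneg by (simp add: algebra_simps)
  then show "loc (k + 1) (4 * real k * (\<alpha> + real \<eta> * \<beta>) * c) (comm V x)"
    using loc_mono[OF loc_comm_V[OF assms]] by simp
qed

text \<open>V consists of \<eta>^2 two-body terms of size \<beta>, and commuting a two-body term
  with T costs 2 * 2 * \<alpha>. This is the source of the factor \<alpha> \<beta> \<eta>^2 in the
  first error bound.\<close>

lemma loc_comm_TV: "loc 2 (4 * \<alpha> * \<beta> * \<eta>\<^sup>2) (comm T V)"
proof -
  have "loc 2 (\<Sum>(i,j)\<in>{..<\<eta>}\<times>{..<\<eta>}. \<beta>) V"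
    unfolding V_def split_def
  proof (rule loc_sum)
    fix e assume "e \<in> {..<\<eta>}\<times>{..<\<eta>}"
    then show "loc 2 \<beta> (v (fst e) (snd e))"
      by (intro loc.base[of "{fst e, snd e}"] acts_on_v bnd_v)
        (auto simp: nonneg card_insert_if)
  qed simp
  then have "loc 2 (\<eta>\<^sup>2 * \<beta>) V" by (simp add: power2_eq_square)
  from loc_comm_T[OF this] show ?thesis by (simp add: ac_simps)
qed

lemma loc_minus: "loc k c x \<Longrightarrow> loc k c (- x)"
proof (induction rule: loc.induct)
  case (base S x k c)
  then show ?case by (intro loc.base[of S]) (auto simp: acts_on_def intro: bnd_minus)
next
  case (add k c x d y)
  then show ?case using loc.add[of k c "-x" d "-y"] by simp
qed

end

section \<open>Operators on many-particle configurations\<close>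

definition l2 :: "'i set \<Rightarrow> ('i \<Rightarrow> complex) \<Rightarrow> real" where
  "l2 X f = L2_set (\<lambda>x. cmod (f x)) X"

definition opb :: "'i set \<Rightarrow> real \<Rightarrow> 'i lop \<Rightarrow> bool" where
  "opb X c A \<longleftrightarrow> (\<forall>f. l2 X (ap A f) \<le> c * l2 X f)"

lemma l2_nonneg: "0 \<le> l2 X f"
  by (simp add: l2_def)

lemma l2_power2: "(l2 X f)\<^sup>2 = (\<Sum>x\<in>X. (cmod (f x))\<^sup>2)"
  by (simp add: l2_def L2_set_def sum_nonneg)

lemma l2_add: "l2 X (\<lambda>x. f x + g x) \<le> l2 X f + l2 X g"
  unfolding l2_def
  by (rule order_trans[OF L2_set_mono L2_set_triangle_ineq]) (auto simp: norm_triangle_ineq)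

lemma opb_add: "opb X c A \<Longrightarrow> opb X d B \<Longrightarrow> opb X (c + d) (A + B)"
  unfolding opb_def
proof
  fix f assume A: "\<forall>f. l2 X (ap A f) \<le> c * l2 X f" and B: "\<forall>f. l2 X (ap B f) \<le> d * l2 X f"
  have "ap (A + B) f = (\<lambda>x. ap A f x + ap B f x)" by auto
  then have "l2 X (ap (A + B) f) \<le> l2 X (ap A f) + l2 X (ap B f)" by (simp add: l2_add)
  also have "\<dots> \<le> (c + d) * l2 X f" using A[rule_format, of f] B[rule_format, of f] by (simp add: algebra_simps)
  finally show "l2 X (ap (A + B) f) \<le> (c + d) * l2 X f" .
qed

lemma opb_mult:
  assumes "opb X c A" "opb X d B" "0 \<le> c"
  shows "opb X (c * d) (A * B)"
  unfolding opb_def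
proof
  fix f
  have "l2 X (ap A (ap B f)) \<le> c * l2 X (ap B f)" using assms(1) by (simp add: opb_def)
  also have "\<dots> \<le> c * (d * l2 X f)" using assms by (intro mult_left_mono) (auto simp: opb_def)
  finally show "l2 X (ap (A * B) f) \<le> c * d * l2 X f" by (simp add: mult.assoc)
qed

lemma opb_minus: "opb X c A \<Longrightarrow> opb X c (- A)"
  by (simp add: opb_def l2_def)

lemma opb_mono: "opb X c A \<Longrightarrow> c \<le> d \<Longrightarrow> opb X d A"
  unfolding opb_def by (meson l2_nonneg mult_right_mono order_trans)

lemma opb_zero: "opb X 0 0"
  by (simp add: opb_def l2_def L2_set_def)

lemma opb_mulop:
  assumes "\<And>x. x \<in> X \<Longrightarrow> cmod (g x) \<le> \<beta>" "0 \<le> \<beta>"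
  shows "opb X \<beta> (mulop g)"
proof -
  have "l2 X (ap (mulop g) f) \<le> \<beta> * l2 X f" for f
  proof -
    have "l2 X (ap (mulop g) f) \<le> L2_set (\<lambda>x. \<beta> * cmod (f x)) X"
      unfolding l2_def using assms by (intro L2_set_mono) (auto simp: norm_mult mult_right_mono)
    then show ?thesis using assms(2) by (simp add: l2_def L2_set_left_distrib L2_set_right_distrib)
  qed
  then show ?thesis by (simp add: opb_def)
qed

text \<open>The one-body operator 1 \<otimes> ... \<otimes> \<tau> \<otimes> ... \<otimes> 1 with
  \<tau> at position i, acting on wave functions of distinguishable particles.\<close>

lift_definition slot :: "nat \<Rightarrow> (nat \<Rightarrow> nat \<Rightarrow> complex) \<Rightarrow> nat \<Rightarrow> nat list lop" is
  "\<lambda>n \<tau> i f xs. \<Sum>k<n. \<tau> (xs ! i) k * f (xs[i := k])"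
  by (auto simp: fun_eq_iff algebra_simps sum.distrib sum_distrib_left)

lemma ap_slot: "ap (slot n \<tau> i) f xs = (\<Sum>k<n. \<tau> (xs ! i) k * f (xs[i := k]))"
  by transfer simp

definition pair_op :: "(nat \<Rightarrow> nat \<Rightarrow> complex) \<Rightarrow> nat \<Rightarrow> nat \<Rightarrow> nat list lop" where
  "pair_op \<nu> i j = mulop (\<lambda>xs. \<nu> (xs ! i) (xs ! j))"

text \<open>Repeated orbitals are allowed. Dropping antisymmetry enlarges the space and can only
  increase norms, but makes one-body operators act independently at each position.\<close>

definition configs :: "nat \<Rightarrow> nat \<Rightarrow> nat list set" where
  "configs n \<eta> = {xs. set xs \<subseteq> {..<n} \<and> length xs = \<eta>}"

text \<open>Updates at different positions commute and leave each other's lookup unchanged. This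
  remains true beyond the end of the list, so no length condition appears.\<close>

lemma slot_comm: "i \<noteq> l \<Longrightarrow> slot n \<tau> i * slot n \<tau> l = slot n \<tau> l * slot n \<tau> i"
proof (rule lop_eqI)
  fix f xs assume il: "i \<noteq> l"
  have "ap (slot n \<tau> i * slot n \<tau> l) f xs
      = (\<Sum>k<n. \<Sum>k'<n. \<tau> (xs ! i) k * \<tau> (xs ! l) k' * f (xs[i := k, l := k']))"
    using il by (simp add: ap_slot sum_distrib_left mult.assoc)
  also have "\<dots> = (\<Sum>k'<n. \<Sum>k<n. \<tau> (xs ! i) k * \<tau> (xs ! l) k' * f (xs[i := k, l := k']))"
    by (rule sum.swap)
  also have "\<dots> = ap (slot n \<tau> l * slot n \<tau> i) f xs"
    using il by (simp add: ap_slot sum_distrib_left mult.assoc mult.left_commute list_update_swap[of l i])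
  finally show "ap (slot n \<tau> i * slot n \<tau> l) f xs = ap (slot n \<tau> l * slot n \<tau> i) f xs" .
qed

lemma slot_pair_comm: "l \<noteq> i \<Longrightarrow> l \<noteq> j \<Longrightarrow> slot n \<tau> l * pair_op \<nu> i j = pair_op \<nu> i j * slot n \<tau> l"
  by (rule lop_eqI) (simp add: ap_slot pair_op_def sum_distrib_left ac_simps)

lemma pair_comm: "pair_op \<nu> i j * pair_op \<nu> i' j' = pair_op \<nu> i' j' * pair_op \<nu> i j"
  by (rule lop_eqI) (simp add: pair_op_def)

text \<open>Substitution along the involution \<open>(xs, k) \<mapsto> (xs[i := k], xs ! i)\<close>.\<close>

lemma sum_resample:
  fixes h :: "nat list \<Rightarrow> real"
  assumes "i < \<eta>"
  shows "(\<Sum>xs\<in>configs n \<eta>. \<Sum>k<n. h (xs[i := k])) = real n * (\<Sum>xs\<in>configs n \<eta>. h xs)"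
proof -
  have "(\<Sum>xs\<in>configs n \<eta>. \<Sum>k<n. h (xs[i := k]))
      = (\<Sum>(xs,k)\<in>configs n \<eta> \<times> {..<n}. h (xs[i := k]))"
    by (simp add: sum.cartesian_product)
  also have "\<dots> = (\<Sum>(xs,k)\<in>configs n \<eta> \<times> {..<n}. h xs)"
    by (rule sum.reindex_bij_witness[where i="\<lambda>(xs,k). (xs[i := k], xs ! i)"
          and j="\<lambda>(xs,k). (xs[i := k], xs ! i)"])
      (use assms in \<open>auto simp: configs_def dest: subsetD[OF set_update_subset_insert]
          subsetD[OF _ nth_mem]\<close>)
  also have "\<dots> = real n * (\<Sum>xs\<in>configs n \<eta>. h xs)"
    by (simp add: sum.cartesian_product[symmetric] sum_distrib_left)
  finally show ?thesis .
qed

text \<open>For fixed other positions, the lists \<open>xs[i := j]\<close> form a copy of the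
  n-dimensional one-particle space, on which the hypothesis on \<tau> applies. Resampling position i
  counts every list n times on both sides, and n cancels; for n = 0 there are no configurations at
  all since i < \<eta>.\<close>

lemma opb_slot:
  assumes \<tau>: "\<And>g. (\<Sum>j<n. (cmod (\<Sum>k<n. \<tau> j k * g k))\<^sup>2) \<le> \<alpha>\<^sup>2 * (\<Sum>k<n. (cmod (g k))\<^sup>2)"
    and "0 \<le> \<alpha>" "i < \<eta>"
  shows "opb (configs n \<eta>) \<alpha> (slot n \<tau> i)"
  unfolding opb_def
proof
  fix f
  let ?X = "configs n \<eta>"
  show "l2 ?X (ap (slot n \<tau> i) f) \<le> \<alpha> * l2 ?X f"
  proof (cases "n = 0")
    case True
    then have "?X = {}" using \<open>i < \<eta>\<close> by (auto simp: configs_def)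
    then show ?thesis by (simp add: l2_def)
  next
    case False
    have len: "length xs = \<eta>" if "xs \<in> ?X" for xs using that by (simp add: configs_def)
    have "real n * (l2 ?X (ap (slot n \<tau> i) f))\<^sup>2
        = (\<Sum>xs\<in>?X. \<Sum>j<n. (cmod (ap (slot n \<tau> i) f (xs[i := j])))\<^sup>2)"
      unfolding l2_power2 by (rule sum_resample[OF \<open>i < \<eta>\<close>, symmetric])
    also have "\<dots> = (\<Sum>xs\<in>?X. \<Sum>j<n. (cmod (\<Sum>k<n. \<tau> j k * f (xs[i := k])))\<^sup>2)"
      using len \<open>i < \<eta>\<close> by (simp add: ap_slot)
    also have "\<dots> \<le> (\<Sum>xs\<in>?X. \<alpha>\<^sup>2 * (\<Sum>k<n. (cmod (f (xs[i := k])))\<^sup>2))"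
      by (intro sum_mono \<tau>)
    also have "\<dots> = \<alpha>\<^sup>2 * (real n * (l2 ?X f)\<^sup>2)"
      using sum_resample[OF \<open>i < \<eta>\<close>, where h="\<lambda>xs. (cmod (f xs))\<^sup>2"]
      by (simp add: l2_power2 flip: sum_distrib_left)
    finally have "(l2 ?X (ap (slot n \<tau> i) f))\<^sup>2 \<le> (\<alpha> * l2 ?X f)\<^sup>2"
      using False by (simp add: power_mult_distrib)
    then show ?thesis
      by (rule power2_le_imp_le) (simp add: l2_nonneg \<open>0 \<le> \<alpha>\<close>)
  qed
qed

lemma few_body_configs:
  assumes "\<And>g. (\<Sum>j<n. (cmod (\<Sum>k<n. \<tau> j k * g k))\<^sup>2) \<le> \<alpha>\<^sup>2 * (\<Sum>k<n. (cmod (g k))\<^sup>2)"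
    and "0 \<le> \<alpha>" and "0 \<le> \<beta>" and "\<And>j k. j < n \<Longrightarrow> k < n \<Longrightarrow> cmod (\<nu> j k) \<le> \<beta>"
  shows "few_body (opb (configs n \<eta>)) (slot n \<tau>) (pair_op \<nu>) \<alpha> \<beta> \<eta>"
proof
  fix i j assume "i < \<eta>" "j < \<eta>"
  then show "opb (configs n \<eta>) \<beta> (pair_op \<nu> i j)"
    unfolding pair_op_def using assms
    by (intro opb_mulop) (auto simp: configs_def intro!: assms(4) dest: subsetD[OF _ nth_mem])
qed (use assms in \<open>auto intro: opb_zero opb_mult opb_add opb_minus opb_mono opb_slot slot_comm
      slot_pair_comm pair_comm\<close>)

section \<open>Fermionic operators on occupation-number states\<close>

lemma occ_bit: "occ s j = of_bool (bit s j)"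
  by (simp add: occ_def bit_iff_odd mod2_eq_if)

section \<open>Jordan-Wigner signs and bit manipulation\<close>

definition jw_sign :: "nat \<Rightarrow> nat \<Rightarrow> complex" where
  "jw_sign j s = (-1) ^ (\<Sum>k<j. occ s k)"

lemma jw_sign_prod: "jw_sign j s = (\<Prod>k<j. if bit s k then -1 else 1)"
  unfolding jw_sign_def power_sum by (intro prod.cong) (auto simp: occ_bit)

lemma jw_sign_square [simp]: "jw_sign j s * jw_sign j s = 1" "jw_sign j s * (jw_sign j s * z) = z"
proof -
  show *: "jw_sign j s * jw_sign j s = 1"
    by (simp add: jw_sign_def flip: power_add mult_2)
  show "jw_sign j s * (jw_sign j s * z) = z" by (simp add: * flip: mult.assoc)
qed

lemma cmod_jw_sign [simp]: "cmod (jw_sign j s) = 1"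
  by (simp add: jw_sign_def norm_power)

lemma bit_set_nat [simp]: "bit (set_bit k s) j \<longleftrightarrow> bit s j \<or> k = j" for s :: nat
  by (auto simp: bit_simps)

lemma bit_unset_nat [simp]: "bit (unset_bit k s) j \<longleftrightarrow> bit s j \<and> k \<noteq> j" for s :: nat
  by (auto simp: bit_simps)

text \<open>In the product form, changing bit k alters exactly the factor with index k, which is
  present precisely when k < j.\<close>

lemma jw_sign_set:
  "\<not> bit s k \<Longrightarrow> jw_sign j (set_bit k s) = (if k < j then - jw_sign j s else jw_sign j s)"
proof -
  assume k: "\<not> bit s k"
  have "jw_sign j (set_bit k s)
      = (\<Prod>l<j. (if bit s l then -1 else 1) * (if l = k then -1 else 1))"
    unfolding jw_sign_prod using k by (intro prod.cong) auto
  then show ?thesis by (simp add: prod.distrib jw_sign_prod)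
qed

lemma jw_sign_unset:
  "bit s k \<Longrightarrow> jw_sign j (unset_bit k s) = (if k < j then - jw_sign j s else jw_sign j s)"
proof -
  assume k: "bit s k"
  have "jw_sign j (unset_bit k s)
      = (\<Prod>l<j. (if bit s l then -1 else 1) * (if l = k then -1 else 1))"
    unfolding jw_sign_prod using k by (intro prod.cong) auto
  then show ?thesis by (simp add: prod.distrib jw_sign_prod)
qed

lemma set_bit_swap: "set_bit j (set_bit k s) = set_bit k (set_bit j s)" for s :: nat
  by (rule bit_eqI) auto

lemma unset_bit_swap: "unset_bit j (unset_bit k s) = unset_bit k (unset_bit j s)" for s :: nat
  by (rule bit_eqI) auto

lemma set_unset_swap: "j \<noteq> k \<Longrightarrow> set_bit j (unset_bit k s) = unset_bit k (set_bit j s)" for s :: nat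
  by (rule bit_eqI) auto

lemma unset_set_same: "\<not> bit s j \<Longrightarrow> unset_bit j (set_bit j s) = s" for s :: nat
  by (rule bit_eqI) auto

lemma set_unset_same: "bit s j \<Longrightarrow> set_bit j (unset_bit j s) = s" for s :: nat
  by (rule bit_eqI) auto

lemma set_bit_plus: "\<not> bit s j \<Longrightarrow> set_bit j s = s + 2 ^ j" for s :: nat
  by (simp add: set_bit_eq)

lemma unset_bit_plus: "bit s j \<Longrightarrow> unset_bit j s + 2 ^ j = s" for s :: nat
  using set_bit_plus[of "unset_bit j s" j] by (simp add: set_unset_same)

lemma unset_bit_id: "\<not> bit s j \<Longrightarrow> unset_bit j s = s" for s :: nat
  by (rule bit_eqI) auto

lemma set_bit_less_pow: "s < 2 ^ n \<Longrightarrow> j < n \<Longrightarrow> set_bit j s < 2 ^ n" for s :: nat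
proof -
  assume "s < 2 ^ n" "j < n"
  then have "take_bit n (set_bit j s) = set_bit j s"
    by (metis take_bit_nat_eq_self_iff take_bit_set_bit_eq not_le)
  then show ?thesis by (simp add: take_bit_nat_eq_self_iff)
qed

lemma unset_bit_less: "s < m \<Longrightarrow> unset_bit j s < m" for s :: nat
  using unset_bit_plus[of s j] unset_bit_id[of s j] by (cases "bit s j") auto

lemma unset_bit_ge_pow: "2 ^ n \<le> s \<Longrightarrow> j < n \<Longrightarrow> 2 ^ n \<le> unset_bit j s" for s :: nat
  using set_bit_less_pow[of "unset_bit j s" n j] unset_bit_id[of s j] set_unset_same[of s j]
  by (cases "bit s j") (auto simp: not_less[symmetric])

text \<open>The operator acts on amplitudes, not on basis vectors: the new amplitude at s comes from
  the state without j, hence the unset bit. Every natural number is a state and every bit an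
  orbital; the dimension 2^n enters only through supports.\<close>

lift_definition fcre :: "nat \<Rightarrow> nat lop" is
  "\<lambda>j f s. if bit s j then jw_sign j s * f (unset_bit j s) else 0"
  by (auto simp: algebra_simps fun_eq_iff)

lift_definition fann :: "nat \<Rightarrow> nat lop" is
  "\<lambda>j f s. if bit s j then 0 else jw_sign j s * f (set_bit j s)"
  by (auto simp: algebra_simps fun_eq_iff)

lemma ap_fcre: "ap (fcre j) f s = (if bit s j then jw_sign j s * f (unset_bit j s) else 0)"
  by transfer simp

lemma ap_fann: "ap (fann j) f s = (if bit s j then 0 else jw_sign j s * f (set_bit j s))"
  by transfer simp

text \<open>For different orbitals, setting the lower one flips the sign of the higher one and not
  conversely, so the two orders differ by exactly one sign. For j = k both sides vanish.\<close>

lemma fann_anticomm: "fann j * fann k = - (fann k * fann j)"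
proof (cases "j = k")
  case True
  then show ?thesis by (intro lop_eqI) (simp add: ap_fann)
next
  case False
  then show ?thesis
    by (intro lop_eqI) (auto simp: ap_fann jw_sign_set set_bit_swap[of j k])
qed

lemma fcre_anticomm: "fcre j * fcre k = - (fcre k * fcre j)"
proof (cases "j = k")
  case True
  then show ?thesis by (intro lop_eqI) (simp add: ap_fcre)
next
  case False
  then show ?thesis
    by (intro lop_eqI) (auto simp: ap_fcre jw_sign_unset unset_bit_swap[of j k])
qed

lemma fann_fcre: "fann j * fcre k = (if j = k then 1 else 0) - fcre k * fann j"
proof (cases "j = k")
  case True
  then show ?thesis
    by (intro lop_eqI)
      (auto simp: ap_fann ap_fcre jw_sign_set jw_sign_unset unset_set_same set_unset_same)
next
  case False
  then show ?thesis
    by (intro lop_eqI) (auto simp: ap_fann ap_fcre jw_sign_set jw_sign_unset set_unset_swap)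
qed

definition fnum :: "nat \<Rightarrow> nat lop" where "fnum l = fcre l * fann l"

lemma ap_fnum: "ap (fnum l) f s = (if bit s l then f s else 0)"
  unfolding fnum_def by (auto simp: ap_fann ap_fcre jw_sign_unset set_unset_same)

text \<open>Monomials of T and of V are both indexed by a pair of orbitals. Treating them as two
  colours of edges allows one combinatorial argument for commutators with mixed letters.\<close>

fun edge_op :: "bool \<Rightarrow> nat \<times> nat \<Rightarrow> nat lop" where
  "edge_op True (j, k) = fcre j * fann k"
| "edge_op False (j, k) = fnum j * fnum k"

text \<open>Moving one bilinear past another on disjoint orbitals takes an even number of
  anticommutations. Number operators are the case of equal indices, so this also settles the
  interaction monomials.\<close>

lemma hop_comm:
  assumes "{j, k} \<inter> {l, m} = {}"
  shows "(fcre j * fann k) * (fcre l * fann m) = (fcre l * fann m) * (fcre j * fann k)"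
proof -
  have "(fcre j * fann k) * (fcre l * fann m) = fcre j * (fann k * fcre l) * fann m"
    by (simp add: mult.assoc)
  also have "\<dots> = - ((fcre j * fcre l) * (fann k * fann m))"
    using assms by (simp add: fann_fcre mult.assoc)
  also have "\<dots> = - (fcre l * (fcre j * fann m) * fann k)"
    by (simp add: fcre_anticomm[of j l] fann_anticomm[of k m] mult.assoc)
  also have "fcre j * fann m = - (fann m * fcre j)"
    using assms by (simp add: fann_fcre)
  finally show ?thesis by (simp add: mult.assoc)
qed

lemma comm_mult_right:
  "a * b = b * a \<Longrightarrow> a * c = c * a \<Longrightarrow> a * (b * c) = (b * c) * (a :: 'r :: ring)"
  by (metis mult.assoc)

lemma edge_op_comm:
  assumes "{fst e, snd e} \<inter> {fst e', snd e'} = {}"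
  shows "edge_op b e * edge_op b' e' = edge_op b' e' * edge_op b e"
proof -
  obtain j k l m where e: "e = (j, k)" "e' = (l, m)" by (metis prod.collapse)
  have num: "fnum x * fnum y = fnum y * fnum x" for x y
    by (rule lop_eqI) (simp add: ap_fnum)
  have hn: "(fcre j * fann k) * fnum x = fnum x * (fcre j * fann k)"
    if "x \<notin> {j, k}" for j k x
    unfolding fnum_def using that by (intro hop_comm) auto
  show ?thesis
  proof (cases b; cases b')
    assume "b" "b'"
    then show ?thesis using assms by (simp add: e hop_comm)
  next
    assume b: "b" "\<not> b'"
    have "(fcre j * fann k) * (fnum l * fnum m) = (fnum l * fnum m) * (fcre j * fann k)"
      using assms by (intro comm_mult_right hn) (auto simp: e)
    with b show ?thesis by (simp add: e)
  next
    assume b: "\<not> b" "b'"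
    have "(fcre l * fann m) * (fnum j * fnum k) = (fnum j * fnum k) * (fcre l * fann m)"
      using assms by (intro comm_mult_right hn) (auto simp: e)
    with b show ?thesis by (simp add: e)
  next
    assume b: "\<not> b" "\<not> b'"
    have "(fnum j * fnum k) * (fnum l * fnum m) = (fnum l * fnum m) * (fnum j * fnum k)"
      by (intro comm_mult_right comm_mult_right[symmetric] num)
    with b show ?thesis by (simp add: e)
  qed
qed

section \<open>Second-quantised generators and their first-quantised amplitudes\<close>

definition gen :: "nat \<Rightarrow> bool \<Rightarrow> (nat \<times> nat \<Rightarrow> complex) \<Rightarrow> nat lop" where
  "gen n b w = (\<Sum>e\<in>{0..<n}\<times>{0..<n}. scop (w e) * edge_op b e)"

text \<open>The vacuum component of \<open>a(x\<^sub>\<eta>) \<dots> a(x\<^sub>1) f\<close>; up to the factor \<open>\<eta>!\<close>, this is the isometry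
  onto antisymmetric wave functions of \<open>\<eta>\<close> particles.\<close>

primrec amp :: "nat list \<Rightarrow> (nat \<Rightarrow> complex) \<Rightarrow> complex" where
  "amp [] f = f 0"
| "amp (x # xs) f = amp xs (ap (fann x) f)"

lemma amp_add: "amp xs (\<lambda>s. f s + g s) = amp xs f + amp xs g"
proof (induction xs arbitrary: f g)
  case (Cons x xs)
  then show ?case by (simp add: ap_add[abs_def])
qed simp

lemma amp_scale: "amp xs (\<lambda>s. c * f s) = c * amp xs f"
proof (induction xs arbitrary: f)
  case (Cons x xs)
  then show ?case by (simp add: ap_scale[abs_def])
qed simp

lemma amp_zero: "amp xs (\<lambda>s. 0) = 0"
  using amp_scale[of xs 0 "\<lambda>_. 0"] by simp

lemma amp_sum: "amp xs (\<lambda>s. \<Sum>i\<in>I. f i s) = (\<Sum>i\<in>I. amp xs (f i))"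
  by (induction I rule: infinite_finite_induct) (auto simp: amp_zero amp_add)

lemma amp_diff: "amp xs (\<lambda>s. f s - g s) = amp xs f - amp xs g"
  using amp_add[of xs f "\<lambda>s. (-1) * g s"] amp_scale[of xs "-1" g] by simp

text \<open>The commutator of \<open>fann x\<close> with \<open>fcre j * fann k\<close> is
  \<open>fann k\<close> if x = j and 0 otherwise: the entry x = j of the list is replaced by k. Once
  all annihilators have been moved through, a creation operator remains on the left, and its vacuum
  component is 0.\<close>

lemma amp_hop:
  "amp xs (ap (fcre j) (ap (fann k) f))
    = (\<Sum>i<length xs. if xs ! i = j then amp (xs[i := k]) f else 0)"
proof (induction xs arbitrary: f)
  case Nil
  then show ?case by (simp add: ap_fcre)
next
  case (Cons x xs)
  have "fann x * (fcre j * fann k) = (fcre j * fann k) * fann x + (if x = j then fann k else 0)"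
  proof -
    have "fann x * (fcre j * fann k) = (fann x * fcre j) * fann k" by (simp add: mult.assoc)
    also have "\<dots> = (if x = j then fann k else 0) - fcre j * (fann x * fann k)"
      by (simp add: fann_fcre algebra_simps)
    finally show ?thesis by (simp add: fann_anticomm[of x k] mult.assoc)
  qed
  from arg_cong[OF this, of "\<lambda>A. ap A f"]
  have "ap (fann x) (ap (fcre j) (ap (fann k) f))
      = (\<lambda>s. ap (fcre j) (ap (fann k) (ap (fann x) f)) s + (if x = j then ap (fann k) f s else 0))"
    by (auto simp: fun_eq_iff split: if_splits)
  then have "amp (x # xs) (ap (fcre j) (ap (fann k) f))
      = amp xs (ap (fcre j) (ap (fann k) (ap (fann x) f))) + (if x = j then amp xs (ap (fann k) f) else 0)"
    by (auto simp: amp_add amp_zero)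
  also have "\<dots> = (\<Sum>i<length (x # xs). if (x # xs) ! i = j then amp ((x # xs)[i := k]) f else 0)"
    by (simp add: Cons.IH sum.lessThan_Suc_shift list_update_code del: sum.lessThan_Suc cong: if_cong)
  finally show ?case .
qed

text \<open>Moving \<open>fann x\<close> through \<open>fnum l\<close> contributes one extra term
  exactly when x = l. The count exceeds one only for lists with repetitions, whose amplitudes vanish
  anyway.\<close>

lemma amp_num: "amp xs (ap (fnum l) f) = of_nat (card {i. i < length xs \<and> xs ! i = l}) * amp xs f"
proof (induction xs arbitrary: f)
  case Nil
  then show ?case by (simp add: ap_fnum)
next
  case (Cons x xs)
  have "ap (fann x) (ap (fnum l) f)
      = (\<lambda>s. ap (fnum l) (ap (fann x) f) s + (if x = l then 1 else 0) * ap (fann x) f s)"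
    by (auto simp: fun_eq_iff ap_fnum ap_fann)
  then have "amp (x # xs) (ap (fnum l) f)
      = amp xs (ap (fnum l) (ap (fann x) f)) + (if x = l then 1 else 0) * amp xs (ap (fann x) f)"
    by (simp only: amp.simps amp_add amp_scale)
  also have "\<dots> = (of_nat (card {i. i < length xs \<and> xs ! i = l}) + (if x = l then 1 else 0)) * amp (x # xs) f"
    by (simp add: Cons.IH algebra_simps)
  also have "of_nat (card {i. i < length xs \<and> xs ! i = l}) + (if x = l then 1 else 0)
      = (of_nat (card {i. i < length (x # xs) \<and> (x # xs) ! i = l}) :: complex)"
  proof -
    have "{i. i < length (x # xs) \<and> (x # xs) ! i = l}
        = (if x = l then {0} else {}) \<union> Suc ` {i. i < length xs \<and> xs ! i = l}"
    proof (rule Set.set_eqI)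
      fix i
      show "i \<in> {i. i < length (x # xs) \<and> (x # xs) ! i = l} \<longleftrightarrow>
          i \<in> (if x = l then {0} else {}) \<union> Suc ` {i. i < length xs \<and> xs ! i = l}"
        by (cases i) auto
    qed
    then show ?thesis by (simp add: card_image card_insert_if)
  qed
  finally show ?case .
qed

lemma amp_hop_gen:
  assumes "xs \<in> configs n \<eta>"
  shows "amp xs (ap (gen n True w) f) = ap (\<Sum>i<\<eta>. slot n (\<lambda>j k. w (j, k)) i) (\<lambda>ys. amp ys f) xs"
proof -
  have len: "length xs = \<eta>" and xs: "\<And>i. i < \<eta> \<Longrightarrow> xs ! i < n"
    using assms by (auto simp: configs_def dest: subsetD[OF _ nth_mem])
  have "amp xs (ap (gen n True w) f)
      = (\<Sum>(j,k)\<in>{0..<n}\<times>{0..<n}. w (j, k) * (\<Sum>i<\<eta>. if xs ! i = j then amp (xs[i := k]) f else 0))"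
    unfolding gen_def ap_sum[abs_def] amp_sum
    by (intro sum.cong refl) (auto simp: amp_scale amp_hop len mulop.rep_eq simp flip: len)
  also have "\<dots> = (\<Sum>i<\<eta>. \<Sum>(j,k)\<in>{0..<n}\<times>{0..<n}. if xs ! i = j then w (j, k) * amp (xs[i := k]) f else 0)"
    unfolding sum_distrib_left split_def by (subst sum.swap) (auto intro!: sum.cong)
  also have "\<dots> = (\<Sum>i<\<eta>. \<Sum>k<n. w (xs ! i, k) * amp (xs[i := k]) f)"
  proof (intro sum.cong refl)
    fix i assume i: "i \<in> {..<\<eta>}"
    have "(\<Sum>(j,k)\<in>{0..<n}\<times>{0..<n}. if xs ! i = j then w (j, k) * amp (xs[i := k]) f else 0)
        = (\<Sum>k<n. \<Sum>j<n. if xs ! i = j then w (j, k) * amp (xs[i := k]) f else 0)"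
      unfolding sum.cartesian_product[symmetric] atLeast0LessThan by (rule sum.swap)
    also have "\<dots> = (\<Sum>k<n. w (xs ! i, k) * amp (xs[i := k]) f)"
      using xs i by simp
    finally show "(\<Sum>(j,k)\<in>{0..<n}\<times>{0..<n}. if xs ! i = j then w (j, k) * amp (xs[i := k]) f else 0)
        = (\<Sum>k<n. w (xs ! i, k) * amp (xs[i := k]) f)" .
  qed
  also have "\<dots> = ap (\<Sum>i<\<eta>. slot n (\<lambda>j k. w (j, k)) i) (\<lambda>ys. amp ys f) xs"
    by (simp add: ap_sum ap_slot)
  finally show ?thesis .
qed

text \<open>Multiplying the two occupation counts yields all ordered pairs of positions. The pairs i
  = j belong there because \<open>fnum l * fnum m\<close> is not normally ordered.\<close>

lemma amp_int_gen:
  assumes "xs \<in> configs n \<eta>"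
  shows "amp xs (ap (gen n False w) f)
    = ap (\<Sum>(i,j)\<in>{..<\<eta>}\<times>{..<\<eta>}. pair_op (\<lambda>j k. w (j, k)) i j) (\<lambda>ys. amp ys f) xs"
proof -
  have len: "length xs = \<eta>" and xs: "\<And>i. i < \<eta> \<Longrightarrow> xs ! i < n"
    using assms by (auto simp: configs_def dest: subsetD[OF _ nth_mem])
  define N where "N = (\<lambda>l. of_nat (card {i. i < \<eta> \<and> xs ! i = l}) :: complex)"
  have N: "N l = (\<Sum>i<\<eta>. if xs ! i = l then 1 else 0)" for l
    unfolding N_def by (simp add: sum.If_cases Int_def conj_commute)
  have "amp xs (ap (gen n False w) f) = (\<Sum>(l,m)\<in>{0..<n}\<times>{0..<n}. w (l, m) * (N l * (N m * amp xs f)))"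
    unfolding gen_def ap_sum[abs_def] amp_sum
    by (intro sum.cong refl) (auto simp: amp_scale amp_num len N_def)
  also have "\<dots> = (\<Sum>(l,m)\<in>{0..<n}\<times>{0..<n}. \<Sum>(i,j)\<in>{..<\<eta>}\<times>{..<\<eta>}.
      if xs ! i = l \<and> xs ! j = m then w (l, m) * amp xs f else 0)"
  proof -
    have "w (l, m) * (N l * (N m * amp xs f)) = (\<Sum>(i,j)\<in>{..<\<eta>}\<times>{..<\<eta>}.
      if xs ! i = l \<and> xs ! j = m then w (l, m) * amp xs f else 0)" for l m
    proof -
      have "N l * N m = (\<Sum>(i,j)\<in>{..<\<eta>}\<times>{..<\<eta>}. if xs ! i = l \<and> xs ! j = m then 1 else 0)"
        unfolding N sum_product sum.cartesian_product by (intro sum.cong) auto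
      then have "w (l, m) * amp xs f * (N l * N m) = (\<Sum>(i,j)\<in>{..<\<eta>}\<times>{..<\<eta>}.
          if xs ! i = l \<and> xs ! j = m then w (l, m) * amp xs f else 0)"
        by (simp add: sum_distrib_left split_def if_distrib cong: if_cong)
      then show ?thesis by (simp add: ac_simps)
    qed
    then show ?thesis by (intro sum.cong refl) auto
  qed
  also have "\<dots> = (\<Sum>(i,j)\<in>{..<\<eta>}\<times>{..<\<eta>}. \<Sum>(l,m)\<in>{0..<n}\<times>{0..<n}.
      if (xs ! i, xs ! j) = (l, m) then w (l, m) * amp xs f else 0)"
    unfolding split_def by (subst sum.swap) (auto intro!: sum.cong)
  also have "\<dots> = (\<Sum>(i,j)\<in>{..<\<eta>}\<times>{..<\<eta>}. w (xs ! i, xs ! j) * amp xs f)"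
  proof (intro sum.cong refl, clarify)
    fix i j assume ij: "i < \<eta>" "j < \<eta>"
    have "(\<Sum>(l,m)\<in>{0..<n}\<times>{0..<n}. if (xs ! i, xs ! j) = (l, m) then w (l, m) * amp xs f else 0)
        = (\<Sum>e\<in>{0..<n}\<times>{0..<n}. if (xs ! i, xs ! j) = e then w e * amp xs f else 0)"
      by (intro sum.cong refl) (simp add: split_def prod_eq_iff)
    also have "\<dots> = w (xs ! i, xs ! j) * amp xs f" using xs ij by simp
    finally show "(\<Sum>(l,m)\<in>{0..<n}\<times>{0..<n}. if (xs ! i, xs ! j) = (l, m) then w (l, m) * amp xs f else 0)
        = w (xs ! i, xs ! j) * amp xs f" .
  qed
  also have "\<dots> = ap (\<Sum>(i,j)\<in>{..<\<eta>}\<times>{..<\<eta>}. pair_op (\<lambda>j k. w (j, k)) i j) (\<lambda>ys. amp ys f) xs"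
    by (simp add: ap_sum pair_op_def split_def)
  finally show ?thesis .
qed

lemma num_el_set: "\<not> bit s x \<Longrightarrow> x < n \<Longrightarrow> num_el n (set_bit x s) = num_el n s + 1"
proof -
  assume s: "\<not> bit s x" "x < n"
  then have "num_el n (set_bit x s) = (\<Sum>j<n. occ s j + (if j = x then 1 else 0))"
    unfolding num_el_def by (intro sum.cong) (auto simp: occ_bit)
  then show ?thesis using s by (simp add: sum.distrib num_el_def)
qed

lemma num_el_unset: "bit s x \<Longrightarrow> x < n \<Longrightarrow> num_el n (unset_bit x s) + 1 = num_el n s"
  using num_el_set[of "unset_bit x s" x n] by (simp add: set_unset_same)

definition in_sector :: "nat \<Rightarrow> nat \<Rightarrow> (nat \<Rightarrow> complex) \<Rightarrow> bool" where
  "in_sector n \<eta> f \<longleftrightarrow> (\<forall>s. f s \<noteq> 0 \<longrightarrow> s < 2 ^ n \<and> num_el n s = \<eta>)"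

lemma in_sector_fann:
  "in_sector n (Suc \<eta>) f \<Longrightarrow> x < n \<Longrightarrow> in_sector n \<eta> (ap (fann x) f)"
  unfolding in_sector_def
proof (intro allI impI)
  fix s assume f: "\<forall>s. f s \<noteq> 0 \<longrightarrow> s < 2 ^ n \<and> num_el n s = Suc \<eta>" and x: "x < n"
    and "ap (fann x) f s \<noteq> 0"
  then have s: "\<not> bit s x" "f (set_bit x s) \<noteq> 0" by (auto simp: ap_fann split: if_splits)
  with f have "set_bit x s < 2 ^ n" "num_el n (set_bit x s) = Suc \<eta>" by auto
  with s x show "s < 2 ^ n \<and> num_el n s = \<eta>"
    by (auto simp: num_el_set) (simp add: set_bit_plus)
qed

text \<open>This is the expectation of the total number operator: the squared norm of
  \<open>fann x\<close> applied to f is the weight of f on states containing x, and each state of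
  the sector is counted once for every one of its \<eta> electrons.\<close>

lemma sum_fann_norm:
  assumes "in_sector n \<eta> f"
  shows "(\<Sum>x<n. (l2 {..<2^n} (ap (fann x) f))\<^sup>2) = \<eta> * (l2 {..<2^n} f)\<^sup>2"
proof -
  have *: "(l2 {..<2^n} (ap (fann x) f))\<^sup>2 = (\<Sum>s<2^n. occ s x * (cmod (f s))\<^sup>2)" if x: "x < n" for x
  proof -
    have "(l2 {..<2^n} (ap (fann x) f))\<^sup>2 = (\<Sum>s\<in>{s. s < 2^n \<and> \<not> bit s x}. (cmod (f (set_bit x s)))\<^sup>2)"
      unfolding l2_power2 by (intro sum.mono_neutral_cong_right) (auto simp: ap_fann norm_mult)
    also have "\<dots> = (\<Sum>s\<in>{s. s < 2^n \<and> bit s x}. (cmod (f s))\<^sup>2)"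
      by (rule sum.reindex_bij_witness[where i="unset_bit x" and j="set_bit x"])
        (auto simp: set_unset_same unset_set_same x set_bit_less_pow unset_bit_less)
    also have "\<dots> = (\<Sum>s<2^n. occ s x * (cmod (f s))\<^sup>2)"
      by (intro sum.mono_neutral_cong_left) (auto simp: occ_bit)
    finally show ?thesis .
  qed
  have "(\<Sum>x<n. (l2 {..<2^n} (ap (fann x) f))\<^sup>2) = (\<Sum>s<2^n. \<Sum>x<n. occ s x * (cmod (f s))\<^sup>2)"
    by (subst sum.swap) (simp add: *)
  also have "\<dots> = (\<Sum>s<2^n. real (num_el n s) * (cmod (f s))\<^sup>2)"
    by (simp add: num_el_def sum_distrib_right)
  also have "\<dots> = (\<Sum>s<2^n. \<eta> * (cmod (f s))\<^sup>2)"
    using assms by (intro sum.cong) (auto simp: in_sector_def)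
  finally show ?thesis by (simp add: l2_power2 sum_distrib_left)
qed

lemma num_el_eq_0:
  assumes "s < 2 ^ n" "num_el n s = 0" shows "s = 0"
proof (rule bit_eqI)
  fix j
  have "\<not> bit s j" 
  proof (cases "j < n")
    case True
    then show ?thesis using assms by (auto simp: num_el_def occ_bit)
  next
    case False
    then show ?thesis using assms(1)
      by (metis bit_take_bit_iff take_bit_nat_eq_self_iff)
  qed
  then show "bit s j = bit (0::nat) j" by simp
qed

text \<open>Stripping the first position lowers the electron number by one and, summed over all
  orbitals, multiplies the squared norm by the current electron number. The factors \<eta>, \<eta> -
  1, ..., 1 make up the factorial.\<close>

lemma amp_norm:
  assumes "in_sector n \<eta> f"
  shows "(l2 (configs n \<eta>) (\<lambda>xs. amp xs f))\<^sup>2 = fact \<eta> * (l2 {..<2^n} f)\<^sup>2"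
  using assms
proof (induction \<eta> arbitrary: f)
  case 0
  have "f s = 0" if "s \<noteq> 0" for s
    using 0 num_el_eq_0[of s n] that unfolding in_sector_def by metis
  then have "(\<Sum>s<2^n. (cmod (f s))\<^sup>2) = (\<Sum>s\<in>{0}. (cmod (f s))\<^sup>2)"
    by (intro sum.mono_neutral_right) auto
  moreover have "configs n 0 = {[]}" by (auto simp: configs_def)
  ultimately show ?case by (simp add: l2_power2)
next
  case (Suc \<eta>)
  have "configs n (Suc \<eta>) = (\<lambda>(x, xs). x # xs) ` ({..<n} \<times> configs n \<eta>)"
    by (auto simp: configs_def length_Suc_conv image_iff)
  moreover have "inj_on (\<lambda>(x, xs). x # xs) ({..<n} \<times> configs n \<eta>)"
    by (auto simp: inj_on_def)
  ultimately have "(l2 (configs n (Suc \<eta>)) (\<lambda>xs. amp xs f))\<^sup>2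
      = (\<Sum>x<n. (l2 (configs n \<eta>) (\<lambda>xs. amp xs (ap (fann x) f)))\<^sup>2)"
    by (simp add: l2_power2 sum.reindex sum.cartesian_product split_def)
  also have "\<dots> = (\<Sum>x<n. fact \<eta> * (l2 {..<2^n} (ap (fann x) f))\<^sup>2)"
    using Suc.prems by (intro sum.cong refl Suc.IH in_sector_fann) auto
  also have "\<dots> = fact (Suc \<eta>) * (l2 {..<2^n} f)\<^sup>2"
    by (simp add: sum_fann_norm[OF Suc.prems] flip: sum_distrib_left)
  finally show ?case .
qed

section \<open>Matrix exponentials\<close>

lemma mult_square_carrier [simp]:
  "A \<in> carrier_mat m m \<Longrightarrow> B \<in> carrier_mat m m \<Longrightarrow> A * B \<in> carrier_mat m m"
  by (rule mult_carrier_mat)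

lemma mult_index:
  assumes "A \<in> carrier_mat m m" "B \<in> carrier_mat m m" "i < m" "j < m"
  shows "(A * B) $$ (i, j) = (\<Sum>l<m. A $$ (i, l) * B $$ (l, j))"
  using assms by (auto simp: scalar_prod_def atLeast0LessThan)

lemma mult_vec_index:
  assumes "A \<in> carrier_mat m m" "v \<in> carrier_vec m" "i < m"
  shows "(A *\<^sub>v v) $ i = (\<Sum>l<m. A $$ (i, l) * v $ l)"
  using assms by (auto simp: scalar_prod_def atLeast0LessThan)

definition expo :: "complex mat \<Rightarrow> complex \<Rightarrow> complex mat" where
  "expo X z = mexp (z \<cdot>\<^sub>m X)"

lemma expo_carrier [simp]: "X \<in> carrier_mat m m \<Longrightarrow> expo X z \<in> carrier_mat m m"
  by (auto simp: expo_def mexp_def)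

lemma smult_pow_index:
  fixes X :: "complex mat"
  assumes "X \<in> carrier_mat m m" "i < m" "j < m"
  shows "((z \<cdot>\<^sub>m X) ^\<^sub>m k) $$ (i, j) = z ^ k * (X ^\<^sub>m k) $$ (i, j)"
  using assms(2,3)
proof (induction k arbitrary: i j)
  case (Suc k)
  have "((z \<cdot>\<^sub>m X) ^\<^sub>m Suc k) $$ (i, j) = (\<Sum>l<m. ((z \<cdot>\<^sub>m X) ^\<^sub>m k) $$ (i, l) * (z \<cdot>\<^sub>m X) $$ (l, j))"
    using assms(1) Suc.prems mult_index[of "(z \<cdot>\<^sub>m X) ^\<^sub>m k" m "z \<cdot>\<^sub>m X" i j] by simp
  also have "\<dots> = z ^ Suc k * (\<Sum>l<m. (X ^\<^sub>m k) $$ (i, l) * X $$ (l, j))"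
    unfolding sum_distrib_left using assms(1) Suc by (intro sum.cong) (auto simp: ac_simps)
  also have "(\<Sum>l<m. (X ^\<^sub>m k) $$ (i, l) * X $$ (l, j)) = (X ^\<^sub>m Suc k) $$ (i, j)"
    using assms(1) Suc.prems mult_index[of "X ^\<^sub>m k" m X i j] by simp
  finally show ?case .
qed (use assms in auto)

lemma pow_mat_comm: "X \<in> carrier_mat m m \<Longrightarrow> X * X ^\<^sub>m k = X ^\<^sub>m k * X"
proof (induction k)
  case (Suc k)
  then show ?case
    using assoc_mult_mat[of X m m "X ^\<^sub>m k" m X m] by simp
qed auto

text \<open>Any geometric bound serves, since it only provides convergence of the exponential
  series. The constant is m times the sum of all absolute entries: a product has m summands.\<close>

lemma pow_index_bound:
  assumes X: "X \<in> carrier_mat m m"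
  obtains B where "0 \<le> B" "\<And>k i j. i < m \<Longrightarrow> j < m \<Longrightarrow> cmod ((X ^\<^sub>m k) $$ (i, j)) \<le> B ^ k"
proof
  define b where "b = (\<Sum>i<m. \<Sum>j<m. cmod (X $$ (i, j)))"
  have b: "cmod (X $$ (i, j)) \<le> b" if "i < m" "j < m" for i j
    unfolding b_def
    by (rule order_trans[OF member_le_sum[of j] member_le_sum[of i]]) (use that in \<open>auto intro: sum_nonneg\<close>)
  have b0: "0 \<le> b" unfolding b_def by (intro sum_nonneg) auto
  then show "0 \<le> real m * b" by simp
  fix k i j assume "i < m" "j < m"
  then show "cmod ((X ^\<^sub>m k) $$ (i, j)) \<le> (real m * b) ^ k"
  proof (induction k arbitrary: i j)
    case (Suc k)
    have "cmod ((X ^\<^sub>m Suc k) $$ (i, j)) = cmod (\<Sum>l<m. (X ^\<^sub>m k) $$ (i, l) * X $$ (l, j))"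
      using X Suc.prems mult_index[of "X ^\<^sub>m k" m X i j] by simp
    also have "\<dots> \<le> (\<Sum>l<m. (real m * b) ^ k * b)"
      using Suc b b0 by (intro sum_norm_le) (auto simp: norm_mult intro!: mult_mono)
    finally show ?case by (simp add: mult_ac)
  qed (use X in auto)
qed

definition expo_coeff :: "complex mat \<Rightarrow> nat \<Rightarrow> nat \<Rightarrow> nat \<Rightarrow> complex" where
  "expo_coeff X i j k = (X ^\<^sub>m k) $$ (i, j) / fact k"

lemma summable_expo:
  assumes X: "X \<in> carrier_mat m m" "i < m" "j < m"
  shows "summable (\<lambda>k. expo_coeff X i j k * z ^ k)"
proof -
  obtain B where B: "0 \<le> B" "\<And>k i j. i < m \<Longrightarrow> j < m \<Longrightarrow> cmod ((X ^\<^sub>m k) $$ (i, j)) \<le> B ^ k"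
    using pow_index_bound[OF X(1)] by blast
  have "summable (\<lambda>k. inverse (fact k) * (B * cmod z) ^ k)" by (rule summable_exp)
  moreover have "norm (expo_coeff X i j k * z ^ k) \<le> inverse (fact k) * (B * cmod z) ^ k" for k
    using mult_right_mono[OF B(2)[OF X(2,3), of k], of "cmod z ^ k / fact k"]
    by (simp add: expo_coeff_def norm_mult norm_divide norm_power power_mult_distrib field_simps)
  ultimately show ?thesis by (rule summable_comparison_test'[where N=0])
qed

lemma expo_index:
  assumes "X \<in> carrier_mat m m" "i < m" "j < m"
  shows "expo X z $$ (i, j) = (\<Sum>k. expo_coeff X i j k * z ^ k)"
  using assms by (simp add: expo_def mexp_def smult_pow_index expo_coeff_def mult.commute)

lemma expo_0: 
  assumes "X \<in> carrier_mat m m" shows "expo X 0 = 1\<^sub>m m"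
proof (rule eq_matI)
  fix i j assume "i < dim_row (1\<^sub>m m :: complex mat)" "j < dim_col (1\<^sub>m m :: complex mat)"
  then have "expo X 0 $$ (i, j) = expo_coeff X i j 0" "i < m" "j < m"
    using assms by (auto simp: expo_index powser_zero simp del: power_0_left)
  then show "expo X 0 $$ (i, j) = 1\<^sub>m m $$ (i, j)"
    using assms by (simp add: expo_coeff_def)
qed (use expo_carrier[OF assms, of 0] in auto)

text \<open>Both products have the same power series, that of the derivative. One computation thus
  supplies the derivative of \<open>expo\<close> and the fact that a matrix commutes with its
  exponential.\<close>

lemma expo_mult_index:
  assumes X: "X \<in> carrier_mat m m" and ij: "i < m" "j < m"
  shows "(expo X z * X) $$ (i, j) = (\<Sum>k. (X ^\<^sub>m Suc k) $$ (i, j) / fact k * z ^ k)"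
    and "(X * expo X z) $$ (i, j) = (\<Sum>k. (X ^\<^sub>m Suc k) $$ (i, j) / fact k * z ^ k)"
proof -
  have s: "summable (\<lambda>k. expo_coeff X i l k * z ^ k)" "summable (\<lambda>k. expo_coeff X l j k * z ^ k)" if "l < m" for l
    using that X ij by (auto intro: summable_expo)
  have "(expo X z * X) $$ (i, j) = (\<Sum>l<m. (\<Sum>k. expo_coeff X i l k * z ^ k) * X $$ (l, j))"
    using X ij by (subst mult_index[of _ m]) (auto simp: expo_index[OF X])
  also have "\<dots> = (\<Sum>l<m. \<Sum>k. expo_coeff X i l k * z ^ k * X $$ (l, j))"
    by (intro sum.cong refl suminf_mult2 s) auto
  also have "\<dots> = (\<Sum>k. \<Sum>l<m. expo_coeff X i l k * z ^ k * X $$ (l, j))"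
    by (intro suminf_sum[symmetric] summable_mult2 s) auto
  also have "\<dots> = (\<Sum>k. (X ^\<^sub>m Suc k) $$ (i, j) / fact k * z ^ k)"
  proof (intro suminf_cong)
    fix k
    have "(X ^\<^sub>m Suc k) $$ (i, j) = (\<Sum>l<m. (X ^\<^sub>m k) $$ (i, l) * X $$ (l, j))"
      using X ij mult_index[of "X ^\<^sub>m k" m X i j] by simp
    then show "(\<Sum>l<m. expo_coeff X i l k * z ^ k * X $$ (l, j)) = (X ^\<^sub>m Suc k) $$ (i, j) / fact k * z ^ k"
      by (simp add: expo_coeff_def sum_distrib_left sum_distrib_right sum_divide_distrib field_simps)
  qed
  finally show "(expo X z * X) $$ (i, j) = (\<Sum>k. (X ^\<^sub>m Suc k) $$ (i, j) / fact k * z ^ k)" .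
  have "(X * expo X z) $$ (i, j) = (\<Sum>l<m. X $$ (i, l) * (\<Sum>k. expo_coeff X l j k * z ^ k))"
    using X ij by (subst mult_index[of _ m]) (auto simp: expo_index[OF X])
  also have "\<dots> = (\<Sum>l<m. \<Sum>k. X $$ (i, l) * (expo_coeff X l j k * z ^ k))"
    by (intro sum.cong refl suminf_mult[symmetric] s) auto
  also have "\<dots> = (\<Sum>k. \<Sum>l<m. X $$ (i, l) * (expo_coeff X l j k * z ^ k))"
    by (intro suminf_sum[symmetric] summable_mult s) auto
  also have "\<dots> = (\<Sum>k. (X ^\<^sub>m Suc k) $$ (i, j) / fact k * z ^ k)"
  proof (intro suminf_cong)
    fix k
    have "(X ^\<^sub>m Suc k) $$ (i, j) = (\<Sum>l<m. X $$ (i, l) * (X ^\<^sub>m k) $$ (l, j))"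
      using X ij mult_index[of X m "X ^\<^sub>m k" i j] by (simp add: pow_mat_comm[OF X, symmetric])
    then show "(\<Sum>l<m. X $$ (i, l) * (expo_coeff X l j k * z ^ k)) = (X ^\<^sub>m Suc k) $$ (i, j) / fact k * z ^ k"
      by (simp add: expo_coeff_def sum_distrib_left sum_distrib_right sum_divide_distrib field_simps)
  qed
  finally show "(X * expo X z) $$ (i, j) = (\<Sum>k. (X ^\<^sub>m Suc k) $$ (i, j) / fact k * z ^ k)" .
qed

lemma expo_comm:
  assumes X: "X \<in> carrier_mat m m" shows "X * expo X z = expo X z * X"
proof -
  have c: "X * expo X z \<in> carrier_mat m m" "expo X z * X \<in> carrier_mat m m"
    using X expo_carrier[OF X, of z] by auto
  show ?thesis
  proof (rule eq_matI)
    fix i j assume "i < dim_row (expo X z * X)" "j < dim_col (expo X z * X)"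
    then show "(X * expo X z) $$ (i, j) = (expo X z * X) $$ (i, j)"
      using c by (simp only: expo_mult_index[OF X] carrier_matD)
  qed (use c in \<open>simp_all only: carrier_matD\<close>)
qed

text \<open>Differentiation is entrywise and in a complex variable, so that entries are entire
  functions. The dimensions are part of the predicate and travel along with the product and chain
  rules.\<close>

definition mat_deriv :: "nat \<Rightarrow> (complex \<Rightarrow> complex mat) \<Rightarrow> complex mat \<Rightarrow> complex \<Rightarrow> bool" where
  "mat_deriv m F F' z \<longleftrightarrow> (\<forall>w. F w \<in> carrier_mat m m) \<and> F' \<in> carrier_mat m m \<and>
     (\<forall>i<m. \<forall>j<m. ((\<lambda>w. F w $$ (i, j)) has_field_derivative F' $$ (i, j)) (at z))"

lemma mat_deriv_carrier:
  "mat_deriv m F F' z \<Longrightarrow> F w \<in> carrier_mat m m" "mat_deriv m F F' z \<Longrightarrow> F' \<in> carrier_mat m m"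
  by (auto simp: mat_deriv_def)

lemma mat_deriv_expo:
  assumes X: "X \<in> carrier_mat m m" shows "mat_deriv m (expo X) (expo X z * X) z"
  unfolding mat_deriv_def
proof (intro conjI allI impI)
  fix i j assume ij: "i < m" "j < m"
  have "((\<lambda>z. \<Sum>k. expo_coeff X i j k * z ^ k) has_field_derivative (\<Sum>k. diffs (expo_coeff X i j) k * z ^ k)) (at z)"
    by (rule termdiffs_strong_converges_everywhere) (rule summable_expo[OF X ij])
  moreover have "diffs (expo_coeff X i j) k = (X ^\<^sub>m Suc k) $$ (i, j) / fact k" for k
    by (simp add: diffs_def expo_coeff_def del: pow_mat.simps of_nat_Suc)
  ultimately show "((\<lambda>w. expo X w $$ (i, j)) has_field_derivative (expo X z * X) $$ (i, j)) (at z)"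
    by (simp add: expo_index[OF X ij] expo_mult_index[OF X ij])
qed (use X in auto)

lemma mat_deriv_chain:
  assumes F: "mat_deriv m F F' (a + c * z)"
  shows "mat_deriv m (\<lambda>w. F (a + c * w)) (c \<cdot>\<^sub>m F') z"
  unfolding mat_deriv_def
proof (intro conjI allI impI)
  fix i j assume ij: "i < m" "j < m"
  then have "((\<lambda>w. F w $$ (i, j)) has_field_derivative F' $$ (i, j)) (at (a + c * z))"
    using F by (auto simp: mat_deriv_def)
  then have "((\<lambda>w. F (a + c * w) $$ (i, j)) has_field_derivative F' $$ (i, j) * c) (at z)"
    by (rule DERIV_chain2) (auto intro!: derivative_eq_intros)
  then show "((\<lambda>w. F (a + c * w) $$ (i, j)) has_field_derivative (c \<cdot>\<^sub>m F') $$ (i, j)) (at z)"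
    using mat_deriv_carrier(2)[OF F] ij by (simp add: mult.commute)
qed (use mat_deriv_carrier[OF F] in auto)

lemma mat_deriv_const: "A \<in> carrier_mat m m \<Longrightarrow> mat_deriv m (\<lambda>_. A) (0\<^sub>m m m) z"
  by (auto simp: mat_deriv_def)

lemma mat_deriv_mult:
  assumes F: "mat_deriv m F F' z" and G: "mat_deriv m G G' z"
  shows "mat_deriv m (\<lambda>w. F w * G w) (F' * G z + F z * G') z"
  unfolding mat_deriv_def
proof (intro conjI allI impI)
  note c = mat_deriv_carrier[OF F] mat_deriv_carrier[OF G]
  have c2: "F' * G z \<in> carrier_mat m m" "F z * G' \<in> carrier_mat m m" using c by auto
  fix i j assume ij: "i < m" "j < m"
  have "((\<lambda>w. \<Sum>l<m. F w $$ (i, l) * G w $$ (l, j)) has_field_derivative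
      (\<Sum>l<m. F' $$ (i, l) * G z $$ (l, j) + F z $$ (i, l) * G' $$ (l, j))) (at z)"
    by (intro DERIV_sum) (use F G ij in \<open>auto simp: mat_deriv_def intro!: derivative_eq_intros\<close>)
  moreover have "(F' * G z + F z * G') $$ (i, j)
      = (\<Sum>l<m. F' $$ (i, l) * G z $$ (l, j) + F z $$ (i, l) * G' $$ (l, j))"
    using c c2 ij carrier_matD[OF c(1)] carrier_matD[OF c(4)]
    by (simp add: sum.distrib mult_index del: index_mult_mat(1))
  moreover have "(F w * G w) $$ (i, j) = (\<Sum>l<m. F w $$ (i, l) * G w $$ (l, j))" for w
    by (rule mult_index[OF c(1) c(3) ij])
  ultimately show "((\<lambda>w. (F w * G w) $$ (i, j)) has_field_derivative (F' * G z + F z * G') $$ (i, j)) (at z)"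
    by simp
qed (use mat_deriv_carrier[OF F] mat_deriv_carrier[OF G] in auto)

lemma mat_deriv_diff:
  assumes F: "mat_deriv m F F' z" and G: "mat_deriv m G G' z"
  shows "mat_deriv m (\<lambda>w. F w - G w) (F' - G') z"
  unfolding mat_deriv_def
proof (intro conjI allI impI)
  note c = mat_deriv_carrier[OF F] mat_deriv_carrier[OF G]
  fix i j assume ij: "i < m" "j < m"
  have "((\<lambda>w. F w $$ (i, j) - G w $$ (i, j)) has_field_derivative (F' $$ (i, j) - G' $$ (i, j))) (at z)"
    using F G ij by (auto simp: mat_deriv_def intro!: derivative_eq_intros)
  moreover have "(F w - G w) $$ (i, j) = F w $$ (i, j) - G w $$ (i, j)" for w
    using c(1)[of w] c(3)[of w] ij by simp
  ultimately show "((\<lambda>w. (F w - G w) $$ (i, j)) has_field_derivative (F' - G') $$ (i, j)) (at z)"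
    using c ij by simp
qed (use mat_deriv_carrier[OF F] mat_deriv_carrier[OF G] in \<open>auto intro!: minus_carrier_mat\<close>)

lemma mat_deriv_unique_zero:
  assumes F: "\<And>z. mat_deriv m F (0\<^sub>m m m) z" shows "F z = F w"
proof (rule eq_matI)
  note c = mat_deriv_carrier(1)[OF F]
  fix i j assume "i < dim_row (F w)" "j < dim_col (F w)"
  then have ij: "i < m" "j < m" using c[of w] by auto
  then have "((\<lambda>w. F w $$ (i, j)) has_field_derivative 0) (at z)" for z
    using F[of z] by (auto simp: mat_deriv_def)
  then have "\<exists>c. \<forall>x\<in>UNIV. F x $$ (i, j) = c"
    by (intro has_field_derivative_zero_constant) auto
  then show "F z $$ (i, j) = F w $$ (i, j)" by auto
qed (use mat_deriv_carrier(1)[OF F, of z] mat_deriv_carrier(1)[OF F, of w] in auto)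

text \<open>The product has derivative 0 everywhere and equals the identity at 0; this replaces a
  Cauchy product of two matrix series.\<close>

lemma expo_neg:
  assumes X: "X \<in> carrier_mat m m" shows "expo X (- z) * expo X z = 1\<^sub>m m"
proof -
  have E: "expo X w \<in> carrier_mat m m" for w using X by simp
  have "mat_deriv m (\<lambda>w. expo X (- w) * expo X w) (0\<^sub>m m m) z" for z
  proof -
    have "mat_deriv m (\<lambda>w. expo X (0 + (-1) * w)) ((-1) \<cdot>\<^sub>m (expo X (- z) * X)) z"
      by (rule mat_deriv_chain) (use mat_deriv_expo[OF X, of "- z"] in simp)
    from mat_deriv_mult[OF this mat_deriv_expo[OF X]]
    have "mat_deriv m (\<lambda>w. expo X (- w) * expo X w)
      ((-1) \<cdot>\<^sub>m (expo X (- z) * X) * expo X z + expo X (- z) * (expo X z * X)) z" by simp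
    moreover have "(-1) \<cdot>\<^sub>m (expo X (- z) * X) * expo X z + expo X (- z) * (expo X z * X) = 0\<^sub>m m m"
    proof -
      have "(-1) \<cdot>\<^sub>m (expo X (- z) * X) * expo X z = (-1) \<cdot>\<^sub>m (expo X (- z) * (X * expo X z))"
        using X E[of "-z"] E[of z]
        by (subst mult_smult_assoc_mat[of _ m m _ m]) (auto simp: assoc_mult_mat[of _ m m _ m _ m])
      moreover have "(-1) \<cdot>\<^sub>m A + A = 0\<^sub>m m m" if "A \<in> carrier_mat m m" for A :: "complex mat"
        using that by (intro eq_matI) auto
      ultimately show ?thesis using X E[of "-z"] E[of z] by (simp add: expo_comm[OF X])
    qed
    ultimately show ?thesis by simp
  qed
  from mat_deriv_unique_zero[OF this, of z 0] show ?thesis by (simp add: expo_0[OF X])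
qed

lemma adj_carrier [simp]: "A \<in> carrier_mat m m' \<Longrightarrow> adj A \<in> carrier_mat m' m"
  by (auto simp: adj_def)

lemma adj_index [simp]: "A \<in> carrier_mat m m' \<Longrightarrow> i < m' \<Longrightarrow> j < m \<Longrightarrow> adj A $$ (i, j) = cnj (A $$ (j, i))"
  by (auto simp: adj_def)

lemma adj_mult:
  assumes A: "A \<in> carrier_mat m m" and B: "B \<in> carrier_mat m m" shows "adj (A * B) = adj B * adj A"
proof (rule eq_matI)
  fix i j assume "i < dim_row (adj B * adj A)" "j < dim_col (adj B * adj A)"
  then have ij: "i < m" "j < m" using adj_carrier[OF A] adj_carrier[OF B] by auto
  have "adj (A * B) $$ (i, j) = (\<Sum>l<m. cnj (A $$ (j, l)) * cnj (B $$ (l, i)))"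
    using A B ij by (subst adj_index[of _ m m]) (auto simp: mult_index simp del: index_mult_mat(1))
  also have "\<dots> = (adj B * adj A) $$ (i, j)"
    using A B ij by (subst mult_index[of _ m]) (auto intro!: sum.cong simp: mult.commute)
  finally show "adj (A * B) $$ (i, j) = (adj B * adj A) $$ (i, j)" .
qed (use A B in \<open>auto simp: adj_def\<close>)

lemma adj_expo:
  assumes X: "X \<in> carrier_mat m m" and h: "adj X = X" shows "adj (expo X z) = expo X (cnj z)"
proof (rule eq_matI)
  have p: "(X ^\<^sub>m k) $$ (i, j) = cnj ((X ^\<^sub>m k) $$ (j, i))" if "i < m" "j < m" for i j k
  proof -
    have "adj (X ^\<^sub>m k) = X ^\<^sub>m k"
    proof (induction k)
      case 0
      show ?case using X by (intro eq_matI) (auto simp: adj_def)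
    next
      case (Suc k)
      then show ?case using X h by (simp add: adj_mult[of _ m] pow_mat_comm[OF X])
    qed
    then show ?thesis using adj_index[of "X ^\<^sub>m k" m m i j] X that by simp
  qed
  note E = expo_carrier[OF X]
  fix i j assume "i < dim_row (expo X (cnj z))" "j < dim_col (expo X (cnj z))"
  then have ij: "i < m" "j < m" using E[of "cnj z"] by auto
  have "adj (expo X z) $$ (i, j) = cnj (\<Sum>k. expo_coeff X j i k * z ^ k)"
    using E[of z] ij by (simp add: expo_index[OF X])
  also have "\<dots> = (\<Sum>k. cnj (expo_coeff X j i k * z ^ k))"
    using sums_cnj summable_expo[OF X ij(2,1), of z] by (metis sums_unique summable_sums)
  also have "\<dots> = (\<Sum>k. expo_coeff X i j k * cnj z ^ k)"
    using p[OF ij] by (intro suminf_cong) (simp add: expo_coeff_def)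
  finally show "adj (expo X z) $$ (i, j) = expo X (cnj z) $$ (i, j)"
    by (simp add: expo_index[OF X ij])
qed (use carrier_matD[OF expo_carrier[OF X]] in \<open>simp_all add: adj_def\<close>)

section \<open>States supported on a set of basis vectors, and matrix elements between them\<close>

definition cip :: "nat \<Rightarrow> complex Matrix.vec \<Rightarrow> complex Matrix.vec \<Rightarrow> complex" where
  "cip m \<phi> \<psi> = (\<Sum>s<m. cnj (\<phi> $ s) * \<psi> $ s)"

definition sector_state :: "nat \<Rightarrow> nat set \<Rightarrow> complex Matrix.vec \<Rightarrow> bool" where
  "sector_state m K \<psi> \<longleftrightarrow> \<psi> \<in> carrier_vec m \<and> (\<forall>s<m. s \<notin> K \<longrightarrow> \<psi> $ s = 0) \<and>
     (\<Sum>s<m. (cmod (\<psi> $ s))\<^sup>2) = 1"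

text \<open>A bound on all matrix elements instead of their supremum: it behaves well even if no
  state exists, and questions about \<open>Sup\<close> are postponed to the end.\<close>

definition form_bound :: "nat \<Rightarrow> nat set \<Rightarrow> real \<Rightarrow> complex mat \<Rightarrow> bool" where
  "form_bound m K c X \<longleftrightarrow> (\<forall>\<phi> \<psi>. sector_state m K \<phi> \<longrightarrow> sector_state m K \<psi> \<longrightarrow> cmod (cip m \<phi> (X *\<^sub>v \<psi>)) \<le> c)"

definition preserves :: "nat \<Rightarrow> nat set \<Rightarrow> complex mat \<Rightarrow> bool" where
  "preserves m K X \<longleftrightarrow> (\<forall>i<m. \<forall>j<m. j \<in> K \<longrightarrow> i \<notin> K \<longrightarrow> X $$ (i, j) = 0)"

abbreviation mcomm :: "complex mat \<Rightarrow> complex mat \<Rightarrow> complex mat" where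
  "mcomm X Z \<equiv> X * Z - Z * X"

lemma sector_state_carrier: "sector_state m K \<psi> \<Longrightarrow> \<psi> \<in> carrier_vec m"
  by (simp add: sector_state_def)

lemma cip_adj:
  assumes A: "A \<in> carrier_mat m m" and v: "\<phi> \<in> carrier_vec m" "\<psi> \<in> carrier_vec m"
  shows "cip m \<phi> (A *\<^sub>v \<psi>) = cip m (adj A *\<^sub>v \<phi>) \<psi>"
proof -
  have "cip m \<phi> (A *\<^sub>v \<psi>) = (\<Sum>s<m. \<Sum>r<m. cnj (\<phi> $ s) * A $$ (s, r) * \<psi> $ r)"
    unfolding cip_def using A v
    by (intro sum.cong refl) (simp add: mult_vec_index sum_distrib_left mult.assoc del: index_mult_mat_vec)
  also have "\<dots> = (\<Sum>r<m. \<Sum>s<m. cnj (\<phi> $ s) * A $$ (s, r) * \<psi> $ r)" by (rule sum.swap)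
  also have "\<dots> = cip m (adj A *\<^sub>v \<phi>) \<psi>"
    unfolding cip_def using A v
    by (intro sum.cong refl)
      (simp add: mult_vec_index[of _ m] sum_distrib_left mult_ac del: index_mult_mat_vec)
  finally show ?thesis .
qed

lemma cip_self: "cip m \<psi> \<psi> = of_real (\<Sum>s<m. (cmod (\<psi> $ s))\<^sup>2)"
  unfolding cip_def of_real_sum
  by (intro sum.cong refl) (simp only: complex_norm_square mult.commute)

lemma sector_state_isometry:
  assumes A: "A \<in> carrier_mat m m" "adj A * A = 1\<^sub>m m" "preserves m K A" and \<psi>: "sector_state m K \<psi>"
  shows "sector_state m K (A *\<^sub>v \<psi>)"
proof -
  have c: "\<psi> \<in> carrier_vec m" using \<psi> by (rule sector_state_carrier)
  have Ac: "A *\<^sub>v \<psi> \<in> carrier_vec m" using A(1) c by simp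
  have "cip m (A *\<^sub>v \<psi>) (A *\<^sub>v \<psi>) = cip m (adj A *\<^sub>v (A *\<^sub>v \<psi>)) \<psi>"
    using A c Ac by (intro cip_adj) auto
  also have "adj A *\<^sub>v (A *\<^sub>v \<psi>) = \<psi>"
    using A c assoc_mult_mat_vec[of "adj A" m m A m \<psi>] by simp
  finally have "of_real (\<Sum>s<m. (cmod ((A *\<^sub>v \<psi>) $ s))\<^sup>2) = (of_real (\<Sum>s<m. (cmod (\<psi> $ s))\<^sup>2) :: complex)"
    by (simp only: cip_self)
  then have "(\<Sum>s<m. (cmod ((A *\<^sub>v \<psi>) $ s))\<^sup>2) = 1"
    using \<psi> by (simp only: of_real_eq_iff sector_state_def)
  moreover have "(A *\<^sub>v \<psi>) $ s = 0" if "s < m" "s \<notin> K" for s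
    unfolding mult_vec_index[OF A(1) c that(1)]
    using A(3) \<psi> that by (intro sum.neutral) (auto simp: preserves_def sector_state_def)
  ultimately show ?thesis using Ac by (simp add: sector_state_def)
qed

lemma sector_state_entry: "sector_state m K \<psi> \<Longrightarrow> s < m \<Longrightarrow> cmod (\<psi> $ s) \<le> 1"
proof -
  assume \<psi>: "sector_state m K \<psi>" and s: "s < m"
  have "(cmod (\<psi> $ s))\<^sup>2 \<le> (\<Sum>s<m. (cmod (\<psi> $ s))\<^sup>2)"
    by (rule member_le_sum) (use s in auto)
  also have "\<dots> = 1" using \<psi> by (simp add: sector_state_def)
  finally show ?thesis by (simp add: power_le_one_iff abs_square_le_1)
qed

text \<open>Crude and dependent on the dimension; it transfers an order of smallness in t from
  entries to matrix elements, where the constant is irrelevant.\<close>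

lemma cip_entry_bound:
  assumes X: "X \<in> carrier_mat m m" and \<phi>: "sector_state m K \<phi>" and \<psi>: "sector_state m K \<psi>"
  shows "cmod (cip m \<phi> (X *\<^sub>v \<psi>)) \<le> (\<Sum>i<m. \<Sum>j<m. cmod (X $$ (i, j)))"
  unfolding cip_def
proof (rule sum_norm_le)
  fix i assume "i \<in> {..<m}"
  then have i: "i < m" by simp
  have "cmod (cnj (\<phi> $ i) * (X *\<^sub>v \<psi>) $ i) \<le> 1 * cmod ((X *\<^sub>v \<psi>) $ i)"
    unfolding norm_mult using sector_state_entry[OF \<phi> i] by (intro mult_right_mono) auto
  also have "\<dots> = cmod (\<Sum>j<m. X $$ (i, j) * \<psi> $ j)"
    using mult_vec_index[OF X sector_state_carrier[OF \<psi>] i] by simp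
  also have "\<dots> \<le> (\<Sum>j<m. cmod (X $$ (i, j)))"
    using sector_state_entry[OF \<psi>] by (intro sum_norm_le) (auto simp: norm_mult intro: mult_left_le)
  finally show "cmod (cnj (\<phi> $ i) * (X *\<^sub>v \<psi>) $ i) \<le> (\<Sum>j<m. cmod (X $$ (i, j)))" .
qed

lemma cip_deriv:
  assumes F: "mat_deriv m F F' z" and v: "\<psi> \<in> carrier_vec m"
  shows "((\<lambda>w. cip m \<phi> (F w *\<^sub>v \<psi>)) has_field_derivative cip m \<phi> (F' *\<^sub>v \<psi>)) (at z)"
proof -
  note c = mat_deriv_carrier[OF F]
  have cip_eq: "cip m \<phi> (A *\<^sub>v \<psi>) = (\<Sum>i<m. \<Sum>j<m. cnj (\<phi> $ i) * (A $$ (i, j) * \<psi> $ j))"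
    if "A \<in> carrier_mat m m" for A
    unfolding cip_def using that v
    by (intro sum.cong refl) (simp add: mult_vec_index sum_distrib_left del: index_mult_mat_vec)
  show ?thesis unfolding cip_eq[OF c(1)] cip_eq[OF c(2)]
    by (intro DERIV_sum DERIV_cmult DERIV_cmult_right) (use F in \<open>auto simp: mat_deriv_def\<close>)
qed

lemma cip_diff:
  assumes "A \<in> carrier_mat m m" "B \<in> carrier_mat m m" "\<psi> \<in> carrier_vec m"
  shows "cip m \<phi> ((A - B) *\<^sub>v \<psi>) = cip m \<phi> (A *\<^sub>v \<psi>) - cip m \<phi> (B *\<^sub>v \<psi>)"
  using assms by (simp add: minus_mult_distrib_mat_vec cip_def right_diff_distrib sum_subtractf
    del: index_mult_mat_vec)

lemma cip_add:
  assumes "A \<in> carrier_mat m m" "B \<in> carrier_mat m m" "\<psi> \<in> carrier_vec m"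
  shows "cip m \<phi> ((A + B) *\<^sub>v \<psi>) = cip m \<phi> (A *\<^sub>v \<psi>) + cip m \<phi> (B *\<^sub>v \<psi>)"
  using assms by (simp add: add_mult_distrib_mat_vec cip_def distrib_left sum.distrib
    del: index_mult_mat_vec)

lemma cip_smult:
  assumes "A \<in> carrier_mat m m" "\<psi> \<in> carrier_vec m"
  shows "cip m \<phi> ((c \<cdot>\<^sub>m A) *\<^sub>v \<psi>) = c * cip m \<phi> (A *\<^sub>v \<psi>)"
proof -
  have "((c \<cdot>\<^sub>m A) *\<^sub>v \<psi>) $ i = c * (A *\<^sub>v \<psi>) $ i" if "i < m" for i
    using assms that by (simp add: mult_vec_index[of _ m] sum_distrib_left mult.assoc del: index_mult_mat_vec)
  then show ?thesis by (simp add: cip_def sum_distrib_left mult.left_commute del: index_mult_mat_vec)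
qed

lemma preserves_mult:
  assumes "A \<in> carrier_mat m m" "B \<in> carrier_mat m m" "preserves m K A" "preserves m K B"
  shows "preserves m K (A * B)"
  unfolding preserves_def
proof (intro allI impI)
  fix i j assume ij: "i < m" "j < m" "j \<in> K" "i \<notin> K"
  have "A $$ (i, l) * B $$ (l, j) = 0" if "l < m" for l
    using assms(3,4) ij that by (cases "l \<in> K") (auto simp: preserves_def)
  then show "(A * B) $$ (i, j) = 0"
    unfolding mult_index[OF assms(1,2) ij(1,2)] by (intro sum.neutral) auto
qed

lemma preserves_expo:
  assumes X: "X \<in> carrier_mat m m" "preserves m K X" shows "preserves m K (expo X z)"
proof -
  have "preserves m K (X ^\<^sub>m k)" for k
  proof (induction k)
    case 0
    then show ?case using X by (auto simp: preserves_def)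
  next
    case (Suc k)
    then show ?case using X by (simp add: preserves_mult)
  qed
  then show ?thesis unfolding preserves_def
    by (auto simp: expo_index[OF X(1)] expo_coeff_def)
qed

section \<open>Taylor approximation of orbits\<close>

text \<open>The polynomial stays anonymous because it will be shown to vanish in the total, whereas
  the remainder constant c is tracked and holds for all t \<ge> 0, not only near 0.\<close>

definition poly_approx :: "nat \<Rightarrow> real \<Rightarrow> (real \<Rightarrow> complex) \<Rightarrow> bool" where
  "poly_approx q c f \<longleftrightarrow> (\<exists>w. \<forall>t\<ge>0. cmod (f t - (\<Sum>j<q. w j * of_real t ^ j)) \<le> c * t ^ q)"

lemma poly_approx_add:
  assumes "poly_approx q c f" "poly_approx q d g"
  shows "poly_approx q (c + d) (\<lambda>t. f t + g t)"
proof -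
  from assms obtain w v where
    w: "\<And>t. t \<ge> 0 \<Longrightarrow> cmod (f t - (\<Sum>j<q. w j * of_real t ^ j)) \<le> c * t ^ q" and
    v: "\<And>t. t \<ge> 0 \<Longrightarrow> cmod (g t - (\<Sum>j<q. v j * of_real t ^ j)) \<le> d * t ^ q"
    unfolding poly_approx_def by blast
  show ?thesis unfolding poly_approx_def
  proof (intro exI[of _ "\<lambda>j. w j + v j"] allI impI)
    fix t :: real assume t: "t \<ge> 0"
    have eq: "f t + g t - (\<Sum>j<q. (w j + v j) * of_real t ^ j)
      = (f t - (\<Sum>j<q. w j * of_real t ^ j)) + (g t - (\<Sum>j<q. v j * of_real t ^ j))"
      by (simp add: sum.distrib distrib_right)
    show "cmod (f t + g t - (\<Sum>j<q. (w j + v j) * of_real t ^ j)) \<le> (c + d) * t ^ q"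
      unfolding eq using norm_triangle_mono[OF w[OF t] v[OF t]] by (simp only: distrib_right)
  qed
qed

lemma poly_approx_scale:
  assumes "poly_approx q c f" "cmod a \<le> b" "0 \<le> c"
  shows "poly_approx q (b * c) (\<lambda>t. a * f t)"
proof -
  from assms obtain w where
    w: "\<And>t. t \<ge> 0 \<Longrightarrow> cmod (f t - (\<Sum>j<q. w j * of_real t ^ j)) \<le> c * t ^ q"
    unfolding poly_approx_def by blast
  show ?thesis unfolding poly_approx_def
  proof (intro exI[of _ "\<lambda>j. a * w j"] allI impI)
    fix t :: real assume t: "t \<ge> 0"
    have "a * f t - (\<Sum>j<q. a * w j * of_real t ^ j) = a * (f t - (\<Sum>j<q. w j * of_real t ^ j))"
      by (simp add: sum_distrib_left right_diff_distrib mult.assoc)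
    then show "cmod (a * f t - (\<Sum>j<q. a * w j * of_real t ^ j)) \<le> b * c * t ^ q"
      using mult_mono[OF assms(2) w[OF t]] t assms(2,3) order_trans[OF norm_ge_zero assms(2)]
      by (simp add: norm_mult mult.assoc)
  qed
qed

lemma poly_approx_shift:
  assumes "poly_approx (q - j) c f" "j \<le> q"
  shows "poly_approx q c (\<lambda>t. of_real t ^ j * f t)"
proof -
  from assms obtain w where
    w: "\<And>t. t \<ge> 0 \<Longrightarrow> cmod (f t - (\<Sum>i<q-j. w i * of_real t ^ i)) \<le> c * t ^ (q - j)"
    unfolding poly_approx_def by blast
  show ?thesis unfolding poly_approx_def
  proof (intro exI[of _ "\<lambda>i. if j \<le> i then w (i - j) else 0"] allI impI)
    fix t :: real assume t: "t \<ge> 0"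
    have "(\<Sum>i<q. (if j \<le> i then w (i - j) else 0) * of_real t ^ i)
        = (\<Sum>i\<in>{j..<q}. w (i - j) * complex_of_real t ^ i)"
      by (intro sum.mono_neutral_cong_right) auto
    also have "\<dots> = (\<Sum>i<q-j. w i * complex_of_real t ^ (i + j))"
      by (rule sum.reindex_bij_witness[where i="\<lambda>i. i + j" and j="\<lambda>i. i - j"]) (use assms in auto)
    also have "\<dots> = of_real t ^ j * (\<Sum>i<q-j. w i * of_real t ^ i)"
      by (simp add: sum_distrib_left power_add mult_ac)
    finally have "of_real t ^ j * f t - (\<Sum>i<q. (if j \<le> i then w (i - j) else 0) * of_real t ^ i)
        = of_real t ^ j * (f t - (\<Sum>i<q-j. w i * of_real t ^ i))"
      by (simp add: right_diff_distrib)
    moreover have "t ^ j * cmod (f t - (\<Sum>i<q-j. w i * of_real t ^ i)) \<le> t ^ j * (c * t ^ (q - j))"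
      using w[OF t] t by (intro mult_left_mono) auto
    moreover have "t ^ j * (c * t ^ (q - j)) = c * t ^ q"
      using assms(2) by (simp add: mult.left_commute flip: power_add)
    ultimately show "cmod (of_real t ^ j * f t - (\<Sum>i<q. (if j \<le> i then w (i - j) else 0) * of_real t ^ i)) \<le> c * t ^ q"
      using t by (simp add: norm_mult norm_power)
  qed
qed

lemma poly_approx_zero: "poly_approx q 0 (\<lambda>t. 0)"
  unfolding poly_approx_def by (rule exI[of _ "\<lambda>_. 0"]) simp

lemma poly_approx_sum:
  assumes "finite A" "\<And>a. a \<in> A \<Longrightarrow> poly_approx q (c a) (f a)"
  shows "poly_approx q (\<Sum>a\<in>A. c a) (\<lambda>t. \<Sum>a\<in>A. f a t)"
  using assms
proof (induction A rule: finite_induct)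
  case empty
  then show ?case by (simp add: poly_approx_zero)
next
  case (insert x F)
  then show ?case by (simp add: poly_approx_add)
qed

lemma poly_approx_near:
  assumes "poly_approx q c g" "\<And>t. t \<ge> 0 \<Longrightarrow> cmod (f t - g t) \<le> d * t ^ q"
  shows "poly_approx q (c + d) f"
proof -
  have "poly_approx q d (\<lambda>t. f t - g t)"
    unfolding poly_approx_def by (rule exI[of _ "\<lambda>_. 0"]) (use assms(2) in simp)
  from poly_approx_add[OF assms(1) this] show ?thesis by simp
qed

lemma poly_approx_const:
  assumes "0 < q" shows "poly_approx q 0 (\<lambda>t. a)"
proof -
  have "(\<Sum>j<q. (if j = 0 then a else 0) * complex_of_real t ^ j) = a" for t
  proof -
    have "(\<Sum>j<q. (if j = 0 then a else 0) * complex_of_real t ^ j) = (\<Sum>j<q. if j = 0 then a else 0)"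
      by (intro sum.cong) auto
    then show ?thesis using assms by simp
  qed
  then show ?thesis unfolding poly_approx_def by (intro exI[of _ "\<lambda>j. if j = 0 then a else 0"]) simp
qed

text \<open>Letting t tend to 0 kills the constant coefficient; dividing by t then lowers the degree
  by one.\<close>

lemma poly_vanishes:
  assumes "\<forall>\<^sub>F t in at_right (0::real). cmod (\<Sum>j<q. w j * of_real t ^ j) \<le> C * t ^ q" and "j < q"
  shows "w j = 0"
  using assms
proof (induction q arbitrary: w j)
  case (Suc q)
  have lim: "((\<lambda>t. \<Sum>j<Suc q. w j * of_real t ^ j) \<longlongrightarrow> (\<Sum>j<Suc q. w j * of_real 0 ^ j)) (at_right (0::real))"
    by (intro tendsto_intros)
  moreover have "(\<Sum>j<Suc q. w j * of_real 0 ^ j) = w 0"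
    by (simp add: sum.lessThan_Suc_shift del: sum.lessThan_Suc)
  moreover have "((\<lambda>t. \<Sum>j<Suc q. w j * of_real t ^ j) \<longlongrightarrow> 0) (at_right (0::real))"
  proof (rule Lim_null_comparison[OF Suc.prems(1)])
    have "((\<lambda>t::real. C * t ^ Suc q) \<longlongrightarrow> C * 0 ^ Suc q) (at_right 0)" by (intro tendsto_intros)
    then show "((\<lambda>t::real. C * t ^ Suc q) \<longlongrightarrow> 0) (at_right 0)" by simp
  qed
  ultimately have w0: "w 0 = 0" using tendsto_unique[of "at_right (0::real)"] by force
  have "\<forall>\<^sub>F t in at_right (0::real). cmod (\<Sum>j<q. w (Suc j) * of_real t ^ j) \<le> C * t ^ q"
    using Suc.prems(1) eventually_at_right_less[of 0]
  proof eventually_elim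
    case (elim t)
    have "(\<Sum>j<Suc q. w j * complex_of_real t ^ j) = of_real t * (\<Sum>j<q. w (Suc j) * of_real t ^ j)"
      by (simp add: sum.lessThan_Suc_shift w0 sum_distrib_left mult_ac del: sum.lessThan_Suc)
    with elim have "t * cmod (\<Sum>j<q. w (Suc j) * of_real t ^ j) \<le> t * (C * t ^ q)"
      by (simp add: norm_mult mult_ac)
    with elim(2) show ?case by simp
  qed
  from Suc.IH[OF this] have "w (Suc j) = 0" if "j < q" for j using that .
  with w0 Suc.prems(2) show ?case by (cases j) auto
qed simp

text \<open>The exchange of constants on which uniformity rests: any C, however large, forces the
  polynomial to vanish, and what is left is the remainder with its own constant c.\<close>

lemma poly_approx_bound:
  assumes "poly_approx q c f" and "\<forall>\<^sub>F t in at_right (0::real). cmod (f t) \<le> C * t ^ q" and "t \<ge> 0"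
  shows "cmod (f t) \<le> c * t ^ q"
proof -
  from assms obtain w where
    w: "\<And>t. t \<ge> 0 \<Longrightarrow> cmod (f t - (\<Sum>j<q. w j * of_real t ^ j)) \<le> c * t ^ q"
    unfolding poly_approx_def by blast
  have "\<forall>\<^sub>F t in at_right (0::real). cmod (\<Sum>j<q. w j * of_real t ^ j) \<le> (c + C) * t ^ q"
    using assms(2) eventually_at_right_less[of 0]
  proof eventually_elim
    case (elim t)
    have "cmod (\<Sum>j<q. w j * of_real t ^ j) \<le> cmod (f t) + cmod (f t - (\<Sum>j<q. w j * of_real t ^ j))"
      by (metis norm_minus_commute norm_triangle_sub)
    then show ?case using elim w[of t] by (simp add: distrib_right)
  qed
  from poly_vanishes[OF this] have "(\<Sum>j<q. w j * of_real t ^ j) = 0" by simp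
  with w[OF assms(3)] show ?thesis by simp
qed

lemma entire_taylor:
  fixes f :: "complex \<Rightarrow> complex"
  assumes f: "f holomorphic_on UNIV"
  obtains B where "\<And>z. cmod z \<le> 1 \<Longrightarrow> cmod (f z - (\<Sum>i\<le>n. (deriv ^^ i) f 0 * z ^ i / fact i)) \<le> B * cmod z ^ Suc n"
proof -
  have hol: "(deriv ^^ i) f holomorphic_on UNIV" for i
    by (rule holomorphic_higher_deriv[OF f]) auto
  then have "continuous_on (cball 0 1) ((deriv ^^ Suc n) f)"
    by (meson continuous_on_subset holomorphic_on_imp_continuous_on subset_UNIV)
  then have "compact ((deriv ^^ Suc n) f ` cball 0 1)"
    by (intro compact_continuous_image) auto
  then obtain B where B: "\<And>x. x \<in> cball 0 1 \<Longrightarrow> cmod ((deriv ^^ Suc n) f x) \<le> B"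
    using compact_imp_bounded bounded_iff by (metis imageI)
  have "cmod (f z - (\<Sum>i\<le>n. (deriv ^^ i) f 0 * (z - 0) ^ i / fact i)) \<le> B * cmod (z - 0) ^ Suc n / fact n"
    if z: "cmod z \<le> 1" for z
  proof (rule field_Taylor[of "cball 0 1" n "\<lambda>i. (deriv ^^ i) f", simplified funpow_0])
    fix i x
    have "((deriv ^^ i) f has_field_derivative deriv ((deriv ^^ i) f) x) (at x)"
      by (rule holomorphic_derivI[OF hol]) auto
    then show "((deriv ^^ i) f has_field_derivative (deriv ^^ Suc i) f x) (at x within cball 0 1)"
      by (simp add: has_field_derivative_at_within)
  qed (use B z in auto)
  then have "cmod (f z - (\<Sum>i\<le>n. (deriv ^^ i) f 0 * z ^ i / fact i)) \<le> (B / fact n) * cmod z ^ Suc n"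
    if "cmod z \<le> 1" for z using that by simp
  then show ?thesis by (rule that)
qed

text \<open>An entire function of size \<open>O(t^(p+1))\<close> along the real axis has vanishing Taylor coefficients
  up to order \<open>p\<close>, so its derivative is \<open>O(t^p)\<close>.\<close>

lemma entire_order_deriv:
  fixes f :: "complex \<Rightarrow> complex"
  assumes f: "\<And>z. (f has_field_derivative f' z) (at z)"
    and small: "\<forall>\<^sub>F t in at (0::real). cmod (f (of_real t)) \<le> C * \<bar>t\<bar> ^ Suc p"
  shows "\<exists>C'. \<forall>\<^sub>F t in at_right (0::real). cmod (f' (of_real t)) \<le> C' * t ^ p"
proof -
  have f': "f' = deriv f" using f by (metis DERIV_imp_deriv ext)
  have hol: "f holomorphic_on UNIV"
    using f by (auto simp: holomorphic_on_def field_differentiable_def)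
  have hol': "f' holomorphic_on UNIV" unfolding f' by (rule holomorphic_deriv[OF hol]) auto
  define a where "a i = (deriv ^^ i) f 0 / fact i" for i
  obtain B where B: "\<And>z. cmod z \<le> 1 \<Longrightarrow> cmod (f z - (\<Sum>i\<le>p. (deriv ^^ i) f 0 * z ^ i / fact i)) \<le> B * cmod z ^ Suc p"
    by (rule entire_taylor[OF hol, of p]) blast
  have ev1: "\<forall>\<^sub>F t in at_right (0::real). t < 1"
    by (rule eventually_at_rightI[of 0 1]) auto
  have evC: "\<forall>\<^sub>F t in at_right (0::real). cmod (f (of_real t)) \<le> C * \<bar>t\<bar> ^ Suc p"
    using small by (simp add: eventually_at_split)
  have "\<forall>\<^sub>F t in at_right (0::real). cmod (\<Sum>i<Suc p. a i * of_real t ^ i) \<le> (C + B) * t ^ Suc p"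
    using evC ev1 eventually_at_right_less[of 0]
  proof eventually_elim
    case (elim t)
    have eq: "(\<Sum>i\<le>p. (deriv ^^ i) f 0 * of_real t ^ i / fact i) = (\<Sum>i<Suc p. a i * of_real t ^ i)"
      by (simp add: a_def lessThan_Suc_atMost)
    have "cmod (\<Sum>i<Suc p. a i * of_real t ^ i)
        \<le> cmod (f (of_real t)) + cmod (f (of_real t) - (\<Sum>i<Suc p. a i * of_real t ^ i))"
      by (metis norm_minus_commute norm_triangle_sub)
    also have "\<dots> \<le> C * t ^ Suc p + B * t ^ Suc p"
      using elim B[of "of_real t"] unfolding eq by (intro add_mono) auto
    finally show ?case by (simp add: distrib_right)
  qed
  from poly_vanishes[OF this] have z: "(deriv ^^ i) f 0 = 0" if "i \<le> p" for i
    using that by (simp add: a_def)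
  show ?thesis
  proof (cases p)
    case 0
    have "continuous_on (cball 0 1) f'"
      using hol' by (meson continuous_on_subset holomorphic_on_imp_continuous_on subset_UNIV)
    then have "compact (f' ` cball 0 1)" by (intro compact_continuous_image) auto
    then obtain D where D: "\<And>x. x \<in> cball 0 1 \<Longrightarrow> cmod (f' x) \<le> D"
      using compact_imp_bounded bounded_iff by (metis imageI)
    show ?thesis using 0 D
      by (intro exI[of _ D] eventually_mono[OF eventually_conj[OF ev1 eventually_at_right_less[of 0]]]) auto
  next
    case (Suc n)
    obtain D where D: "\<And>z. cmod z \<le> 1 \<Longrightarrow> cmod (f' z - (\<Sum>i\<le>n. (deriv ^^ i) f' 0 * z ^ i / fact i)) \<le> D * cmod z ^ Suc n"
      by (rule entire_taylor[OF hol', of n]) blast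
    \<comment> \<open>The derivatives of \<open>f'\<close> at 0 are those of f shifted by one, so
      orders up to p - 1 are covered.\<close>
    have "(deriv ^^ i) f' 0 = 0" if "i \<le> n" for i
      using z[of "Suc i"] that Suc by (simp add: f' funpow_Suc_right del: funpow.simps)
    then have "cmod (f' z) \<le> D * cmod z ^ p" if "cmod z \<le> 1" for z
      using D[OF that] Suc by simp
    then show ?thesis
      by (intro exI[of _ D] eventually_mono[OF eventually_conj[OF ev1 eventually_at_right_less[of 0]]])
        (metis abs_of_pos less_eq_real_def norm_of_real)
  qed
qed

section \<open>Error of a product formula\<close>

locale hamiltonian =
  fixes m :: nat and K :: "nat set" and T V :: "complex mat"
  assumes T_carrier: "T \<in> carrier_mat m m" and V_carrier: "V \<in> carrier_mat m m"
    and T_adj: "adj T = T" and V_adj: "adj V = V"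
    and T_preserves: "preserves m K T" and V_preserves: "preserves m K V"
begin

definition part :: "bool \<Rightarrow> complex mat" where "part b = (if b then T else V)"

lemma part_carrier [simp]: "part b \<in> carrier_mat m m"
  by (simp add: part_def T_carrier V_carrier)

lemma sq_simps:
  "\<lbrakk>A \<in> carrier_mat m m; B \<in> carrier_mat m m; C \<in> carrier_mat m m\<rbrakk> \<Longrightarrow> A * B * C = A * (B * C)"
  for A B C :: "complex mat"
  by (rule assoc_mult_mat)

lemma sq_vec:
  "\<lbrakk>A \<in> carrier_mat m m; B \<in> carrier_mat m m; v \<in> carrier_vec m\<rbrakk> \<Longrightarrow> (A * B) *\<^sub>v v = A *\<^sub>v (B *\<^sub>v v)"
  for A B :: "complex mat"
  by (rule assoc_mult_mat_vec)

lemma sq_left: "A \<in> carrier_mat m m \<Longrightarrow> 1\<^sub>m m * A = A" for A :: "complex mat"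
  by (rule left_mult_one_mat)

abbreviation prop_op :: "real \<Rightarrow> bool \<Rightarrow> complex \<Rightarrow> complex mat" where
  "prop_op c b z \<equiv> expo (part b) (- (\<i> * of_real c) * z)"

lemma prop_op_inverse: "prop_op c b z * prop_op (- c) b z = 1\<^sub>m m"
  using expo_neg[OF part_carrier, of b "\<i> * of_real c * z"] by simp

lemma prop_op_adj: "adj (prop_op c b (of_real t)) = prop_op (- c) b (of_real t)"
proof -
  have "adj (part b) = part b" by (simp add: part_def T_adj V_adj)
  from adj_expo[OF part_carrier this] show ?thesis by simp
qed

lemma prop_op_state:
  assumes "sector_state m K \<psi>" shows "sector_state m K (prop_op c b (of_real t) *\<^sub>v \<psi>)"
proof (rule sector_state_isometry[OF _ _ _ assms])
  show "adj (prop_op c b (of_real t)) * prop_op c b (of_real t) = 1\<^sub>m m"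
    using prop_op_inverse[where c="- c" and b=b and z="of_real t"] by (simp only: prop_op_adj minus_minus)
  show "preserves m K (prop_op c b (of_real t))"
    by (rule preserves_expo) (simp_all add: part_def T_preserves V_preserves T_carrier V_carrier)
qed simp

primrec S :: "(real \<times> bool) list \<Rightarrow> complex \<Rightarrow> complex mat" where
  "S [] z = 1\<^sub>m m"
| "S (cb # G) z = prop_op (fst cb) (snd cb) z * S G z"

primrec SI :: "(real \<times> bool) list \<Rightarrow> complex \<Rightarrow> complex mat" where
  "SI [] z = 1\<^sub>m m"
| "SI (cb # G) z = SI G z * prop_op (- fst cb) (snd cb) z"

lemma S_carrier [simp]: "S G z \<in> carrier_mat m m"
  by (induction G) auto

lemma SI_carrier [simp]: "SI G z \<in> carrier_mat m m"
  by (induction G) auto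

lemma S_SI: "S G z * SI G z = 1\<^sub>m m"
proof (induction G)
  case (Cons cb G)
  let ?E = "prop_op (fst cb) (snd cb) z" and ?E' = "prop_op (- fst cb) (snd cb) z"
  have "S (cb # G) z * SI (cb # G) z = ?E * ((S G z * SI G z) * ?E')"
    by (simp add: sq_simps)
  also have "\<dots> = 1\<^sub>m m" unfolding Cons.IH by (simp only: sq_left expo_carrier part_carrier prop_op_inverse)
  finally show ?case .
qed simp

lemma SI_S: "SI G z * S G z = 1\<^sub>m m"
proof (induction G)
  case (Cons cb G)
  let ?E = "prop_op (fst cb) (snd cb) z" and ?E' = "prop_op (- fst cb) (snd cb) z"
  have "SI (cb # G) z * S (cb # G) z = SI G z * ((?E' * ?E) * S G z)"
    by (simp add: sq_simps)
  also have "?E' * ?E = 1\<^sub>m m" using prop_op_inverse[where c="- fst cb" and b="snd cb" and z=z] by simp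
  finally show ?case using Cons.IH by (simp add: sq_left)
qed simp

lemma adj_SI: "adj (SI G (of_real t)) = S G (of_real t)"
proof (induction G)
  case Nil
  show ?case by (rule eq_matI) (auto simp: adj_def)
next
  case (Cons cb G)
  have "adj (SI (cb # G) (of_real t)) = adj (prop_op (- fst cb) (snd cb) (of_real t)) * S G (of_real t)"
    unfolding SI.simps Cons.IH[symmetric] by (rule adj_mult[of _ m]) simp_all
  then show ?case by (simp only: prop_op_adj minus_minus S.simps)
qed

lemma adj_S: "adj (S G (of_real t)) = SI G (of_real t)"
proof -
  have "adj (adj A) = A" for A by (rule eq_matI) (auto simp: adj_def)
  then show ?thesis by (metis adj_SI)
qed

lemma S_state:
  "sector_state m K \<psi> \<Longrightarrow> sector_state m K (S G (of_real t) *\<^sub>v \<psi>)"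
proof (induction G)
  case (Cons cb G)
  then show ?case
    using sector_state_carrier[OF Cons.prems] prop_op_state[OF Cons.IH[OF Cons.prems], where c="fst cb" and b="snd cb" and t=t]
    by (simp add: sq_vec)
qed (auto simp: sector_state_def)

lemma SI_state:
  "sector_state m K \<psi> \<Longrightarrow> sector_state m K (SI G (of_real t) *\<^sub>v \<psi>)"
proof (induction G arbitrary: \<psi>)
  case (Cons cb G)
  have "sector_state m K (prop_op (- fst cb) (snd cb) (of_real t) *\<^sub>v \<psi>)"
    by (rule prop_op_state[OF Cons.prems])
  from Cons.IH[OF this] show ?case
    using sector_state_carrier[OF Cons.prems] by (simp add: sq_vec)
qed (auto simp: sector_state_def)

text \<open>The matrix element of the Heisenberg-evolved Z. Placing the unitaries on the states
  keeps a bounded Z bounded, as evolved states are again states of the sector.\<close>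

definition heis :: "(real \<times> bool) list \<Rightarrow> complex Matrix.vec \<Rightarrow> complex Matrix.vec \<Rightarrow> complex mat \<Rightarrow> real \<Rightarrow> complex" where
  "heis G \<phi> \<psi> Z t = cip m (S G (of_real t) *\<^sub>v \<phi>) (Z *\<^sub>v (S G (of_real t) *\<^sub>v \<psi>))"

lemma heis_conj:
  assumes "Z \<in> carrier_mat m m" "\<phi> \<in> carrier_vec m" "\<psi> \<in> carrier_vec m"
  shows "cip m \<phi> ((SI G (of_real t) * Z * S G (of_real t)) *\<^sub>v \<psi>) = heis G \<phi> \<psi> Z t"
proof -
  have c: "Z *\<^sub>v (S G (of_real t) *\<^sub>v \<psi>) \<in> carrier_vec m"
    by (rule mult_mat_vec_carrier[OF assms(1) mult_mat_vec_carrier[OF S_carrier assms(3)]])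
  have "(SI G (of_real t) * Z * S G (of_real t)) *\<^sub>v \<psi> = SI G (of_real t) *\<^sub>v (Z *\<^sub>v (S G (of_real t) *\<^sub>v \<psi>))"
    using assms mult_mat_vec_carrier[OF S_carrier[of G "of_real t"] assms(3)] by (simp add: sq_vec)
  then show ?thesis
    using cip_adj[OF SI_carrier[of G "of_real t"] assms(2) c] by (simp add: heis_def adj_SI)
qed

text \<open>One constant for all words of length q in the two generators: expanding successive
  conjugations produces words with letters in any order.\<close>

primrec nested_bound :: "nat \<Rightarrow> real \<Rightarrow> complex mat \<Rightarrow> bool" where
  "nested_bound 0 M Z = form_bound m K M Z"
| "nested_bound (Suc q) M Z = (nested_bound q M (mcomm T Z) \<and> nested_bound q M (mcomm V Z))"

lemma mcomm_carrier [simp]: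
  "A \<in> carrier_mat m m \<Longrightarrow> B \<in> carrier_mat m m \<Longrightarrow> mcomm A B \<in> carrier_mat m m"
  by (intro minus_carrier_mat) simp

lemma mcomm_pow_carrier [simp]: "Z \<in> carrier_mat m m \<Longrightarrow> ((mcomm (part b)) ^^ j) Z \<in> carrier_mat m m"
proof (induction j)
  case (Suc j)
  then have "mcomm (part b) ((mcomm (part b) ^^ j) Z) \<in> carrier_mat m m" by (intro mcomm_carrier) auto
  then show ?case by simp
qed simp

lemma nested_bound_pow: "nested_bound (j + r) M Z \<Longrightarrow> nested_bound r M (((mcomm (part b)) ^^ j) Z)"
proof (induction j arbitrary: Z)
  case (Suc j)
  then have "nested_bound (j + r) M (mcomm (part b) Z)" by (auto simp: part_def)
  from Suc.IH[OF this] show ?case by (simp add: funpow_Suc_right del: funpow.simps)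
qed simp

text \<open>A matrix commutes with its own exponential, so the two terms of the product rule combine
  into a commutator. The sign is that of the left factor, whose exponent is
  \<open>\<i> * c * z\<close> times the generator.\<close>

lemma conj_deriv:
  assumes A: "A \<in> carrier_mat m m"
  shows "mat_deriv m (\<lambda>w. prop_op (- c) b w * A * prop_op c b w)
     ((\<i> * of_real c) \<cdot>\<^sub>m (prop_op (- c) b z * mcomm (part b) A * prop_op c b z)) z"
proof -
  let ?X = "part b" and ?a = "\<i> * of_real c"
  define E where "E = prop_op c b z"
  define E' where "E' = prop_op (- c) b z"
  have c: "E \<in> carrier_mat m m" "E' \<in> carrier_mat m m" "?X \<in> carrier_mat m m" by (auto simp: E_def E'_def)
  have 1: "mat_deriv m (\<lambda>w. prop_op c b w) ((- ?a) \<cdot>\<^sub>m (E * ?X)) z"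
    using mat_deriv_chain[of m "expo ?X" "E * ?X" 0 "- ?a" z] mat_deriv_expo[OF part_carrier, of b "- ?a * z"]
    by (simp add: E_def)
  have 2: "mat_deriv m (\<lambda>w. prop_op (- c) b w) (?a \<cdot>\<^sub>m (E' * ?X)) z"
    using mat_deriv_chain[of m "expo ?X" "E' * ?X" 0 "?a" z] mat_deriv_expo[OF part_carrier, of b "?a * z"]
    by (simp add: E'_def)
  have "mat_deriv m (\<lambda>w. prop_op (- c) b w * A * prop_op c b w)
     ((?a \<cdot>\<^sub>m (E' * ?X) * A + E' * 0\<^sub>m m m) * E + E' * A * ((- ?a) \<cdot>\<^sub>m (E * ?X))) z"
    using mat_deriv_mult[OF mat_deriv_mult[OF 2 mat_deriv_const[OF A]] 1]
    by (simp add: E_def E'_def)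
  moreover have "(?a \<cdot>\<^sub>m (E' * ?X) * A + E' * 0\<^sub>m m m) * E + E' * A * ((- ?a) \<cdot>\<^sub>m (E * ?X))
      = ?a \<cdot>\<^sub>m (E' * mcomm ?X A * E)"
  proof -
    have XE: "E * ?X = ?X * E" unfolding E_def by (rule expo_comm[OF part_carrier, symmetric])
    have "E' * 0\<^sub>m m m = 0\<^sub>m m m" using c by simp
    moreover have "?a \<cdot>\<^sub>m (E' * ?X) * A = ?a \<cdot>\<^sub>m (E' * (?X * A))"
      using c A by (simp add: mult_smult_assoc_mat[of _ m m _ m] sq_simps)
    moreover have "?a \<cdot>\<^sub>m (E' * (?X * A)) * E = ?a \<cdot>\<^sub>m (E' * ((?X * A) * E))"
      using c A by (simp add: mult_smult_assoc_mat[of _ m m _ m] sq_simps)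
    moreover have "E' * A * ((- ?a) \<cdot>\<^sub>m (E * ?X)) = (- ?a) \<cdot>\<^sub>m (E' * ((A * ?X) * E))"
      unfolding XE using c A by (simp add: mult_smult_distrib[of _ m m _ m] sq_simps)
    moreover have "E' * mcomm ?X A * E = E' * ((?X * A) * E) - E' * ((A * ?X) * E)"
    proof -
      have "E' * mcomm ?X A * E = E' * (mcomm ?X A * E)" using c A by (intro sq_simps mcomm_carrier)
      also have "mcomm ?X A * E = (?X * A) * E - (A * ?X) * E"
        using c A by (intro minus_mult_distrib_mat[of _ m m]) auto
      also have "E' * \<dots> = E' * ((?X * A) * E) - E' * ((A * ?X) * E)"
        using c A by (intro mult_minus_distrib_mat[of _ m m _ m]) auto
      finally show ?thesis .
    qed
    moreover have "a \<cdot>\<^sub>m P + (- a) \<cdot>\<^sub>m Q = a \<cdot>\<^sub>m (P - Q)" if "P \<in> carrier_mat m m" "Q \<in> carrier_mat m m"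
      for P Q :: "complex mat" and a
      using that by (intro eq_matI) (auto simp: algebra_simps)
    ultimately show ?thesis using c A by simp
  qed
  ultimately show ?thesis by (simp only: E_def E'_def)
qed

end

text \<open>Accumulated constant of the inside-out Taylor expansion of the conjugation by a product of
  exponentials: the conjugation next to the operator is expanded first, and the unitaries outside
  of a remainder do not change its size.\<close>

fun conj_const :: "(real \<times> bool) list \<Rightarrow> nat \<Rightarrow> real" where
  "conj_const [] q = 1"
| "conj_const (cb # G) q = (\<Sum>j<q. \<bar>fst cb\<bar> ^ j * conj_const G (q - j)) + \<bar>fst cb\<bar> ^ q"

lemma conj_const_nonneg: "0 \<le> conj_const G q"
  by (induction G arbitrary: q) (auto intro!: add_nonneg_nonneg sum_nonneg)

text \<open>One summand per exponential: its coefficient times the constant for conjugating by the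
  factors to its right. Only p and the coefficients enter, which makes the final constants
  independent of the system.\<close>

fun formula_const :: "nat \<Rightarrow> (real \<times> bool) list \<Rightarrow> real" where
  "formula_const p [] = 0"
| "formula_const p (cb # G) = \<bar>fst cb\<bar> * conj_const G p + formula_const p G"

lemma formula_const_nonneg: "0 \<le> formula_const p G"
  by (induction G) (auto simp: conj_const_nonneg)

context hamiltonian
begin

text \<open>The j-th derivative of the conjugated matrix element is an evolved j-fold commutator.
  Unitarity bounds the q-th one by the same M along the whole real line, so the remainder estimate
  has no restriction on t.\<close>

lemma conj_taylor:
  assumes \<phi>: "sector_state m K \<phi>" and \<psi>: "sector_state m K \<psi>" and Z: "Z \<in> carrier_mat m m"
    and t: "0 \<le> t" and M: "0 \<le> M" "form_bound m K M ((mcomm (part b) ^^ q) Z)"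
  shows "cmod (cip m (prop_op c b (of_real t) *\<^sub>v \<phi>) (Z *\<^sub>v (prop_op c b (of_real t) *\<^sub>v \<psi>))
      - (\<Sum>j<q. (\<i> * of_real c) ^ j / fact j * of_real t ^ j * cip m \<phi> ((mcomm (part b) ^^ j) Z *\<^sub>v \<psi>)))
     \<le> \<bar>c\<bar> ^ q * M * t ^ q"
proof -
  note v = sector_state_carrier[OF \<phi>] sector_state_carrier[OF \<psi>]
  define D where "D = (\<lambda>j. (mcomm (part b) ^^ j) Z)"
  have D: "D j \<in> carrier_mat m m" for j unfolding D_def using Z by simp
  define F where "F = (\<lambda>j w. prop_op (- c) b w * D j * prop_op c b w)"
  have Fc: "F j w \<in> carrier_mat m m" for j w unfolding F_def using D by simp
  define f where "f = (\<lambda>j w. (\<i> * of_real c) ^ j * cip m \<phi> (F j w *\<^sub>v \<psi>))"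
  have F_eq: "cip m \<phi> (F j (of_real s) *\<^sub>v \<psi>)
      = cip m (prop_op c b (of_real s) *\<^sub>v \<phi>) (D j *\<^sub>v (prop_op c b (of_real s) *\<^sub>v \<psi>))" for j s
  proof -
    let ?E = "prop_op c b (of_real s)"
    have c: "?E *\<^sub>v \<psi> \<in> carrier_vec m" by (rule mult_mat_vec_carrier[OF expo_carrier[OF part_carrier] v(2)])
    have c2: "D j *\<^sub>v (?E *\<^sub>v \<psi>) \<in> carrier_vec m" by (rule mult_mat_vec_carrier[OF D c])
    have "F j (of_real s) *\<^sub>v \<psi> = prop_op (- c) b (of_real s) *\<^sub>v (D j *\<^sub>v (?E *\<^sub>v \<psi>))"
      unfolding F_def using D v c by (simp add: sq_vec)
    then show ?thesis using cip_adj[OF expo_carrier[OF part_carrier] v(1) c2]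
      by (simp only: prop_op_adj minus_minus)
  qed
  have deriv: "(f j has_field_derivative f (Suc j) w) (at w)" for j w
  proof -
    have "mat_deriv m (F j) ((\<i> * of_real c) \<cdot>\<^sub>m F (Suc j) w) w"
      using conj_deriv[OF D[of j], where c=c and b=b and z=w] by (simp add: F_def D_def)
    from DERIV_cmult[OF cip_deriv[OF this v(2), of \<phi>], of "(\<i> * of_real c) ^ j"]
    show ?thesis by (simp add: f_def cip_smult[OF Fc v(2)] mult_ac)
  qed
  have bound: "cmod (f q (of_real s)) \<le> \<bar>c\<bar> ^ q * M" for s
  proof -
    have "cmod (cip m \<phi> (F q (of_real s) *\<^sub>v \<psi>)) \<le> M"
      unfolding F_eq using M(2) prop_op_state[OF \<phi>] prop_op_state[OF \<psi>]
      by (simp add: form_bound_def D_def)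
    then show ?thesis by (simp add: f_def norm_mult norm_power mult_left_mono)
  qed
  have f0: "f j 0 = (\<i> * of_real c) ^ j * cip m \<phi> (D j *\<^sub>v \<psi>)" for j
    using D[of j] by (simp add: f_def F_def expo_0[OF part_carrier] sq_left)
  have ft: "f 0 (of_real t) = cip m (prop_op c b (of_real t) *\<^sub>v \<phi>) (Z *\<^sub>v (prop_op c b (of_real t) *\<^sub>v \<psi>))"
    unfolding f_def F_eq by (simp add: D_def)
  show ?thesis
  proof (cases q)
    case 0
    have "cmod (f 0 (of_real t)) \<le> M" using bound[of t] 0 by simp
    then show ?thesis unfolding ft using 0 by simp
  next
    case (Suc n)
    have "cmod (f 0 (of_real t) - (\<Sum>i\<le>n. f i 0 * (of_real t - 0) ^ i / fact i))
        \<le> (\<bar>c\<bar> ^ q * M) * cmod (of_real t - 0) ^ Suc n / fact n"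
    proof (rule field_Taylor)
      show "convex (closed_segment 0 (complex_of_real t))" by simp
      show "(f i has_field_derivative f (Suc i) x) (at x within closed_segment 0 (complex_of_real t))" for i x
        by (rule has_field_derivative_at_within[OF deriv])
      fix x assume "x \<in> closed_segment 0 (complex_of_real t)"
      then obtain s where "x = of_real s" by (auto simp: in_segment scaleR_conv_of_real simp flip: of_real_mult)
      then show "cmod (f (Suc n) x) \<le> \<bar>c\<bar> ^ q * M" using bound[of s] Suc by simp
    qed auto
    \<comment> \<open>The factorial in the Taylor remainder is given away, as constants are not
      optimised.\<close>
    also have "\<dots> \<le> (\<bar>c\<bar> ^ q * M) * t ^ q"
    proof -
      have "(\<bar>c\<bar> ^ q * M * t ^ q) / fact n \<le> (\<bar>c\<bar> ^ q * M * t ^ q) / 1"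
        using M t by (intro divide_left_mono) (auto simp: fact_ge_1)
      then show ?thesis using t Suc by simp
    qed
    also have "(\<Sum>i\<le>n. f i 0 * (of_real t - 0) ^ i / fact i)
        = (\<Sum>j<q. (\<i> * of_real c) ^ j / fact j * of_real t ^ j * cip m \<phi> (D j *\<^sub>v \<psi>))"
      unfolding Suc lessThan_Suc_atMost by (intro sum.cong refl) (simp add: f0)
    finally show ?thesis unfolding ft D_def .
  qed
qed

text \<open>The head of the list stands next to Z. Expanding it yields t^j times the same problem
  for a j-fold commutator, the shorter list and the order q - j. Its remainder already carries q
  commutators and the full power t^q, so it is simply bounded.\<close>

lemma heis_approx:
  assumes "Z \<in> carrier_mat m m" "0 \<le> M" "nested_bound q M Z"
    and \<phi>: "sector_state m K \<phi>" and \<psi>: "sector_state m K \<psi>"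
  shows "poly_approx q (conj_const G q * M) (heis G \<phi> \<psi> Z)"
  using assms(1-3)
proof (induction G arbitrary: q Z)
  case Nil
  have "heis [] \<phi> \<psi> Z = (\<lambda>t. cip m \<phi> (Z *\<^sub>v \<psi>))"
    using sector_state_carrier[OF \<phi>] sector_state_carrier[OF \<psi>] by (simp add: heis_def fun_eq_iff)
  moreover have "poly_approx q M (\<lambda>t. cip m \<phi> (Z *\<^sub>v \<psi>))"
  proof (cases q)
    case 0
    then show ?thesis using Nil(3) \<phi> \<psi> by (simp add: poly_approx_def form_bound_def)
  next
    case (Suc n)
    then show ?thesis
      using poly_approx_near[OF poly_approx_const[of q "cip m \<phi> (Z *\<^sub>v \<psi>)"],
          of "\<lambda>t. cip m \<phi> (Z *\<^sub>v \<psi>)" M] Nil(2) by simp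
  qed
  ultimately show ?case by simp
next
  case (Cons cb G)
  obtain c b where cb: "cb = (c, b)" by (cases cb)
  let ?D = "\<lambda>j. (mcomm (part b) ^^ j) Z"
  have "poly_approx q (\<Sum>j<q. \<bar>c\<bar> ^ j * (conj_const G (q - j) * M))
      (\<lambda>t. \<Sum>j<q. (\<i> * of_real c) ^ j / fact j * (of_real t ^ j * heis G \<phi> \<psi> (?D j) t))"
  proof (rule poly_approx_sum)
    fix j assume j: "j \<in> {..<q}"
    \<comment> \<open>Of the q commutators covered by the bound, j have been used up by the
      expansion of the head.\<close>
    have "nested_bound (q - j) M (?D j)" using Cons.prems(3) j nested_bound_pow[of j "q - j"] by simp
    then have "poly_approx (q - j) (conj_const G (q - j) * M) (heis G \<phi> \<psi> (?D j))"
      using Cons.prems by (intro Cons.IH) auto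
    then have "poly_approx q (conj_const G (q - j) * M) (\<lambda>t. of_real t ^ j * heis G \<phi> \<psi> (?D j) t)"
      by (rule poly_approx_shift) (use j in auto)
    moreover have "cmod ((\<i> * of_real c) ^ j / fact j) \<le> \<bar>c\<bar> ^ j"
    proof -
      have "\<bar>c\<bar> ^ j / fact j \<le> \<bar>c\<bar> ^ j / 1" by (intro divide_left_mono) (auto simp: fact_ge_1)
      then show ?thesis by (simp add: norm_divide norm_power norm_mult)
    qed
    ultimately show "poly_approx q (\<bar>c\<bar> ^ j * (conj_const G (q - j) * M))
        (\<lambda>t. (\<i> * of_real c) ^ j / fact j * (of_real t ^ j * heis G \<phi> \<psi> (?D j) t))"
      using Cons.prems(2) by (intro poly_approx_scale) (auto simp: conj_const_nonneg)
  qed simp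
  moreover have "cmod (heis (cb # G) \<phi> \<psi> Z t
      - (\<Sum>j<q. (\<i> * of_real c) ^ j / fact j * (of_real t ^ j * heis G \<phi> \<psi> (?D j) t))) \<le> (\<bar>c\<bar> ^ q * M) * t ^ q"
    if t: "t \<ge> 0" for t
  proof -
    have "heis (cb # G) \<phi> \<psi> Z t = cip m (prop_op c b (of_real t) *\<^sub>v (S G (of_real t) *\<^sub>v \<phi>))
        (Z *\<^sub>v (prop_op c b (of_real t) *\<^sub>v (S G (of_real t) *\<^sub>v \<psi>)))"
      using sector_state_carrier[OF \<phi>] sector_state_carrier[OF \<psi>] by (simp add: heis_def cb sq_vec)
    moreover have "form_bound m K M (?D q)"
      using Cons.prems(3) nested_bound_pow[of q 0] by simp
    ultimately show ?thesis
      using conj_taylor[OF S_state[OF \<phi>] S_state[OF \<psi>] Cons.prems(1) t Cons.prems(2), where q=q and b=b and c=c]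
      by (simp add: heis_def mult.assoc)
  qed
  ultimately have "poly_approx q ((\<Sum>j<q. \<bar>c\<bar> ^ j * (conj_const G (q - j) * M)) + \<bar>c\<bar> ^ q * M) (heis (cb # G) \<phi> \<psi> Z)"
    by (rule poly_approx_near)
  then show ?case by (simp add: cb distrib_right sum_distrib_right mult.assoc)
qed

text \<open>The logarithmic derivative of the product formula, that is the W with S' = S W: each
  exponential contributes its generator conjugated by the factors to its right.\<close>

primrec gen_sum :: "(real \<times> bool) list \<Rightarrow> complex \<Rightarrow> complex mat" where
  "gen_sum [] z = 0\<^sub>m m m"
| "gen_sum (cb # G) z = SI G z * ((- \<i> * of_real (fst cb)) \<cdot>\<^sub>m part (snd cb)) * S G z + gen_sum G z"

lemma gen_sum_carrier [simp]: "gen_sum G z \<in> carrier_mat m m"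
  by (induction G) auto

lemma S_deriv: "mat_deriv m (S G) (S G z * gen_sum G z) z"
proof (induction G)
  case Nil
  have "S [] = (\<lambda>_. 1\<^sub>m m)" by auto
  moreover have "S [] z * gen_sum [] z = 0\<^sub>m m m" by simp
  ultimately show ?case using mat_deriv_const[of "1\<^sub>m m" m z] by simp
next
  case (Cons cb G)
  let ?X = "part (snd cb)" and ?a = "- \<i> * of_real (fst cb)"
  define E where "E = prop_op (fst cb) (snd cb) z"
  have Ec: "E \<in> carrier_mat m m" by (simp add: E_def)
  have 1: "mat_deriv m (\<lambda>w. prop_op (fst cb) (snd cb) w) (?a \<cdot>\<^sub>m (E * ?X)) z"
    using mat_deriv_chain[of m "expo ?X" "E * ?X" 0 ?a z] mat_deriv_expo[OF part_carrier, of "snd cb" "?a * z"]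
    by (simp add: E_def)
  have "S (cb # G) = (\<lambda>w. prop_op (fst cb) (snd cb) w * S G w)" by auto
  then have "mat_deriv m (S (cb # G)) (?a \<cdot>\<^sub>m (E * ?X) * S G z + E * (S G z * gen_sum G z)) z"
    using mat_deriv_mult[OF 1 Cons.IH] by (simp add: E_def)
  moreover have "S (cb # G) z * gen_sum (cb # G) z = ?a \<cdot>\<^sub>m (E * ?X) * S G z + E * (S G z * gen_sum G z)"
  proof -
    have "S (cb # G) z * gen_sum (cb # G) z
        = E * S G z * (SI G z * (?a \<cdot>\<^sub>m ?X) * S G z) + E * S G z * gen_sum G z"
      unfolding S.simps gen_sum.simps E_def[symmetric]
      using Ec by (intro mult_add_distrib_mat[of _ m m _ m]) auto
    also have "E * S G z * (SI G z * (?a \<cdot>\<^sub>m ?X) * S G z) = E * ((S G z * SI G z) * ((?a \<cdot>\<^sub>m ?X) * S G z))"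
      using Ec by (simp add: sq_simps)
    also have "\<dots> = E * ((?a \<cdot>\<^sub>m ?X) * S G z)" unfolding S_SI by (simp add: sq_left)
    also have "\<dots> = ?a \<cdot>\<^sub>m (E * ?X) * S G z"
      using Ec by (simp add: mult_smult_assoc_mat[of _ m m _ m] mult_smult_distrib[of _ m m _ m] sq_simps)
    finally show ?thesis using Ec by (simp add: sq_simps)
  qed
  ultimately show ?case by (simp only:)
qed

lemma gen_sum_approx:
  assumes "0 \<le> M" "nested_bound p M T" "nested_bound p M V"
    and \<phi>: "sector_state m K \<phi>" and \<psi>: "sector_state m K \<psi>"
  shows "poly_approx p (formula_const p G * M) (\<lambda>t. cip m \<phi> (gen_sum G (of_real t) *\<^sub>v \<psi>))"
proof (induction G)
  note v = sector_state_carrier[OF \<phi>] sector_state_carrier[OF \<psi>]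
  case Nil
  have "cip m \<phi> (gen_sum [] (of_real t) *\<^sub>v \<psi>) = 0" for t :: real
    using v by (auto simp: cip_def)
  then show ?case by (simp add: poly_approx_zero)
next
  note v = sector_state_carrier[OF \<phi>] sector_state_carrier[OF \<psi>]
  case (Cons cb G)
  let ?X = "part (snd cb)" and ?a = "- \<i> * of_real (fst cb)"
  have "poly_approx p (conj_const G p * M) (heis G \<phi> \<psi> ?X)"
    using assms(2,3) by (intro heis_approx[OF _ assms(1) _ \<phi> \<psi>]) (auto simp: part_def T_carrier V_carrier)
  then have "poly_approx p (\<bar>fst cb\<bar> * (conj_const G p * M)) (\<lambda>t. ?a * heis G \<phi> \<psi> ?X t)"
    using assms(1) by (intro poly_approx_scale) (auto simp: conj_const_nonneg norm_mult)
  from poly_approx_add[OF this Cons.IH]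
  have "poly_approx p (formula_const p (cb # G) * M)
      (\<lambda>t. ?a * heis G \<phi> \<psi> ?X t + cip m \<phi> (gen_sum G (of_real t) *\<^sub>v \<psi>))"
    by (simp add: distrib_right mult.assoc)
  moreover have "cip m \<phi> (gen_sum (cb # G) (of_real t) *\<^sub>v \<psi>)
      = ?a * heis G \<phi> \<psi> ?X t + cip m \<phi> (gen_sum G (of_real t) *\<^sub>v \<psi>)" for t :: real
  proof -
    have eq: "SI G (of_real t) * (?a \<cdot>\<^sub>m ?X) * S G (of_real t) = ?a \<cdot>\<^sub>m (SI G (of_real t) * ?X * S G (of_real t))"
      by (simp add: mult_smult_assoc_mat[of _ m m _ m] mult_smult_distrib[of _ m m _ m])
    have c: "SI G (of_real t) * ?X * S G (of_real t) \<in> carrier_mat m m" by simp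
    have "cip m \<phi> (gen_sum (cb # G) (of_real t) *\<^sub>v \<psi>)
        = cip m \<phi> ((?a \<cdot>\<^sub>m (SI G (of_real t) * ?X * S G (of_real t))) *\<^sub>v \<psi>) + cip m \<phi> (gen_sum G (of_real t) *\<^sub>v \<psi>)"
      unfolding gen_sum.simps eq by (rule cip_add) (use v c in \<open>auto simp del: mult_smult_distrib\<close>)
    then show ?thesis by (simp only: cip_smult[OF c v(2)] heis_conj[OF part_carrier v])
  qed
  ultimately show ?case by simp
qed

end

text \<open>Smallness near 0 with no control of the constant, in contrast to
  \<open>poly_approx\<close>; it holds the information taken from the order condition.\<close>

definition small_order :: "nat \<Rightarrow> (real \<Rightarrow> complex) \<Rightarrow> bool" where
  "small_order p f \<longleftrightarrow> (\<exists>C. \<forall>\<^sub>F t in at_right (0::real). cmod (f t) \<le> C * t ^ p)"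

lemma small_order_add: "small_order p f \<Longrightarrow> small_order p g \<Longrightarrow> small_order p (\<lambda>t. f t + g t)"
proof -
  assume "small_order p f" "small_order p g"
  then obtain C D where C: "\<forall>\<^sub>F t in at_right (0::real). cmod (f t) \<le> C * t ^ p"
    and D: "\<forall>\<^sub>F t in at_right (0::real). cmod (g t) \<le> D * t ^ p" by (auto simp: small_order_def)
  from C D have "\<forall>\<^sub>F t in at_right (0::real). cmod (f t + g t) \<le> (C + D) * t ^ p"
    by eventually_elim (simp add: distrib_right norm_triangle_mono)
  then show ?thesis by (auto simp: small_order_def)
qed

lemma small_order_cmult: "small_order p f \<Longrightarrow> small_order p (\<lambda>t. c * f t)"
proof -
  assume "small_order p f"
  then obtain C where C: "\<forall>\<^sub>F t in at_right (0::real). cmod (f t) \<le> C * t ^ p"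
    by (auto simp: small_order_def)
  from C have "\<forall>\<^sub>F t in at_right (0::real). cmod (c * f t) \<le> (cmod c * C) * t ^ p"
    by eventually_elim (simp add: norm_mult mult.assoc mult_left_mono)
  then show ?thesis by (auto simp: small_order_def)
qed

lemma small_order_sum:
  "(\<And>a. a \<in> A \<Longrightarrow> small_order p (f a)) \<Longrightarrow> small_order p (\<lambda>t. \<Sum>a\<in>A. f a t)"
proof (induction A rule: infinite_finite_induct)
  case (insert x F)
  then show ?case by (simp add: small_order_add)
qed (auto simp: small_order_def intro!: exI[of _ 0])

lemma small_order_norm: "small_order p (\<lambda>t. of_real (cmod (f t))) \<longleftrightarrow> small_order p f"
  by (simp add: small_order_def)

context hamiltonian
begin

abbreviation H where "H \<equiv> T + V"

abbreviation U :: "complex \<Rightarrow> complex mat" where "U z \<equiv> expo H (- \<i> * z)"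

lemma H_carrier [simp]: "H \<in> carrier_mat m m"
  using T_carrier V_carrier by simp

lemma U_state:
  assumes "sector_state m K \<psi>" shows "sector_state m K (U (of_real t) *\<^sub>v \<psi>)"
proof (rule sector_state_isometry[OF _ _ _ assms])
  have "adj (T + V) = T + V"
  proof (rule eq_matI)
    fix i j assume "i < dim_row (T + V)" "j < dim_col (T + V)"
    then have ij: "i < m" "j < m" using V_carrier by auto
    have "cnj (T $$ (j, i)) = T $$ (i, j)" "cnj (V $$ (j, i)) = V $$ (i, j)"
      using adj_index[OF T_carrier ij] adj_index[OF V_carrier ij] by (simp_all add: T_adj V_adj)
    then show "adj (T + V) $$ (i, j) = (T + V) $$ (i, j)"
      using ij T_carrier V_carrier adj_index[OF H_carrier ij] by simp
  qed (use V_carrier in \<open>auto simp: adj_def\<close>)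
  then have "adj (U (of_real t)) = expo H (- (- \<i> * of_real t))"
    by (simp add: adj_expo[OF H_carrier])
  then show "adj (U (of_real t)) * U (of_real t) = 1\<^sub>m m"
    using expo_neg[OF H_carrier, of "- \<i> * of_real t"] by simp
  have "preserves m K H"
    using T_preserves V_preserves T_carrier V_carrier by (auto simp: preserves_def)
  then show "preserves m K (U (of_real t))" by (intro preserves_expo H_carrier)
qed (rule expo_carrier[OF H_carrier])

text \<open>The derivative of \<open>s \<mapsto> S(s) U(t - s)\<close> is \<open>S(s) R(s) U(t - s)\<close>.\<close>

definition R :: "(real \<times> bool) list \<Rightarrow> complex \<Rightarrow> complex mat" where
  "R G z = gen_sum G z + \<i> \<cdot>\<^sub>m H"

lemma R_carrier [simp]: "R G z \<in> carrier_mat m m"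
  by (simp add: R_def)

text \<open>With D = S - U, the identities S' = S W and U' = - i U H give S R = D' + i D H. This
  transports the order condition on D to R.\<close>

lemma S_mult_R:
  "S G z * R G z = (S G z * gen_sum G z - (- \<i>) \<cdot>\<^sub>m (U z * H)) + \<i> \<cdot>\<^sub>m ((S G z - U z) * H)"
proof -
  have Uc: "U z \<in> carrier_mat m m" by (rule expo_carrier[OF H_carrier])
  have SH: "S G z * H \<in> carrier_mat m m" and UH: "U z * H \<in> carrier_mat m m" 
    using Uc by (auto intro: mult_square_carrier[OF _ H_carrier])
  have "S G z * R G z = S G z * gen_sum G z + S G z * (\<i> \<cdot>\<^sub>m H)"
    unfolding R_def by (rule mult_add_distrib_mat[of _ m m _ m]) simp_all
  also have "S G z * (\<i> \<cdot>\<^sub>m H) = \<i> \<cdot>\<^sub>m (S G z * H)"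
    by (rule mult_smult_distrib[of _ m m _ m]) simp_all
  finally have 1: "S G z * R G z = S G z * gen_sum G z + \<i> \<cdot>\<^sub>m (S G z * H)" .
  have 2: "(S G z - U z) * H = S G z * H - U z * H"
    by (rule minus_mult_distrib_mat[OF S_carrier Uc H_carrier])
  have "A + \<i> \<cdot>\<^sub>m B = (A - (- \<i>) \<cdot>\<^sub>m C) + \<i> \<cdot>\<^sub>m (B - C)"
    if "A \<in> carrier_mat m m" "B \<in> carrier_mat m m" "C \<in> carrier_mat m m" for A B C :: "complex mat"
    using that by (intro eq_matI) (auto simp: algebra_simps)
  from this[OF _ SH UH, of "S G z * gen_sum G z"] show ?thesis unfolding 1 2 by simp
qed

text \<open>The entries of D = S - U are entire, so their order p + 1 gives order p for the
  derivative; by \<open>S_mult_R\<close> the product S R has order p, and the unitary S is moved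
  onto a state. The constants may depend on everything.\<close>

lemma R_small:
  assumes order: "\<And>i j. i < m \<Longrightarrow> j < m \<Longrightarrow>
      \<exists>C. \<forall>\<^sub>F t in at (0::real). cmod ((S G (of_real t) - U (of_real t)) $$ (i, j)) \<le> C * \<bar>t\<bar> ^ Suc p"
    and \<phi>: "sector_state m K \<phi>" and \<psi>: "sector_state m K \<psi>"
  shows "small_order p (\<lambda>t. cip m \<phi> (R G (of_real t) *\<^sub>v \<psi>))"
proof -
  note v = sector_state_carrier[OF \<phi>] sector_state_carrier[OF \<psi>]
  have Uc: "U z \<in> carrier_mat m m" for z by (rule expo_carrier[OF H_carrier])
  define D where "D z = S G z - U z" for z
  define D' where "D' z = S G z * gen_sum G z - (- \<i>) \<cdot>\<^sub>m (U z * H)" for z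
  have Dc: "D z \<in> carrier_mat m m" and D'c: "D' z \<in> carrier_mat m m" for z
    unfolding D_def D'_def using Uc by (auto intro!: minus_carrier_mat)
  have deriv: "mat_deriv m D (D' z) z" for z
  proof -
    have "mat_deriv m (\<lambda>w. U w) ((- \<i>) \<cdot>\<^sub>m (U z * H)) z"
      using mat_deriv_chain[of m "expo H" "U z * H" 0 "- \<i>" z] mat_deriv_expo[OF H_carrier, of "- \<i> * z"] by simp
    from mat_deriv_diff[OF S_deriv this] show ?thesis unfolding D_def D'_def .
  qed
  have smallD': "small_order p (\<lambda>t. D' (of_real t) $$ (i, j))" if ij: "i < m" "j < m" for i j
  proof -
    from order[OF ij] obtain C where
      C: "\<forall>\<^sub>F t in at (0::real). cmod (D (of_real t) $$ (i, j)) \<le> C * \<bar>t\<bar> ^ Suc p" by (auto simp: D_def)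
    have "((\<lambda>w. D w $$ (i, j)) has_field_derivative D' z $$ (i, j)) (at z)" for z
      using deriv[of z] ij by (auto simp: mat_deriv_def)
    from entire_order_deriv[of "\<lambda>w. D w $$ (i, j)" "\<lambda>w. D' w $$ (i, j)", OF this C]
    show ?thesis by (simp add: small_order_def)
  qed
  have smallD: "small_order p (\<lambda>t. D (of_real t) $$ (i, j))" if ij: "i < m" "j < m" for i j
  proof -
    from order[OF ij] obtain C where
      "\<forall>\<^sub>F t in at (0::real). cmod (D (of_real t) $$ (i, j)) \<le> C * \<bar>t\<bar> ^ Suc p" by (auto simp: D_def)
    then have C: "\<forall>\<^sub>F t in at_right (0::real). cmod (D (of_real t) $$ (i, j)) \<le> C * \<bar>t\<bar> ^ Suc p"
      by (simp add: eventually_at_split)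
    have ev1: "\<forall>\<^sub>F t in at_right (0::real). t < 1" by (rule eventually_at_rightI[of 0 1]) auto
    have "\<forall>\<^sub>F t in at_right (0::real). cmod (D (of_real t) $$ (i, j)) \<le> \<bar>C\<bar> * t ^ p"
      using C ev1 eventually_at_right_less[of 0]
    proof eventually_elim
      case (elim t)
      have "C * \<bar>t\<bar> ^ Suc p \<le> \<bar>C\<bar> * t ^ p"
        using elim power_decreasing[of p "Suc p" t] by (intro mult_mono) auto
      with elim show ?case by linarith
    qed
    then show ?thesis by (auto simp: small_order_def)
  qed
  define X where "X z = S G z * R G z" for z
  have Xc: "X z \<in> carrier_mat m m" for z by (simp add: X_def)
  have X_index: "X z $$ (i, j) = D' z $$ (i, j) + \<i> * (\<Sum>l<m. H $$ (l, j) * D z $$ (i, l))"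
    if "i < m" "j < m" for i j z
  proof -
    have "X z = D' z + \<i> \<cdot>\<^sub>m (D z * H)" unfolding X_def D'_def D_def by (rule S_mult_R)
    moreover have "D z * H \<in> carrier_mat m m" by (rule mult_square_carrier[OF Dc H_carrier])
    ultimately have "X z $$ (i, j) = D' z $$ (i, j) + \<i> * (D z * H) $$ (i, j)"
      using that D'c[of z] by (simp del: index_mult_mat index_add_mat(2,3))
    then show ?thesis unfolding mult_index[OF Dc H_carrier that] by (simp add: mult.commute)
  qed
  have "small_order p (\<lambda>t. \<Sum>i<m. \<Sum>j<m. of_real (cmod (X (of_real t) $$ (i, j))))"
    unfolding small_order_norm
    by (intro small_order_sum, subst small_order_norm)
      (auto simp: X_index intro!: small_order_add small_order_cmult small_order_sum smallD smallD')
  then obtain C where C: "\<forall>\<^sub>F t in at_right (0::real).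
      cmod (\<Sum>i<m. \<Sum>j<m. complex_of_real (cmod (X (of_real t) $$ (i, j)))) \<le> C * t ^ p"
    by (auto simp: small_order_def)
  have "cmod (cip m \<phi> (R G (of_real t) *\<^sub>v \<psi>)) \<le> cmod (\<Sum>i<m. \<Sum>j<m. complex_of_real (cmod (X (of_real t) $$ (i, j))))"
    for t :: real
  proof -
    have "R G (of_real t) = SI G (of_real t) * X (of_real t)"
      using sq_simps[of "SI G (of_real t)" "S G (of_real t)" "R G (of_real t)"]
      by (simp add: X_def SI_S sq_left)
    then have "cip m \<phi> (R G (of_real t) *\<^sub>v \<psi>) = cip m \<phi> (SI G (of_real t) *\<^sub>v (X (of_real t) *\<^sub>v \<psi>))"
      using v Xc by (simp add: sq_vec)
    also have "\<dots> = cip m (S G (of_real t) *\<^sub>v \<phi>) (X (of_real t) *\<^sub>v \<psi>)"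
      using cip_adj[OF SI_carrier v(1) mult_mat_vec_carrier[OF Xc v(2)]] by (simp only: adj_SI)
    finally have "cmod (cip m \<phi> (R G (of_real t) *\<^sub>v \<psi>)) \<le> (\<Sum>i<m. \<Sum>j<m. cmod (X (of_real t) $$ (i, j)))"
      using cip_entry_bound[OF Xc S_state[OF \<phi>] \<psi>] by simp
    also have "\<dots> = cmod (of_real (\<Sum>i<m. \<Sum>j<m. cmod (X (of_real t) $$ (i, j))))"
      by (simp only: norm_of_real) (simp add: sum_nonneg)
    finally show ?thesis by simp
  qed
  then show ?thesis unfolding small_order_def
    by (intro exI[of _ C] eventually_mono[OF C]) (meson order_trans)
qed

text \<open>The path \<open>F w\<close> leads from U(t) at 0 to S(t) at t. Instead of integrating
  its derivative, a mean value inequality on the segment is used: a bound of order t^p times the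
  length t.\<close>

theorem product_formula_error:
  assumes order: "\<And>i j. i < m \<Longrightarrow> j < m \<Longrightarrow>
      \<exists>C. \<forall>\<^sub>F t in at (0::real). cmod ((S G (of_real t) - U (of_real t)) $$ (i, j)) \<le> C * \<bar>t\<bar> ^ Suc p"
    and p: "1 \<le> p" and M: "0 \<le> M" "nested_bound p M T" "nested_bound p M V" and t: "0 \<le> t"
  shows "form_bound m K (formula_const p G * M * t ^ Suc p) (S G (of_real t) - U (of_real t))"
  unfolding form_bound_def
proof (intro allI impI)
  fix \<phi> \<psi> assume \<phi>: "sector_state m K \<phi>" and \<psi>: "sector_state m K \<psi>"
  note v = sector_state_carrier[OF \<phi>] sector_state_carrier[OF \<psi>]
  have Uc: "U z \<in> carrier_mat m m" for z by (rule expo_carrier[OF H_carrier])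
  let ?C = "formula_const p G * M"
  have R_bound: "cmod (cip m \<phi>' (R G (of_real s) *\<^sub>v \<psi>')) \<le> ?C * s ^ p"
    if \<phi>': "sector_state m K \<phi>'" and \<psi>': "sector_state m K \<psi>'" and s: "0 \<le> s" for \<phi>' \<psi>' s
  proof -
    note v' = sector_state_carrier[OF \<phi>'] sector_state_carrier[OF \<psi>']
    obtain C where C: "\<forall>\<^sub>F t in at_right (0::real). cmod (cip m \<phi>' (R G (of_real t) *\<^sub>v \<psi>')) \<le> C * t ^ p"
      using R_small[OF order \<phi>' \<psi>'] by (auto simp: small_order_def)
    \<comment> \<open>The summand from iH is constant in t and belongs to a polynomial of degree
      less than p; this is where p \<ge> 1 is used. It adds nothing to the remainder.\<close>
    have "poly_approx p (?C + 0) (\<lambda>t. cip m \<phi>' (gen_sum G (of_real t) *\<^sub>v \<psi>') + cip m \<phi>' ((\<i> \<cdot>\<^sub>m H) *\<^sub>v \<psi>'))"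
      using p by (intro poly_approx_add gen_sum_approx poly_approx_const M \<phi>' \<psi>') auto
    moreover have "cip m \<phi>' (R G (of_real t) *\<^sub>v \<psi>')
        = cip m \<phi>' (gen_sum G (of_real t) *\<^sub>v \<psi>') + cip m \<phi>' ((\<i> \<cdot>\<^sub>m H) *\<^sub>v \<psi>')" for t :: real
      unfolding R_def by (rule cip_add) (use v' in simp_all)
    ultimately have "poly_approx p ?C (\<lambda>t. cip m \<phi>' (R G (of_real t) *\<^sub>v \<psi>'))" by simp
    from poly_approx_bound[OF this C s] show ?thesis .
  qed
  define F where "F w = S G w * U (of_real t - w)" for w
  define F' where "F' w = S G w * R G w * U (of_real t - w)" for w
  have Fc: "F w \<in> carrier_mat m m" for w unfolding F_def using Uc by simp
  have deriv: "mat_deriv m F (F' w) w" for w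
  proof -
    let ?u = "U (of_real t - w)"
    have "mat_deriv m (\<lambda>w. expo H (- \<i> * of_real t + \<i> * w)) (\<i> \<cdot>\<^sub>m (?u * H)) w"
      by (rule mat_deriv_chain) (use mat_deriv_expo[OF H_carrier, of "- \<i> * of_real t + \<i> * w"] in \<open>simp add: algebra_simps\<close>)
    then have "mat_deriv m (\<lambda>w. U (of_real t - w)) (\<i> \<cdot>\<^sub>m (?u * H)) w"
      by (simp add: algebra_simps)
    from mat_deriv_mult[OF S_deriv this, of G]
    have "mat_deriv m F (S G w * gen_sum G w * ?u + S G w * (\<i> \<cdot>\<^sub>m (?u * H))) w"
      unfolding F_def .
    moreover have "S G w * gen_sum G w * ?u + S G w * (\<i> \<cdot>\<^sub>m (?u * H)) = F' w"
    proof -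
      have "\<i> \<cdot>\<^sub>m (?u * H) = (\<i> \<cdot>\<^sub>m H) * ?u"
        using Uc[of "of_real t - w"] mult_smult_assoc_mat[OF H_carrier, of ?u m \<i>] expo_comm[OF H_carrier] by simp
      then have "S G w * gen_sum G w * ?u + S G w * (\<i> \<cdot>\<^sub>m (?u * H))
          = S G w * (gen_sum G w * ?u) + S G w * ((\<i> \<cdot>\<^sub>m H) * ?u)"
        using Uc[of "of_real t - w"] by (simp add: sq_simps)
      also have "\<dots> = S G w * (gen_sum G w * ?u + (\<i> \<cdot>\<^sub>m H) * ?u)"
        by (rule mult_add_distrib_mat[of _ m m _ m, symmetric]) (use Uc H_carrier in simp_all)
      also have "gen_sum G w * ?u + (\<i> \<cdot>\<^sub>m H) * ?u = R G w * ?u"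
        unfolding R_def by (rule add_mult_distrib_mat[OF gen_sum_carrier _ Uc, symmetric]) simp
      also have "S G w * (R G w * ?u) = F' w"
        unfolding F'_def by (rule sq_simps[symmetric]) (use Uc in simp_all)
      finally show ?thesis .
    qed
    ultimately show ?thesis by simp
  qed
  \<comment> \<open>The outer unitaries are moved onto the two states, which stay in the sector, and
    only R is left to estimate.\<close>
  have bound: "cmod (cip m \<phi> (F' (of_real s) *\<^sub>v \<psi>)) \<le> ?C * t ^ p" if s: "0 \<le> s" "s \<le> t" for s
  proof -
    let ?\<psi> = "U (of_real (t - s)) *\<^sub>v \<psi>"
    have \<psi>': "sector_state m K ?\<psi>" by (rule U_state[OF \<psi>])
    have c: "R G (of_real s) *\<^sub>v ?\<psi> \<in> carrier_vec m"
      by (rule mult_mat_vec_carrier[OF R_carrier sector_state_carrier[OF \<psi>']])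
    have "F' (of_real s) *\<^sub>v \<psi> = S G (of_real s) *\<^sub>v (R G (of_real s) *\<^sub>v ?\<psi>)"
      unfolding F'_def using Uc v sector_state_carrier[OF \<psi>'] by (simp add: sq_vec)
    then have "cip m \<phi> (F' (of_real s) *\<^sub>v \<psi>) = cip m (SI G (of_real s) *\<^sub>v \<phi>) (R G (of_real s) *\<^sub>v ?\<psi>)"
      using cip_adj[OF S_carrier v(1) c] by (simp only: adj_S)
    then have "cmod (cip m \<phi> (F' (of_real s) *\<^sub>v \<psi>)) \<le> ?C * s ^ p"
      using R_bound[OF SI_state[OF \<phi>] \<psi>' s(1)] by simp
    also have "\<dots> \<le> ?C * t ^ p"
      using s M formula_const_nonneg by (intro mult_left_mono power_mono) auto
    finally show ?thesis .
  qed
  have "cmod (cip m \<phi> (F (of_real t) *\<^sub>v \<psi>) - cip m \<phi> (F 0 *\<^sub>v \<psi>)) \<le> (?C * t ^ p) * cmod (of_real t - 0)"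
  proof (rule field_differentiable_bound)
    show "convex (closed_segment 0 (complex_of_real t))" by simp
    show "((\<lambda>w. cip m \<phi> (F w *\<^sub>v \<psi>)) has_field_derivative cip m \<phi> (F' w *\<^sub>v \<psi>)) (at w within closed_segment 0 (of_real t))" for w
      by (rule has_field_derivative_at_within[OF cip_deriv[OF deriv v(2)]])
    fix w assume "w \<in> closed_segment 0 (complex_of_real t)"
    then obtain u where u: "0 \<le> u" "u \<le> 1" "w = of_real (u * t)" by (auto simp: in_segment scaleR_conv_of_real)
    then show "cmod (cip m \<phi> (F' w *\<^sub>v \<psi>)) \<le> ?C * t ^ p"
      using bound[of "u * t"] t by (simp add: mult_left_le_one_le)
  qed auto
  moreover have "F (of_real t) = S G (of_real t)" "F 0 = U (of_real t)"
  proof -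
    show "F (of_real t) = S G (of_real t)"
      by (simp add: F_def expo_0[OF H_carrier] right_mult_one_mat[of _ m m])
    have "S G 0 = 1\<^sub>m m"
      by (induction G) (simp_all add: expo_0[OF part_carrier])
    then show "F 0 = U (of_real t)" using Uc by (simp add: F_def sq_left)
  qed
  ultimately show "cmod (cip m \<phi> ((S G (of_real t) - U (of_real t)) *\<^sub>v \<psi>)) \<le> ?C * t ^ Suc p"
    unfolding cip_diff[OF S_carrier Uc v(2)] using t by (simp add: mult_ac)
qed

end

section \<open>From matrices to operators\<close>

definition supported :: "nat \<Rightarrow> (nat \<Rightarrow> complex) \<Rightarrow> bool" where
  "supported m f \<longleftrightarrow> (\<forall>s\<ge>m. f s = 0)"

text \<open>The matrix describes the operator on functions supported below m, and that support must
  be preserved. Both facts together make the relation compatible with products.\<close>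

definition rep :: "nat \<Rightarrow> complex mat \<Rightarrow> nat lop \<Rightarrow> bool" where
  "rep m M L \<longleftrightarrow> M \<in> carrier_mat m m \<and> (\<forall>f. supported m f \<longrightarrow>
     supported m (ap L f) \<and> (\<forall>s<m. ap L f s = (\<Sum>r<m. M $$ (s, r) * f r)))"

lemma rep_carrier: "rep m M L \<Longrightarrow> M \<in> carrier_mat m m"
  by (simp add: rep_def)

lemma rep_supported: "rep m M L \<Longrightarrow> supported m f \<Longrightarrow> supported m (ap L f)"
  by (simp add: rep_def)

lemma rep_apply: "rep m M L \<Longrightarrow> supported m f \<Longrightarrow> s < m \<Longrightarrow> ap L f s = (\<Sum>r<m. M $$ (s, r) * f r)"
  by (simp add: rep_def)

lemma rep_mult:
  assumes A: "rep m A P" and B: "rep m B Q" shows "rep m (A * B) (P * Q)"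
  unfolding rep_def
proof (intro conjI allI impI)
  note c = rep_carrier[OF A] rep_carrier[OF B]
  show "A * B \<in> carrier_mat m m" using c by simp
  fix f assume f: "supported m f"
  have g: "supported m (ap Q f)" by (rule rep_supported[OF B f])
  show "supported m (ap (P * Q) f)" using rep_supported[OF A g] by simp
  fix s assume s: "s < m"
  have "ap (P * Q) f s = (\<Sum>r<m. A $$ (s, r) * (\<Sum>l<m. B $$ (r, l) * f l))"
    using rep_apply[OF A g s] rep_apply[OF B f] by simp
  also have "\<dots> = (\<Sum>l<m. \<Sum>r<m. A $$ (s, r) * B $$ (r, l) * f l)"
    unfolding sum_distrib_left by (subst sum.swap) (simp add: mult.assoc)
  also have "\<dots> = (\<Sum>l<m. (A * B) $$ (s, l) * f l)"
    using c s by (intro sum.cong refl) (simp add: mult_index sum_distrib_right del: index_mult_mat)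
  finally show "ap (P * Q) f s = (\<Sum>l<m. (A * B) $$ (s, l) * f l)" .
qed

lemma rep_add:
  assumes A: "rep m A P" and B: "rep m B Q" shows "rep m (A + B) (P + Q)"
  using rep_carrier[OF A] rep_carrier[OF B] assms
  by (auto simp: rep_def supported_def distrib_right sum.distrib)

lemma rep_diff:
  assumes A: "rep m A P" and B: "rep m B Q" shows "rep m (A - B) (P - Q)"
  using rep_carrier[OF A] rep_carrier[OF B] assms
  by (auto simp: rep_def supported_def left_diff_distrib sum_subtractf intro!: minus_carrier_mat)

lemma rep_smult:
  assumes A: "rep m A P" shows "rep m (c \<cdot>\<^sub>m A) (scop c * P)"
  using rep_carrier[OF A] assms
  by (auto simp: rep_def supported_def sum_distrib_left mult.assoc)

lemma rep_zero: "rep m (0\<^sub>m m m) 0"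
  by (auto simp: rep_def supported_def)

lemma rep_comm: "rep m A P \<Longrightarrow> rep m B Q \<Longrightarrow> rep m (mcomm A B) (comm P Q)"
  by (intro rep_diff rep_mult)

lemma msum_insert:
  assumes "finite I" "i \<notin> I" shows "msum m f (insert i I) = f i + msum m f I"
proof -
  interpret comp_fun_commute "\<lambda>i acc. f i + acc"
    \<comment> \<open>A matrix sum takes its dimensions from the right summand, so adding on the
      left commutes without any carrier condition on the terms.\<close>
    by standard (intro ext eq_matI, auto simp: algebra_simps)
  show ?thesis unfolding msum_def using assms by simp
qed

lemma rep_msum:
  assumes "finite I" "\<And>i. i \<in> I \<Longrightarrow> rep m (f i) (g i)"
  shows "rep m (msum m f I) (\<Sum>i\<in>I. g i)"
  using assms
proof (induction I rule: finite_induct)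
  case empty
  then show ?case by (simp add: msum_def rep_zero)
next
  case (insert x F)
  then show ?case by (simp add: msum_insert rep_add)
qed

lemma jw_sign_cnj [simp]: "cnj (jw_sign j s) = jw_sign j s"
  by (simp add: jw_sign_def)

lemma cre_index:
  assumes "r < 2 ^ n" "s < 2 ^ n"
  shows "cre n j $$ (r, s) = (if \<not> bit s j \<and> r = set_bit j s then jw_sign j s else 0)"
  using assms by (auto simp: cre_def occ_bit jw_sign_def set_bit_plus)

lemma cre_carrier: "cre n j \<in> carrier_mat (2 ^ n) (2 ^ n)"
  by (simp add: cre_def)

lemma rep_cre:
  assumes j: "j < n" shows "rep (2 ^ n) (cre n j) (fcre j)"
  unfolding rep_def
proof (intro conjI allI impI)
  show "cre n j \<in> carrier_mat (2 ^ n) (2 ^ n)" by (rule cre_carrier)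
  fix f assume f: "supported (2 ^ n) f"
  show "supported (2 ^ n) (ap (fcre j) f)"
    using f j by (auto simp: supported_def ap_fcre unset_bit_ge_pow)
  fix s :: nat assume s: "s < 2 ^ n"
  have "(\<Sum>r<2^n. cre n j $$ (s, r) * f r)
      = (\<Sum>r<2^n. if r = unset_bit j s then (if bit s j then jw_sign j s * f r else 0) else 0)"
    using s by (intro sum.cong refl)
      (auto simp: cre_index unset_set_same set_unset_same jw_sign_unset jw_sign_set)
  then show "ap (fcre j) f s = (\<Sum>r<2^n. cre n j $$ (s, r) * f r)"
    using s by (simp add: ap_fcre unset_bit_less)
qed

lemma le_set_bit: "s \<le> set_bit j s" for s :: nat
proof (cases "bit s j")
  case True
  then have "set_bit j s = s" by (intro bit_eqI) auto
  then show ?thesis by simp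
qed (simp add: set_bit_plus)

lemma rep_ann:
  assumes j: "j < n" shows "rep (2 ^ n) (ann n j) (fann j)"
  unfolding rep_def
proof (intro conjI allI impI)
  show "ann n j \<in> carrier_mat (2 ^ n) (2 ^ n)" unfolding ann_def using cre_carrier by simp
  fix f assume f: "supported (2 ^ n) f"
  have "2 ^ n \<le> set_bit j s" if "2 ^ n \<le> s" for s :: nat
    using that le_set_bit[of s j] by linarith
  then show "supported (2 ^ n) (ap (fann j) f)"
    using f by (auto simp: supported_def ap_fann)
  fix s :: nat assume s: "s < 2 ^ n"
  have "(\<Sum>r<2^n. ann n j $$ (s, r) * f r)
      = (\<Sum>r<2^n. if r = set_bit j s then (if bit s j then 0 else jw_sign j s * f r) else 0)"
    using s by (intro sum.cong refl) (auto simp: ann_def adj_index[OF cre_carrier] cre_index)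
  then show "ap (fann j) f s = (\<Sum>r<2^n. ann n j $$ (s, r) * f r)"
    using s j by (auto simp: ap_fann set_bit_less_pow)
qed

lemma rep_numop: "j < n \<Longrightarrow> rep (2 ^ n) (numop n j) (fnum j)"
  unfolding numop_def fnum_def by (intro rep_mult rep_cre rep_ann)

lemma rep_hop: "rep (2 ^ n) (hop_op n \<tau>) (gen n True (\<lambda>e. \<tau> $$ e))"
  unfolding hop_op_def gen_def
  by (rule rep_msum) (auto intro!: rep_smult rep_mult rep_cre rep_ann)

lemma rep_int: "rep (2 ^ n) (int_op n \<nu>) (gen n False (\<lambda>e. \<nu> $$ e))"
  unfolding int_op_def gen_def
  by (rule rep_msum) (auto intro!: rep_smult rep_mult rep_numop)

definition vec_fun :: "nat \<Rightarrow> complex Matrix.vec \<Rightarrow> nat \<Rightarrow> complex" where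
  "vec_fun m \<psi> s = (if s < m then \<psi> $ s else 0)"

lemma supported_vec_fun: "supported m (vec_fun m \<psi>)"
  by (simp add: supported_def vec_fun_def)

lemma rep_vec:
  assumes "rep m M L" "\<psi> \<in> carrier_vec m" "s < m"
  shows "(M *\<^sub>v \<psi>) $ s = ap L (vec_fun m \<psi>) s"
  using mult_vec_index[OF rep_carrier[OF assms(1)] assms(2,3)]
    rep_apply[OF assms(1) supported_vec_fun assms(3), of \<psi>] by (simp add: vec_fun_def)

lemma in_sector_edge:
  assumes f: "in_sector n \<eta> f" and e: "e \<in> {0..<n} \<times> {0..<n}"
  shows "in_sector n \<eta> (ap (edge_op b e) f)"
proof -
  obtain j k where jk: "e = (j, k)" "j < n" "k < n" using e by auto
  show ?thesis
  proof (cases b)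
    case False
    then show ?thesis using f jk by (auto simp: in_sector_def ap_fnum split: if_splits)
  next
    case True
    show ?thesis unfolding in_sector_def
    proof (intro allI impI)
      fix s assume "ap (edge_op b e) f s \<noteq> 0"
      then have s: "bit s j" "\<not> bit (unset_bit j s) k" "f (set_bit k (unset_bit j s)) \<noteq> 0"
        using True jk by (auto simp: ap_fcre ap_fann split: if_splits)
      then have "set_bit k (unset_bit j s) < 2 ^ n" "num_el n (set_bit k (unset_bit j s)) = \<eta>"
        using f by (auto simp: in_sector_def)
      moreover have "num_el n (set_bit k (unset_bit j s)) = num_el n s"
        using num_el_set[OF s(2) jk(3)] num_el_unset[OF s(1) jk(2)] by simp
      moreover have "unset_bit j s < 2 ^ n"
        using \<open>set_bit k (unset_bit j s) < 2 ^ n\<close> le_set_bit[of "unset_bit j s" k] by linarith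
      ultimately show "s < 2 ^ n \<and> num_el n s = \<eta>"
        using unset_bit_ge_pow[of n s j] jk(2) by (auto simp: not_less[symmetric])
    qed
  qed
qed

definition sector_op :: "nat \<Rightarrow> nat \<Rightarrow> nat lop \<Rightarrow> bool" where
  "sector_op n \<eta> L \<longleftrightarrow> (\<forall>f. in_sector n \<eta> f \<longrightarrow> in_sector n \<eta> (ap L f))"

lemma sector_op_gen: "sector_op n \<eta> (gen n b w)"
  unfolding sector_op_def
proof (intro allI impI)
  fix f assume f: "in_sector n \<eta> f"
  show "in_sector n \<eta> (ap (gen n b w) f)"
    unfolding in_sector_def
  proof (intro allI impI)
    fix s assume "ap (gen n b w) f s \<noteq> 0"
    then obtain e where "e \<in> {0..<n} \<times> {0..<n}" "ap (edge_op b e) f s \<noteq> 0"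
      unfolding gen_def ap_sum by (auto elim!: sum.not_neutral_contains_not_neutral)
    then show "s < 2 ^ n \<and> num_el n s = \<eta>"
      using in_sector_edge[OF f] by (auto simp: in_sector_def)
  qed
qed

lemma sector_op_comm: "sector_op n \<eta> P \<Longrightarrow> sector_op n \<eta> Q \<Longrightarrow> sector_op n \<eta> (comm P Q)"
  unfolding sector_op_def
proof (intro allI impI)
  fix f assume a: "\<forall>f. in_sector n \<eta> f \<longrightarrow> in_sector n \<eta> (ap P f)"
    "\<forall>f. in_sector n \<eta> f \<longrightarrow> in_sector n \<eta> (ap Q f)" "in_sector n \<eta> f"
  then have "in_sector n \<eta> (ap P (ap Q f))" "in_sector n \<eta> (ap Q (ap P f))" by auto
  moreover have "ap P (ap Q f) s \<noteq> 0 \<or> ap Q (ap P f) s \<noteq> 0" if "ap (comm P Q) f s \<noteq> 0" for s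
    using that by auto
  ultimately show "in_sector n \<eta> (ap (comm P Q) f)" unfolding in_sector_def by blast
qed

abbreviation sector :: "nat \<Rightarrow> nat \<Rightarrow> nat set" where
  "sector n \<eta> \<equiv> {s. num_el n s = \<eta>}"

lemma sector_op_preserves:
  assumes M: "rep (2 ^ n) M L" and L: "sector_op n \<eta> L"
  shows "preserves (2 ^ n) (sector n \<eta>) M"
  unfolding preserves_def
proof (intro allI impI)
  fix i j assume ij: "i < 2 ^ n" "j < 2 ^ n" "j \<in> sector n \<eta>" "i \<notin> sector n \<eta>"
  define f where "f s = (if s = j then 1 else 0 :: complex)" for s
  have "supported (2 ^ n) f" using ij by (auto simp: supported_def f_def)
  from rep_apply[OF M this ij(1)] have "ap L f i = M $$ (i, j)"
    using ij(2) by (simp add: f_def if_distrib[of "\<lambda>x. _ * x"] cong: if_cong)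
  moreover have "in_sector n \<eta> f" using ij by (auto simp: in_sector_def f_def)
  then have "in_sector n \<eta> (ap L f)" using L by (simp add: sector_op_def)
  then have "ap L f i = 0" using ij(4) unfolding in_sector_def by blast
  ultimately show "M $$ (i, j) = 0" by simp
qed

lemma in_sector_state:
  assumes "sector_state (2 ^ n) (sector n \<eta>) \<psi>"
  shows "in_sector n \<eta> (vec_fun (2 ^ n) \<psi>)" "l2 {..<2^n} (vec_fun (2 ^ n) \<psi>) = 1"
proof -
  show "in_sector n \<eta> (vec_fun (2 ^ n) \<psi>)"
    using assms by (auto simp: sector_state_def in_sector_def vec_fun_def split: if_splits)
  have "(l2 {..<2^n} (vec_fun (2 ^ n) \<psi>))\<^sup>2 = (\<Sum>s<2^n. (cmod (\<psi> $ s))\<^sup>2)"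
    unfolding l2_power2 by (intro sum.cong) (auto simp: vec_fun_def)
  then show "l2 {..<2^n} (vec_fun (2 ^ n) \<psi>) = 1"
    using assms l2_nonneg[of "{..<2^n}" "vec_fun (2 ^ n) \<psi>"] by (simp add: sector_state_def power2_eq_1_iff)
qed

lemma cip_l2:
  assumes "rep m M L" "\<psi> \<in> carrier_vec m"
  shows "cmod (cip m \<phi> (M *\<^sub>v \<psi>)) \<le> l2 {..<m} (vec_fun m \<phi>) * l2 {..<m} (ap L (vec_fun m \<psi>))"
proof -
  have "cmod (cip m \<phi> (M *\<^sub>v \<psi>)) \<le> (\<Sum>s<m. cmod (vec_fun m \<phi> s) * cmod (ap L (vec_fun m \<psi>) s))"
    unfolding cip_def
    by (rule sum_norm_le) (simp add: norm_mult rep_vec[OF assms] vec_fun_def del: index_mult_mat_vec)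
  also have "\<dots> \<le> l2 {..<m} (vec_fun m \<phi>) * l2 {..<m} (ap L (vec_fun m \<psi>))"
    unfolding l2_def
    using L2_set_mult_ineq[of "\<lambda>s. cmod (vec_fun m \<phi> s)" "\<lambda>s. cmod (ap L (vec_fun m \<psi>) s)" "{..<m}"]
    by simp
  finally show ?thesis .
qed

text \<open>The operators correspond under passage to amplitudes. Allowing every g that agrees with
  the amplitudes on \<open>configs\<close> leaves other lists out of play, which is what makes the
  relation compose.\<close>

definition intertwines :: "nat \<Rightarrow> nat \<Rightarrow> nat lop \<Rightarrow> nat list lop \<Rightarrow> bool" where
  "intertwines n \<eta> L F \<longleftrightarrow> (\<forall>f g. (\<forall>xs\<in>configs n \<eta>. g xs = amp xs f) \<longrightarrow>
     (\<forall>xs\<in>configs n \<eta>. amp xs (ap L f) = ap F g xs))"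

lemma intertwines_comm:
  assumes "intertwines n \<eta> P F" "intertwines n \<eta> Q G"
  shows "intertwines n \<eta> (comm P Q) (comm F G)"
  unfolding intertwines_def
proof (intro allI impI ballI)
  fix f g xs assume g: "\<forall>xs\<in>configs n \<eta>. g xs = amp xs f" and xs: "xs \<in> configs n \<eta>"
  have PF: "\<forall>xs\<in>configs n \<eta>. ap F g xs = amp xs (ap P f)" and QG: "\<forall>xs\<in>configs n \<eta>. ap G g xs = amp xs (ap Q f)"
    using assms g unfolding intertwines_def by metis+
  have "amp xs (ap P (ap Q f)) = ap F (ap G g) xs" "amp xs (ap Q (ap P f)) = ap G (ap F g) xs"
    using assms PF QG xs unfolding intertwines_def by metis+
  moreover have "ap (comm P Q) f = (\<lambda>s. ap P (ap Q f) s - ap Q (ap P f) s)" by auto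
  ultimately show "amp xs (ap (comm P Q) f) = ap (comm F G) g xs"
    by (simp add: amp_diff)
qed

lemma configs_update: "xs \<in> configs n \<eta> \<Longrightarrow> k < n \<Longrightarrow> xs[i := k] \<in> configs n \<eta>"
  using set_update_subset_insert[of xs i k] by (auto simp: configs_def)

lemma intertwines_hop:
  "intertwines n \<eta> (gen n True w) (\<Sum>i<\<eta>. slot n (\<lambda>j k. w (j, k)) i)"
  unfolding intertwines_def
proof (intro allI impI ballI)
  fix f g xs assume "\<forall>xs\<in>configs n \<eta>. g xs = amp xs f" and xs: "xs \<in> configs n \<eta>"
  then show "amp xs (ap (gen n True w) f) = ap (\<Sum>i<\<eta>. slot n (\<lambda>j k. w (j, k)) i) g xs"
    unfolding amp_hop_gen[OF xs] by (simp add: ap_sum ap_slot configs_update)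
qed

lemma intertwines_int:
  "intertwines n \<eta> (gen n False w) (\<Sum>(i,j)\<in>{..<\<eta>}\<times>{..<\<eta>}. pair_op (\<lambda>j k. w (j, k)) i j)"
  unfolding intertwines_def
proof (intro allI impI ballI)
  fix f g xs assume "\<forall>xs\<in>configs n \<eta>. g xs = amp xs f" and xs: "xs \<in> configs n \<eta>"
  then show "amp xs (ap (gen n False w) f)
      = ap (\<Sum>(i,j)\<in>{..<\<eta>}\<times>{..<\<eta>}. pair_op (\<lambda>j k. w (j, k)) i j) g xs"
    unfolding amp_int_gen[OF xs] by (simp add: ap_sum pair_op_def split_def)
qed

text \<open>Passing to amplitudes multiplies the squared norms of the input and of the output by the
  same factorial, since the operator preserves the sector; hence a norm bound for distinguishable
  particles carries over unchanged.\<close>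

lemma form_bound_intertwined:
  assumes M: "rep (2 ^ n) M L" and L: "sector_op n \<eta> L" and F: "intertwines n \<eta> L F"
    and c: "opb (configs n \<eta>) c F" "0 \<le> c"
  shows "form_bound (2 ^ n) (sector n \<eta>) c M"
  unfolding form_bound_def
proof (intro allI impI)
  fix \<phi> \<psi> assume \<phi>: "sector_state (2 ^ n) (sector n \<eta>) \<phi>" and \<psi>: "sector_state (2 ^ n) (sector n \<eta>) \<psi>"
  let ?f = "vec_fun (2 ^ n) \<psi>" and ?X = "configs n \<eta>"
  have sf: "in_sector n \<eta> ?f" "in_sector n \<eta> (ap L ?f)"
    using in_sector_state[OF \<psi>] L by (auto simp: sector_op_def)
  have "amp xs (ap L ?f) = ap F (\<lambda>xs. amp xs ?f) xs" if "xs \<in> ?X" for xs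
    using F[unfolded intertwines_def, THEN spec[of _ ?f], THEN spec[of _ "\<lambda>xs. amp xs ?f"]] that by simp
  then have "l2 ?X (\<lambda>xs. amp xs (ap L ?f)) = l2 ?X (ap F (\<lambda>xs. amp xs ?f))"
    unfolding l2_def by (intro L2_set_cong refl) simp
  then have "fact \<eta> * (l2 {..<2^n} (ap L ?f))\<^sup>2 = (l2 ?X (ap F (\<lambda>xs. amp xs ?f)))\<^sup>2"
    unfolding amp_norm[OF sf(2), symmetric] by (rule arg_cong)
  also have "\<dots> \<le> (c * l2 ?X (\<lambda>xs. amp xs ?f))\<^sup>2"
    by (rule power_mono) (use c(1) in \<open>simp_all add: opb_def l2_nonneg\<close>)
  also have "\<dots> = fact \<eta> * c\<^sup>2"
    using in_sector_state(2)[OF \<psi>] by (simp add: power_mult_distrib amp_norm[OF sf(1)])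
  finally have "(l2 {..<2^n} (ap L ?f))\<^sup>2 \<le> c\<^sup>2" by simp
  then have "l2 {..<2^n} (ap L ?f) \<le> c" using c(2) by (rule power2_le_imp_le)
  then show "cmod (cip (2 ^ n) \<phi> (M *\<^sub>v \<psi>)) \<le> c"
    using cip_l2[OF M sector_state_carrier[OF \<psi>], of \<phi>] in_sector_state(2)[OF \<phi>] by simp
qed

section \<open>Sparse interactions\<close>

definition n1 :: "nat \<Rightarrow> (nat \<Rightarrow> complex) \<Rightarrow> real" where
  "n1 m f = (\<Sum>s<m. cmod (f s))"

lemma n1_nonneg: "0 \<le> n1 m f"
  by (simp add: n1_def sum_nonneg)

lemma n1_diff: "n1 m (\<lambda>s. f s - g s) \<le> n1 m f + n1 m g"
  by (simp add: n1_def norm_triangle_ineq4 sum_mono flip: sum.distrib)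

text \<open>A bound on the l1 operator norm, the largest absolute column sum. Creation and
  annihilation operators cost at most 1: up to sign they send distinct basis states to distinct
  basis states or to 0.\<close>

definition bounded1 :: "nat \<Rightarrow> real \<Rightarrow> nat lop \<Rightarrow> bool" where
  "bounded1 m c L \<longleftrightarrow> (\<forall>f. supported m f \<longrightarrow> supported m (ap L f) \<and> n1 m (ap L f) \<le> c * n1 m f)"

lemma bounded1_mult:
  assumes "bounded1 m c P" "bounded1 m d Q" "0 \<le> c"
  shows "bounded1 m (c * d) (P * Q)"
  unfolding bounded1_def
proof (intro allI impI conjI)
  fix f assume f: "supported m f"
  have Q: "supported m (ap Q f)" "n1 m (ap Q f) \<le> d * n1 m f" using assms(2) f by (auto simp: bounded1_def)
  have P: "supported m (ap P (ap Q f))" "n1 m (ap P (ap Q f)) \<le> c * n1 m (ap Q f)"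
    using assms(1) Q by (auto simp: bounded1_def)
  show "supported m (ap (P * Q) f)" using P by simp
  have "c * n1 m (ap Q f) \<le> c * (d * n1 m f)" using Q assms(3) by (intro mult_left_mono)
  then show "n1 m (ap (P * Q) f) \<le> c * d * n1 m f" using P by (simp add: mult.assoc)
qed

lemma bounded1_comm:
  assumes "bounded1 m c P" "bounded1 m d Q" "0 \<le> c" "0 \<le> d"
  shows "bounded1 m (2 * c * d) (comm P Q)"
  unfolding bounded1_def
proof (intro allI impI conjI)
  fix f assume f: "supported m f"
  have 1: "supported m (ap (P * Q) f)" "n1 m (ap (P * Q) f) \<le> c * d * n1 m f"
    using bounded1_mult[OF assms(1,2,3)] f by (auto simp: bounded1_def)
  have 2: "supported m (ap (Q * P) f)" "n1 m (ap (Q * P) f) \<le> d * c * n1 m f"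
    using bounded1_mult[OF assms(2,1,4)] f by (auto simp: bounded1_def)
  have eq: "ap (comm P Q) f = (\<lambda>s. ap (P * Q) f s - ap (Q * P) f s)" by auto
  show "supported m (ap (comm P Q) f)" using 1(1) 2(1) by (simp add: eq supported_def)
  have "n1 m (ap (comm P Q) f) \<le> n1 m (ap (P * Q) f) + n1 m (ap (Q * P) f)"
    unfolding eq by (rule n1_diff)
  then show "n1 m (ap (comm P Q) f) \<le> 2 * c * d * n1 m f" using 1(2) 2(2) by (simp add: mult_ac)
qed

lemma bounded1_fcre: assumes "j < n" shows "bounded1 (2 ^ n) 1 (fcre j)"
  unfolding bounded1_def
proof (intro allI impI conjI)
  fix f assume f: "supported (2 ^ n) f"
  show "supported (2 ^ n) (ap (fcre j) f)" by (rule rep_supported[OF rep_cre[OF assms] f])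
  have "n1 (2 ^ n) (ap (fcre j) f) = (\<Sum>s\<in>{s. s < 2 ^ n \<and> bit s j}. cmod (f (unset_bit j s)))"
    unfolding n1_def by (intro sum.mono_neutral_cong_right) (auto simp: ap_fcre norm_mult)
  also have "\<dots> = (\<Sum>s\<in>{s. s < 2 ^ n \<and> \<not> bit s j}. cmod (f s))"
    by (rule sum.reindex_bij_witness[where i="set_bit j" and j="unset_bit j"])
      (auto simp: set_unset_same unset_set_same assms set_bit_less_pow unset_bit_less)
  also have "\<dots> \<le> (\<Sum>s<2^n. cmod (f s))" by (intro sum_mono2) auto
  finally show "n1 (2 ^ n) (ap (fcre j) f) \<le> 1 * n1 (2 ^ n) f" by (simp add: n1_def)
qed

lemma bounded1_fann: assumes "j < n" shows "bounded1 (2 ^ n) 1 (fann j)"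
  unfolding bounded1_def
proof (intro allI impI conjI)
  fix f assume f: "supported (2 ^ n) f"
  show "supported (2 ^ n) (ap (fann j) f)" by (rule rep_supported[OF rep_ann[OF assms] f])
  have "n1 (2 ^ n) (ap (fann j) f) = (\<Sum>s\<in>{s. s < 2 ^ n \<and> \<not> bit s j}. cmod (f (set_bit j s)))"
    unfolding n1_def by (intro sum.mono_neutral_cong_right) (auto simp: ap_fann norm_mult)
  also have "\<dots> = (\<Sum>s\<in>{s. s < 2 ^ n \<and> bit s j}. cmod (f s))"
    by (rule sum.reindex_bij_witness[where i="unset_bit j" and j="set_bit j"])
      (auto simp: set_unset_same unset_set_same assms set_bit_less_pow unset_bit_less)
  also have "\<dots> \<le> (\<Sum>s<2^n. cmod (f s))" by (intro sum_mono2) auto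
  finally show "n1 (2 ^ n) (ap (fann j) f) \<le> 1 * n1 (2 ^ n) f" by (simp add: n1_def)
qed

lemma bounded1_edge: assumes "e \<in> {0..<n} \<times> {0..<n}" shows "bounded1 (2 ^ n) 1 (edge_op b e)"
proof -
  obtain j k where jk: "e = (j, k)" "j < n" "k < n" using assms by auto
  have prod: "bounded1 (2 ^ n) 1 (P * Q)" if "bounded1 (2 ^ n) 1 P" "bounded1 (2 ^ n) 1 Q" for P Q
    using bounded1_mult[OF that] by simp
  show ?thesis using jk
    by (cases b) (auto simp: fnum_def intro!: prod bounded1_fcre bounded1_fann)
qed

section \<open>Nested commutators of monomials and linked edge lists\<close>

type_synonym edge = "bool \<times> nat \<times> nat"

definition edge_sites :: "edge \<Rightarrow> nat set" where
  "edge_sites x = {fst (snd x), snd (snd x)}"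

definition sites :: "edge list \<Rightarrow> nat set" where
  "sites xs = (\<Union>x\<in>set xs. edge_sites x)"

fun mono_comm :: "edge list \<Rightarrow> nat lop" where
  "mono_comm [] = 0"
| "mono_comm [x] = edge_op (fst x) (snd x)"
| "mono_comm (x # y # ys) = comm (edge_op (fst x) (snd x)) (mono_comm (y # ys))"

text \<open>Built from the innermost edge outwards: a new edge must meet the sites already present,
  since otherwise its monomial commutes with everything inside and the nested commutator is 0 from
  there on.\<close>

fun linked :: "edge list \<Rightarrow> bool" where
  "linked [] = True"
| "linked [x] = True"
| "linked (x # y # ys) = (edge_sites x \<inter> sites (y # ys) \<noteq> {} \<and> linked (y # ys))"

lemma finite_sites: "finite (sites xs)"
  by (simp add: sites_def edge_sites_def)

lemma card_sites: "card (sites xs) \<le> 2 * length xs"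
proof (induction xs)
  case (Cons x xs)
  have "sites (x # xs) = edge_sites x \<union> sites xs" by (simp add: sites_def)
  moreover have "card (edge_sites x) \<le> 2" by (simp add: edge_sites_def card_insert_if)
  ultimately show ?case using Cons card_Un_le[of "edge_sites x" "sites xs"] by simp
qed (simp add: sites_def)

lemma mono_comm_disjoint:
  "edge_sites x \<inter> sites ys = {} \<Longrightarrow>
    edge_op (fst x) (snd x) * mono_comm ys = mono_comm ys * edge_op (fst x) (snd x)"
proof (induction ys rule: mono_comm.induct)
  case (2 y)
  then show ?case using edge_op_comm[of "snd x" "snd y"] by (simp add: sites_def edge_sites_def)
next
  case (3 y z zs)
  let ?x = "edge_op (fst x) (snd x)" and ?y = "edge_op (fst y) (snd y)" and ?m = "mono_comm (z # zs)"
  have 1: "?x * ?y = ?y * ?x"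
    using "3.prems" edge_op_comm[of "snd x" "snd y"] by (auto simp: sites_def edge_sites_def)
  have "edge_sites x \<inter> sites (z # zs) = {}" using "3.prems" by (auto simp: sites_def)
  then have 2: "?x * ?m = ?m * ?x" by (rule "3.IH"(1))
  show ?case using comm_mult_right[OF 1 2] comm_mult_right[OF 2 1]
    by (simp add: right_diff_distrib left_diff_distrib)
qed simp

lemma mono_comm_unlinked: "\<not> linked xs \<Longrightarrow> mono_comm xs = 0"
proof (induction xs rule: mono_comm.induct)
  case (3 x y ys)
  then show ?case using mono_comm_disjoint[of x "y # ys"] by (cases "linked (y # ys)") auto
qed auto

lemma edge_op_vacuum:
  assumes "\<And>s x. f s \<noteq> 0 \<Longrightarrow> x \<in> {fst e, snd e} \<Longrightarrow> \<not> bit s x"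
  shows "ap (edge_op b e) f = (\<lambda>s. 0)"
proof -
  obtain j k where e: "e = (j, k)" by (cases e)
  have f: "f s = 0" if "bit s j \<or> bit s k" for s
    using assms[of s j] assms[of s k] that by (auto simp: e)
  show ?thesis by (cases b) (auto simp: e fun_eq_iff ap_fcre ap_fann ap_fnum f)
qed

text \<open>In either order of a commutator, the factor applied first already annihilates f: a
  single monomial by its annihilators, the inner commutator by induction.\<close>

lemma mono_comm_vacuum:
  assumes "\<And>s x. f s \<noteq> 0 \<Longrightarrow> x \<in> sites xs \<Longrightarrow> \<not> bit s x"
  shows "ap (mono_comm xs) f = (\<lambda>s. 0)"
  using assms
proof (induction xs rule: mono_comm.induct)
  case (2 x)
  then show ?case using edge_op_vacuum[of f "snd x" "fst x"] by (simp add: sites_def edge_sites_def)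
next
  case (3 x y ys)
  have "ap (mono_comm (y # ys)) f = (\<lambda>s. 0)" by (rule "3.IH"(1)) (use "3.prems" in \<open>auto simp: sites_def\<close>)
  moreover have "ap (edge_op (fst x) (snd x)) f = (\<lambda>s. 0)"
    by (rule edge_op_vacuum) (use "3.prems" in \<open>auto simp: sites_def edge_sites_def\<close>)
  ultimately show ?case by (intro ext) (simp add: ap_zero)
qed auto

text \<open>Each commutator doubles the bound. The innermost monomial is also charged a factor 2,
  for the sake of a uniform exponent.\<close>

lemma bounded1_mono_comm:
  "snd ` set xs \<subseteq> {0..<n} \<times> {0..<n} \<Longrightarrow> bounded1 (2 ^ n) (2 ^ length xs) (mono_comm xs)"
proof (induction xs rule: mono_comm.induct)
  case 1
  then show ?case by (simp add: bounded1_def supported_def n1_def sum_nonneg)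
next
  case (2 x)
  then have "bounded1 (2 ^ n) 1 (edge_op (fst x) (snd x))" by (intro bounded1_edge) auto
  then show ?case unfolding bounded1_def
  proof (intro allI impI)
    fix f assume a: "\<forall>f. supported (2 ^ n) f \<longrightarrow> supported (2 ^ n) (ap (edge_op (fst x) (snd x)) f) \<and>
        n1 (2 ^ n) (ap (edge_op (fst x) (snd x)) f) \<le> 1 * n1 (2 ^ n) f" and f: "supported (2 ^ n) f"
    show "supported (2 ^ n) (ap (mono_comm [x]) f) \<and>
        n1 (2 ^ n) (ap (mono_comm [x]) f) \<le> 2 ^ length [x] * n1 (2 ^ n) f"
      using n1_nonneg[of "2 ^ n" f] a[rule_format, OF f] by auto
  qed
next
  case (3 x y ys)
  have 1: "bounded1 (2 ^ n) 1 (edge_op (fst x) (snd x))" using "3.prems" by (intro bounded1_edge) auto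
  have 2: "bounded1 (2 ^ n) (2 ^ length (y # ys)) (mono_comm (y # ys))"
    by (rule "3.IH"(1)) (use "3.prems" in auto)
  from bounded1_comm[OF 1 2] show ?case by simp
qed

definition basis_fun :: "nat \<Rightarrow> nat \<Rightarrow> complex" where
  "basis_fun s r = (if r = s then 1 else 0)"

text \<open>For an operator represented by a matrix, this is the sum of the absolute values in
  column s.\<close>

definition col1 :: "nat \<Rightarrow> nat \<Rightarrow> nat lop \<Rightarrow> real" where
  "col1 m s L = n1 m (ap L (basis_fun s))"

lemma col1_mono_comm:
  assumes "snd ` set xs \<subseteq> {0..<n} \<times> {0..<n}" "s < 2 ^ n"
  shows "col1 (2 ^ n) s (mono_comm xs) \<le> 2 ^ length xs * of_bool (linked xs \<and> (\<exists>x\<in>sites xs. bit s x))"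
proof (cases "linked xs \<and> (\<exists>x\<in>sites xs. bit s x)")
  case True
  have "supported (2 ^ n) (basis_fun s)" "n1 (2 ^ n) (basis_fun s) = 1"
    using assms(2) by (auto simp: supported_def basis_fun_def n1_def if_distrib cong: if_cong)
  then have "col1 (2 ^ n) s (mono_comm xs) \<le> 2 ^ length xs * 1"
    using bounded1_mono_comm[OF assms(1)] unfolding bounded1_def col1_def by metis
  moreover have "of_bool (linked xs \<and> (\<exists>x\<in>sites xs. bit s x)) = (1::real)" using True by simp
  ultimately show ?thesis by (simp only:)
next
  case False
  have "ap (mono_comm xs) (basis_fun s) = (\<lambda>s. 0)"
  proof (cases "linked xs")
    case True
    with False show ?thesis by (intro mono_comm_vacuum) (auto simp: basis_fun_def split: if_splits)
  qed (simp add: mono_comm_unlinked fun_eq_iff)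
  then show ?thesis using False by (simp add: col1_def n1_def)
qed

lemma col1_add_le: "col1 m s (P + Q) \<le> col1 m s P + col1 m s Q"
  by (simp add: col1_def n1_def norm_triangle_ineq sum_mono flip: sum.distrib)

lemma col1_sum_le: "col1 m s (\<Sum>i\<in>I. f i) \<le> (\<Sum>i\<in>I. col1 m s (f i))"
proof (induction I rule: infinite_finite_induct)
  case (insert x F)
  then show ?case using col1_add_le[of m s "f x" "sum f F"] by simp
qed (simp_all add: col1_def n1_def)

lemma col1_scale: "col1 m s (scop c * P) = cmod c * col1 m s P"
  by (simp add: col1_def n1_def norm_mult sum_distrib_left)

abbreviation through :: "nat \<Rightarrow> edge list \<Rightarrow> real" where
  "through x xs \<equiv> of_bool (linked xs \<and> x \<in> sites xs)"

abbreviation touches :: "nat \<times> nat \<Rightarrow> nat set \<Rightarrow> real" where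
  "touches e A \<equiv> of_bool ({fst e, snd e} \<inter> A \<noteq> {})"

text \<open>Sparsity is used only in the form of bounds on absolute row and column sums; in the
  application \<open>D b\<close> is d times the largest entry.\<close>

locale sparse_gens =
  fixes n :: nat and w :: "bool \<Rightarrow> nat \<times> nat \<Rightarrow> complex" and D :: "bool \<Rightarrow> real"
  assumes row: "j < n \<Longrightarrow> (\<Sum>k<n. cmod (w b (j, k))) \<le> D b"
    and col: "k < n \<Longrightarrow> (\<Sum>j<n. cmod (w b (j, k))) \<le> D b"
    and D_nonneg: "0 \<le> D b"
begin

abbreviation E where "E \<equiv> {0..<n} \<times> {0..<n}"

fun nest :: "bool list \<Rightarrow> nat lop" where
  "nest [] = 0"
| "nest [b] = gen n b (w b)"
| "nest (b # b' # bs) = comm (gen n b (w b)) (nest (b' # bs))"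

text \<open>The multilinear expansion over all edge lists with prescribed letters, weighted by the
  product of coefficients. The recursion lets the outermost edge be split off by unfolding, where a
  sum over a set of lists would need reindexing.\<close>

primrec osum :: "bool list \<Rightarrow> (edge list \<Rightarrow> nat lop) \<Rightarrow> nat lop" where
  "osum [] F = F []"
| "osum (b # bs) F = (\<Sum>e\<in>E. scop (w b e) * osum bs (\<lambda>xs. F ((b, e) # xs)))"

primrec wsum :: "bool list \<Rightarrow> (edge list \<Rightarrow> real) \<Rightarrow> real" where
  "wsum [] F = F []"
| "wsum (b # bs) F = (\<Sum>e\<in>E. cmod (w b e) * wsum bs (\<lambda>xs. F ((b, e) # xs)))"

lemma osum_cong:
  "(\<And>xs. length xs = length bs \<Longrightarrow> F xs = G xs) \<Longrightarrow> osum bs F = osum bs G"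
proof (induction bs arbitrary: F G)
  case (Cons b bs)
  have "osum bs (\<lambda>xs. F ((b, e) # xs)) = osum bs (\<lambda>xs. G ((b, e) # xs))" for e
    by (rule Cons.IH) (simp add: Cons.prems)
  then show ?case by simp
qed simp

lemma comm_osum: "comm A (osum bs F) = osum bs (\<lambda>xs. comm A (F xs))"
proof (induction bs arbitrary: F)
  case (Cons b bs)
  have "comm A (scop c * B) = scop c * comm A B" for c B
    using scop_central[of A c] by (simp add: right_diff_distrib) (metis mult.assoc)
  then show ?case unfolding osum.simps comm_sum_right by (simp add: Cons.IH)
qed simp

lemma nest_osum: "bs \<noteq> [] \<Longrightarrow> nest bs = osum bs mono_comm"
proof (induction bs rule: nest.induct)
  case (2 b)
  then show ?case by (simp add: gen_def)
next
  case (3 b b' bs)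
  have "nest (b # b' # bs) = (\<Sum>e\<in>E. comm (scop (w b e) * edge_op b e) (osum (b' # bs) mono_comm))"
    using 3 by (simp only: nest.simps gen_def comm_sum_left list.distinct not_False_eq_True simp_thms)
  also have "\<dots> = (\<Sum>e\<in>E. scop (w b e) * comm (edge_op b e) (osum (b' # bs) mono_comm))"
  proof (intro sum.cong refl)
    fix e
    have "comm (scop c * A) B = scop c * comm A B" for c and A B :: "nat lop"
      using scop_central[of B c] by (simp add: right_diff_distrib mult.assoc[symmetric])
    then show "comm (scop (w b e) * edge_op b e) (osum (b' # bs) mono_comm)
        = scop (w b e) * comm (edge_op b e) (osum (b' # bs) mono_comm)" .
  qed
  also have "\<dots> = (\<Sum>e\<in>E. scop (w b e) * osum (b' # bs) (\<lambda>xs. mono_comm ((b, e) # xs)))"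
  proof (intro sum.cong refl)
    fix e
    have "osum (b' # bs) (\<lambda>xs. comm (edge_op b e) (mono_comm xs)) = osum (b' # bs) (\<lambda>xs. mono_comm ((b, e) # xs))"
    proof (rule osum_cong)
      fix xs :: "edge list" assume "length xs = length (b' # bs)"
      then show "comm (edge_op b e) (mono_comm xs) = mono_comm ((b, e) # xs)" by (cases xs) auto
    qed
    then show "scop (w b e) * comm (edge_op b e) (osum (b' # bs) mono_comm)
        = scop (w b e) * osum (b' # bs) (\<lambda>xs. mono_comm ((b, e) # xs))"
      by (simp only: comm_osum)
  qed
  finally show ?case by simp
qed simp

lemma wsum_mono:
  "(\<And>xs. length xs = length bs \<Longrightarrow> snd ` set xs \<subseteq> E \<Longrightarrow> F xs \<le> G xs) \<Longrightarrow> wsum bs F \<le> wsum bs G"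
proof (induction bs arbitrary: F G)
  case (Cons b bs)
  have "wsum bs (\<lambda>xs. F ((b, e) # xs)) \<le> wsum bs (\<lambda>xs. G ((b, e) # xs))" if "e \<in> E" for e
  proof (rule Cons.IH)
    fix xs :: "edge list" assume "length xs = length bs" "snd ` set xs \<subseteq> E"
    then show "F ((b, e) # xs) \<le> G ((b, e) # xs)" using that by (intro Cons.prems) simp_all
  qed
  then show ?case unfolding wsum.simps by (intro sum_mono mult_left_mono) auto
qed simp

lemma wsum_add: "wsum bs (\<lambda>xs. F xs + G xs) = wsum bs F + wsum bs G"
  by (induction bs arbitrary: F G) (auto simp: distrib_left sum.distrib)

lemma wsum_cmult: "wsum bs (\<lambda>xs. c * F xs) = c * wsum bs F"
  by (induction bs arbitrary: F) (auto simp: sum_distrib_left mult_ac)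

lemma wsum_zero: "wsum bs (\<lambda>xs. 0) = 0"
  by (induction bs) auto

lemma wsum_sum: "wsum bs (\<lambda>xs. \<Sum>i\<in>I. F i xs) = (\<Sum>i\<in>I. wsum bs (F i))"
  by (induction I rule: infinite_finite_induct) (auto simp: wsum_zero wsum_add)

lemma col1_osum: "col1 m s (osum bs F) \<le> wsum bs (\<lambda>xs. col1 m s (F xs))"
proof (induction bs arbitrary: F)
  case (Cons b bs)
  have "col1 m s (osum (b # bs) F) \<le> (\<Sum>e\<in>E. col1 m s (scop (w b e) * osum bs (\<lambda>xs. F ((b, e) # xs))))"
    unfolding osum.simps by (rule col1_sum_le)
  also have "\<dots> \<le> wsum (b # bs) (\<lambda>xs. col1 m s (F xs))"
    unfolding wsum.simps col1_scale by (intro sum_mono mult_left_mono Cons.IH) auto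
  finally show ?case .
qed simp

text \<open>A site is met by edges from its row and from its column, each of weight at most
  \<open>D b\<close>; a union bound over A does the rest.\<close>

lemma edge_touch_site:
  assumes "finite A"
  shows "(\<Sum>e\<in>E. cmod (w b e) * touches e A) \<le> card A * (2 * D b)"
proof -
  have site: "(\<Sum>e\<in>E. cmod (w b e) * of_bool (y \<in> {fst e, snd e})) \<le> 2 * D b" for y
  proof -
    have "(\<Sum>e\<in>E. cmod (w b e) * of_bool (y \<in> {fst e, snd e}))
        \<le> (\<Sum>e\<in>E. cmod (w b e) * of_bool (fst e = y) + cmod (w b e) * of_bool (snd e = y))"
      by (intro sum_mono) auto
    also have "\<dots> = (\<Sum>j<n. \<Sum>k<n. cmod (w b (j, k)) * of_bool (j = y)) + (\<Sum>j<n. \<Sum>k<n. cmod (w b (j, k)) * of_bool (k = y))"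
      by (simp only: sum.distrib sum.cartesian_product split_def atLeast0LessThan prod.collapse)
    also have "(\<Sum>j<n. \<Sum>k<n. cmod (w b (j, k)) * of_bool (j = y)) = (\<Sum>j<n. of_bool (j = y) * (\<Sum>k<n. cmod (w b (j, k))))"
      by (simp add: sum_distrib_left mult.commute)
    also have "\<dots> = (\<Sum>j<n. if j = y then (\<Sum>k<n. cmod (w b (y, k))) else 0)"
      by (intro sum.cong) auto
    also have "\<dots> \<le> D b" using row[of y b] D_nonneg[of b] by simp
    also have "(\<Sum>j<n. \<Sum>k<n. cmod (w b (j, k)) * of_bool (k = y)) = (\<Sum>k<n. of_bool (k = y) * (\<Sum>j<n. cmod (w b (j, k))))"
      by (subst sum.swap) (simp add: sum_distrib_left mult.commute)
    also have "\<dots> = (\<Sum>k<n. if k = y then (\<Sum>j<n. cmod (w b (j, y))) else 0)"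
      by (intro sum.cong) auto
    also have "\<dots> \<le> D b" using col[of y b] D_nonneg[of b] by simp
    finally show ?thesis by simp
  qed
  have "(\<Sum>e\<in>E. cmod (w b e) * touches e A)
      \<le> (\<Sum>e\<in>E. \<Sum>y\<in>A. cmod (w b e) * of_bool (y \<in> {fst e, snd e}))"
  proof (intro sum_mono)
    fix e
    show "cmod (w b e) * touches e A \<le> (\<Sum>y\<in>A. cmod (w b e) * of_bool (y \<in> {fst e, snd e}))"
    proof (cases "{fst e, snd e} \<inter> A = {}")
      case False
      then obtain y where y: "y \<in> A" "y \<in> {fst e, snd e}" by auto
      have "cmod (w b e) * of_bool (y \<in> {fst e, snd e}) \<le> (\<Sum>y\<in>A. cmod (w b e) * of_bool (y \<in> {fst e, snd e}))"
        by (rule member_le_sum[OF y(1)]) (use assms in auto)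
      moreover have "of_bool (y \<in> {fst e, snd e}) = (1::real)" using y(2) by simp
      moreover have "touches e A = (1::real)" using False by simp
      ultimately show ?thesis by (simp only:)
    qed (auto intro: sum_nonneg)
  qed
  also have "\<dots> = (\<Sum>y\<in>A. \<Sum>e\<in>E. cmod (w b e) * of_bool (y \<in> {fst e, snd e}))" by (rule sum.swap)
  also have "\<dots> \<le> (\<Sum>y\<in>A. 2 * D b)" by (intro sum_mono site)
  finally show ?thesis by simp
qed

text \<open>Weighted number of linked edge lists through a given site: remove the outermost edge; either
  the site lies in the rest, or in the removed edge, one of whose ends lies in the rest.\<close>

lemma linked_weight:
  "bs \<noteq> [] \<Longrightarrow> wsum bs (through x)
    \<le> 4 ^ length bs * fact (length bs) * prod_list (map D bs)"
proof (induction bs arbitrary: x rule: nest.induct)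
  case (2 b)
  have "wsum [b] (through x) \<le> (\<Sum>e\<in>E. cmod (w b e) * touches e {x})"
    unfolding wsum.simps by (intro sum_mono mult_left_mono) (auto simp: sites_def edge_sites_def)
  also have "\<dots> \<le> 2 * D b" using edge_touch_site[of "{x}" b] by simp
  finally show ?case using D_nonneg[of b] by simp
next
  case (3 b b' bs)
  let ?bs = "b' # bs" and ?q = "real (length (b' # bs))"
  define N where "N = (4 ^ length ?bs * fact (length ?bs) * prod_list (map D ?bs) :: real)"
  have IH: "wsum ?bs (through y) \<le> N" for y
    using 3(1) unfolding N_def by simp
  have N0: "0 \<le> N" unfolding N_def by (intro mult_nonneg_nonneg prod_list_nonneg) (auto simp: D_nonneg)
  have "wsum (b # ?bs) (through x)
      \<le> (\<Sum>e\<in>E. cmod (w b e) * (wsum ?bs (\<lambda>xs. through x xs * touches e (sites xs))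
          + touches e {x} *
            (wsum ?bs (through (fst e)) + wsum ?bs (through (snd e)))))"
    unfolding wsum.simps(2)[of b]
  proof (intro sum_mono mult_left_mono)
    fix e
    show "wsum ?bs (\<lambda>xs. of_bool (linked ((b, e) # xs) \<and> x \<in> sites ((b, e) # xs)))
      \<le> wsum ?bs (\<lambda>xs. through x xs * touches e (sites xs))
          + touches e {x} *
            (wsum ?bs (through (fst e)) + wsum ?bs (through (snd e)))"
      unfolding wsum_add[symmetric] wsum_cmult[symmetric]
    proof (rule wsum_mono)
      fix xs :: "edge list" assume "length xs = length ?bs"
      then obtain y ys where xs: "xs = y # ys" by (cases xs) auto
      have "sites ((b, e) # xs) = {fst e, snd e} \<union> sites xs" by (auto simp: sites_def edge_sites_def)
      moreover have "linked ((b, e) # xs) \<longleftrightarrow> {fst e, snd e} \<inter> sites xs \<noteq> {} \<and> linked xs"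
        by (simp add: xs edge_sites_def)
      ultimately show "of_bool (linked ((b, e) # xs) \<and> x \<in> sites ((b, e) # xs))
        \<le> through x xs * touches e (sites xs) + touches e {x} *
          (through (fst e) xs + through (snd e) xs)"
        by auto
    qed
  qed auto
  also have "\<dots> \<le> (\<Sum>e\<in>E. cmod (w b e) * wsum ?bs (\<lambda>xs. through x xs * touches e (sites xs)))
      + (\<Sum>e\<in>E. cmod (w b e) * touches e {x} * (N + N))"
    unfolding sum.distrib[symmetric]
  proof (intro sum_mono)
    fix e
    have "cmod (w b e) * touches e {x} *
        (wsum ?bs (through (fst e)) + wsum ?bs (through (snd e)))
      \<le> cmod (w b e) * touches e {x} * (N + N)"
      by (intro mult_left_mono add_mono IH) auto
    then show "cmod (w b e) * (wsum ?bs (\<lambda>xs. through x xs * touches e (sites xs))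
          + touches e {x} *
            (wsum ?bs (through (fst e)) + wsum ?bs (through (snd e))))
      \<le> cmod (w b e) * wsum ?bs (\<lambda>xs. through x xs * touches e (sites xs))
        + cmod (w b e) * touches e {x} * (N + N)"
      by (simp only: distrib_left mult.assoc)
  qed
  also have "(\<Sum>e\<in>E. cmod (w b e) * wsum ?bs (\<lambda>xs. through x xs * touches e (sites xs)))
      = wsum ?bs (\<lambda>xs. through x xs * (\<Sum>e\<in>E. cmod (w b e) * touches e (sites xs)))"
    unfolding sum_distrib_left wsum_sum wsum_cmult[symmetric] by (simp only: mult.left_commute)
  \<comment> \<open>The order of summation has been exchanged: for a fixed inner list, which has at
    most 2 q sites, each site admits outer edges of weight at most 2 D b.\<close>
  also have "\<dots> \<le> wsum ?bs (\<lambda>xs. (4 * ?q * D b) * through x xs)"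
  proof (rule wsum_mono)
    fix xs :: "edge list" assume len: "length xs = length ?bs"
    have "(\<Sum>e\<in>E. cmod (w b e) * touches e (sites xs)) \<le> card (sites xs) * (2 * D b)"
      by (rule edge_touch_site[OF finite_sites])
    also have "\<dots> \<le> (2 * ?q) * (2 * D b)"
      using card_sites[of xs] len D_nonneg[of b] by (intro mult_right_mono) (auto simp flip: of_nat_mult)
    finally have le: "(\<Sum>e\<in>E. cmod (w b e) * touches e (sites xs)) \<le> (2 * ?q) * (2 * D b)" .
    show "through x xs * (\<Sum>e\<in>E. cmod (w b e) * touches e (sites xs))
        \<le> (4 * ?q * D b) * through x xs"
    proof (cases "linked xs \<and> x \<in> sites xs")
      case True
      then have eq: "through x xs = (1::real)" by simp
      have "(2 * ?q) * (2 * D b) = 4 * ?q * D b" by simp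
      with le show ?thesis unfolding eq by (simp only: mult_1_left mult_1_right)
    next
      case False
      then have eq: "through x xs = (0::real)" by simp
      show ?thesis unfolding eq by simp
    qed
  qed
  also have "\<dots> \<le> (4 * ?q * D b) * N"
    unfolding wsum_cmult using D_nonneg[of b] by (intro mult_left_mono IH) auto
  also have "(\<Sum>e\<in>E. cmod (w b e) * touches e {x} * (N + N)) \<le> (2 * D b) * (N + N)"
    unfolding sum_distrib_right[symmetric] using edge_touch_site[of "{x}" b] N0 by (intro mult_right_mono) auto
  \<comment> \<open>Inner lists through x give 4 q D N. Outer edges through x give 2 D times N + N,
    one N for each end that may be the link. The total factor 4 (q + 1) produces the power of 4 and
    the factorial.\<close>
  finally have "wsum (b # ?bs) (through x) \<le> 4 * (?q + 1) * D b * N"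
    by (simp add: algebra_simps)
  also have "4 * (?q + 1) * D b * N = 4 ^ length (b # ?bs) * fact (length (b # ?bs)) * prod_list (map D (b # ?bs))"
    by (simp add: N_def mult_ac)
  finally show ?case .
qed simp

text \<open>A nonzero contribution needs an occupied site, and the indicator of this is at most the
  sum over the occupied orbitals of s; hence a single factor of the electron number. The base 8 is 2
  from the commutators times 4 from counting linked lists.\<close>

lemma col1_nest:
  assumes "bs \<noteq> []" "s < 2 ^ n"
  shows "col1 (2 ^ n) s (nest bs)
    \<le> real (num_el n s) * (8 ^ length bs * fact (length bs) * prod_list (map D bs))"
proof -
  let ?q = "length bs"
  have "col1 (2 ^ n) s (nest bs) \<le> wsum bs (\<lambda>xs. col1 (2 ^ n) s (mono_comm xs))"
    unfolding nest_osum[OF assms(1)] by (rule col1_osum)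
  also have "\<dots> \<le> wsum bs (\<lambda>xs. \<Sum>x\<in>{x. x < n \<and> bit s x}. 2 ^ ?q * through x xs)"
  proof (rule wsum_mono)
    fix xs :: "edge list" assume xs: "length xs = length bs" "snd ` set xs \<subseteq> E"
    have "col1 (2 ^ n) s (mono_comm xs) \<le> 2 ^ ?q * of_bool (linked xs \<and> (\<exists>x\<in>sites xs. bit s x))"
      using col1_mono_comm[OF xs(2) assms(2)] xs(1) by simp
    also have "\<dots> \<le> (\<Sum>x\<in>{x. x < n \<and> bit s x}. 2 ^ ?q * through x xs)"
    proof (cases "linked xs \<and> (\<exists>x\<in>sites xs. bit s x)")
      case True
      then obtain x where x: "x \<in> sites xs" "bit s x" by auto
      have "x < n" using x(1) xs(2) by (force simp: sites_def edge_sites_def)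
      then have "(2::real) ^ ?q * through x xs
          \<le> (\<Sum>x\<in>{x. x < n \<and> bit s x}. 2 ^ ?q * through x xs)"
        using x(2) by (intro member_le_sum) auto
      then show ?thesis using True x by simp
    qed (auto intro: sum_nonneg)
    finally show "col1 (2 ^ n) s (mono_comm xs) \<le> (\<Sum>x\<in>{x. x < n \<and> bit s x}. 2 ^ ?q * through x xs)" .
  qed
  also have "\<dots> \<le> (\<Sum>x\<in>{x. x < n \<and> bit s x}. 2 ^ ?q * (4 ^ ?q * fact ?q * prod_list (map D bs)))"
    unfolding wsum_sum wsum_cmult by (intro sum_mono mult_left_mono linked_weight assms(1)) auto
  also have "\<dots> = card {x. x < n \<and> bit s x} * (8 ^ ?q * fact ?q * prod_list (map D bs))"
    by (simp flip: power_mult_distrib mult.assoc)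
  also have "card {x. x < n \<and> bit s x} = num_el n s"
    unfolding num_el_def occ_bit by (simp add: Int_def)
  finally show ?thesis .
qed

end

section \<open>Bounds on all nested commutators of the two generators\<close>

context hamiltonian
begin

lemma nested_bound_mono: "nested_bound q M Z \<Longrightarrow> M \<le> M' \<Longrightarrow> nested_bound q M' Z"
proof (induction q arbitrary: Z)
  case 0
  then show ?case unfolding nested_bound.simps form_bound_def by (meson order_trans)
next
  case (Suc q)
  then have "nested_bound q M (mcomm T Z)" "nested_bound q M (mcomm V Z)"
    by (simp_all only: nested_bound.simps)
  from this[THEN Suc.IH[OF _ Suc.prems(2)]] show ?case by (simp only: nested_bound.simps simp_thms)
qed

lemma nested_bound_zero: "0 \<le> M \<Longrightarrow> nested_bound q M (0\<^sub>m m m)"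
proof (induction q)
  case 0
  have "cip m \<phi> (0\<^sub>m m m *\<^sub>v \<psi>) = 0" if "sector_state m K \<psi>" for \<phi> \<psi>
    using sector_state_carrier[OF that] by (auto simp: cip_def)
  then show ?case using 0 by (simp add: form_bound_def)
next
  case (Suc q)
  moreover have "mcomm T (0\<^sub>m m m) = 0\<^sub>m m m" "mcomm V (0\<^sub>m m m) = 0\<^sub>m m m"
    using T_carrier V_carrier by (auto intro!: eq_matI)
  ultimately show ?case by (simp only: nested_bound.simps)
qed

end

text \<open>The first commutator vanishes or is that of T and V up to sign; the remaining q = p - 1
  each cost at most 4 (p + 1) (\<alpha> + \<eta> \<beta>), because a term never involves more than p
  + 1 particles.\<close>

lemma dense_nested_bound:
  fixes \<tau> \<nu> :: "complex mat"
  assumes ham: "hamiltonian (2 ^ n) (sector n \<eta>) (hop_op n \<tau>) (int_op n \<nu>)"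
    and \<tau>: "\<And>g. (\<Sum>j<n. (cmod (\<Sum>k<n. \<tau> $$ (j, k) * g k))\<^sup>2) \<le> \<alpha>\<^sup>2 * (\<Sum>k<n. (cmod (g k))\<^sup>2)"
    and \<alpha>: "0 \<le> \<alpha>" and \<beta>: "0 \<le> \<beta>" and \<nu>: "\<And>j k. j < n \<Longrightarrow> k < n \<Longrightarrow> cmod (\<nu> $$ (j, k)) \<le> \<beta>"
    and p: "p = Suc q"
    and M: "M = (4 * real (p + 1) * (\<alpha> + \<eta> * \<beta>)) ^ q * (4 * \<alpha> * \<beta> * \<eta>\<^sup>2)"
  shows "hamiltonian.nested_bound (2 ^ n) (sector n \<eta>) (hop_op n \<tau>) (int_op n \<nu>) p M (hop_op n \<tau>)"
    and "hamiltonian.nested_bound (2 ^ n) (sector n \<eta>) (hop_op n \<tau>) (int_op n \<nu>) p M (int_op n \<nu>)"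
proof -
  let ?T = "hop_op n \<tau>" and ?V = "int_op n \<nu>"
  interpret hamiltonian "2 ^ n" "sector n \<eta>" ?T ?V by (rule ham)
  interpret FB: few_body "opb (configs n \<eta>)" "slot n (\<lambda>j k. \<tau> $$ (j, k))" "pair_op (\<lambda>j k. \<nu> $$ (j, k))" \<alpha> \<beta> \<eta>
    by (rule few_body_configs) (use \<tau> \<alpha> \<beta> \<nu> in auto)
  define LT where "LT = gen n True (\<lambda>e. \<tau> $$ e)"
  define LV where "LV = gen n False (\<lambda>e. \<nu> $$ e)"
  have T: "rep (2 ^ n) ?T LT" "sector_op n \<eta> LT" "intertwines n \<eta> LT FB.T"
    unfolding LT_def FB.T_def using rep_hop sector_op_gen intertwines_hop by auto
  have V: "rep (2 ^ n) ?V LV" "sector_op n \<eta> LV" "intertwines n \<eta> LV FB.V"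
    unfolding LV_def FB.V_def using rep_int sector_op_gen intertwines_int by auto
  define \<gamma> where "\<gamma> = \<alpha> + \<eta> * \<beta>"
  have \<gamma>: "0 \<le> \<gamma>" using \<alpha> \<beta> by (simp add: \<gamma>_def)
  \<comment> \<open>The sum k + r does not change in the induction: a commutator uses up one level r
    and adds at most one particle to k. It therefore bounds the particle number at every
    stage.\<close>
  have step: "nested_bound r ((4 * real (k + r) * \<gamma>) ^ r * c) Z"
    if "rep (2 ^ n) Z L" "sector_op n \<eta> L" "intertwines n \<eta> L F" "FB.loc k c F" for r k c Z L F
    using that
  proof (induction r arbitrary: k c Z L F)
    case 0
    then show ?case
      using form_bound_intertwined[OF 0(1-3) FB.loc_bnd[OF 0(4)] FB.loc_nonneg[OF 0(4)]] by simp
  next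
    case (Suc r)
    have c: "0 \<le> c" by (rule FB.loc_nonneg[OF Suc.prems(4)])
    have le: "(4 * real (k + 1 + r) * \<gamma>) ^ r * (4 * real k * \<gamma> * c) \<le> (4 * real (k + Suc r) * \<gamma>) ^ Suc r * c"
    proof -
      have "4 * real k * \<gamma> * c \<le> 4 * real (k + Suc r) * \<gamma> * c"
        using c \<gamma> by (intro mult_right_mono) auto
      then have "(4 * real (k + 1 + r) * \<gamma>) ^ r * (4 * real k * \<gamma> * c)
          \<le> (4 * real (k + 1 + r) * \<gamma>) ^ r * (4 * real (k + Suc r) * \<gamma> * c)"
        using \<gamma> by (intro mult_left_mono) auto
      then show ?thesis by (simp add: mult_ac)
    qed
    have "nested_bound r ((4 * real (k + 1 + r) * \<gamma>) ^ r * (4 * real k * \<gamma> * c)) (mcomm ?T Z)"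
      using Suc.prems T FB.loc_comm(1)[OF Suc.prems(4)] unfolding \<gamma>_def[symmetric]
      by (intro Suc.IH[of _ "comm LT L" "comm FB.T F"] rep_comm sector_op_comm intertwines_comm) auto
    moreover have "nested_bound r ((4 * real (k + 1 + r) * \<gamma>) ^ r * (4 * real k * \<gamma> * c)) (mcomm ?V Z)"
      using Suc.prems V FB.loc_comm(2)[OF Suc.prems(4)] unfolding \<gamma>_def[symmetric]
      by (intro Suc.IH[of _ "comm LV L" "comm FB.V F"] rep_comm sector_op_comm intertwines_comm) auto
    ultimately show ?case using le by (auto intro: nested_bound_mono)
  qed
  have c0: "0 \<le> 4 * \<alpha> * \<beta> * \<eta>\<^sup>2" using \<alpha> \<beta> by simp
  have Meq: "(4 * real (2 + q) * \<gamma>) ^ q * (4 * \<alpha> * \<beta> * \<eta>\<^sup>2) = M"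
    unfolding M \<gamma>_def p by simp
  have TV: "FB.loc 2 (4 * \<alpha> * \<beta> * \<eta>\<^sup>2) (comm FB.T FB.V)" by (rule FB.loc_comm_TV)
  have VT: "FB.loc 2 (4 * \<alpha> * \<beta> * \<eta>\<^sup>2) (comm FB.V FB.T)"
    using FB.loc_minus[OF TV] by simp
  have zero: "FB.loc 2 (4 * \<alpha> * \<beta> * \<eta>\<^sup>2) (comm X X)" for X
    using FB.loc_zero[OF c0] by simp
  have "nested_bound q M (mcomm ?T ?T)" unfolding Meq[symmetric]
    by (rule step[OF rep_comm[OF T(1) T(1)] sector_op_comm[OF T(2) T(2)] intertwines_comm[OF T(3) T(3)] zero])
  moreover have "nested_bound q M (mcomm ?V ?T)" unfolding Meq[symmetric]
    by (rule step[OF rep_comm[OF V(1) T(1)] sector_op_comm[OF V(2) T(2)] intertwines_comm[OF V(3) T(3)] VT])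
  ultimately show "nested_bound p M ?T" unfolding p by simp
  have "nested_bound q M (mcomm ?V ?V)" unfolding Meq[symmetric]
    by (rule step[OF rep_comm[OF V(1) V(1)] sector_op_comm[OF V(2) V(2)] intertwines_comm[OF V(3) V(3)] zero])
  moreover have "nested_bound q M (mcomm ?T ?V)" unfolding Meq[symmetric]
    by (rule step[OF rep_comm[OF T(1) V(1)] sector_op_comm[OF T(2) V(2)] intertwines_comm[OF T(3) V(3)] TV])
  ultimately show "nested_bound p M ?V" unfolding p by simp
qed

text \<open>Commuting with a Hermitian matrix exchanges the two signs, so all nested commutators
  stay in this class. Either sign makes the absolute values of the entries symmetric.\<close>

definition skew_or_hermitian :: "nat \<Rightarrow> complex mat \<Rightarrow> bool" where
  "skew_or_hermitian m Z \<longleftrightarrow> (\<exists>\<sigma>\<in>{1, -1}. \<forall>i<m. \<forall>j<m. Z $$ (i, j) = \<sigma> * cnj (Z $$ (j, i)))"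

lemma skew_or_hermitian_comm:
  assumes "A \<in> carrier_mat m m" "adj A = A" "Z \<in> carrier_mat m m" "skew_or_hermitian m Z"
  shows "skew_or_hermitian m (mcomm A Z)"
proof -
  from assms(4) obtain \<sigma> where \<sigma>: "\<sigma> = 1 \<or> \<sigma> = -1"
    and Z: "\<And>i j. i < m \<Longrightarrow> j < m \<Longrightarrow> Z $$ (i, j) = \<sigma> * cnj (Z $$ (j, i))"
    unfolding skew_or_hermitian_def by blast
  have A: "A $$ (i, j) = cnj (A $$ (j, i))" if "i < m" "j < m" for i j
    using adj_index[OF assms(1) that] unfolding assms(2) .
  have idx: "mcomm A Z $$ (i, j) = (\<Sum>l<m. A $$ (i, l) * Z $$ (l, j)) - (\<Sum>l<m. Z $$ (i, l) * A $$ (l, j))"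
    if "i < m" "j < m" for i j
    using mult_index[OF assms(1,3) that] mult_index[OF assms(3,1) that] assms(1,3) that
    by (simp del: index_mult_mat(1))
  have AZ: "(\<Sum>l<m. A $$ (i, l) * Z $$ (l, j)) = \<sigma> * cnj (\<Sum>l<m. Z $$ (j, l) * A $$ (l, i))"
    if "i < m" "j < m" for i j
    unfolding cnj_sum sum_distrib_left
  proof (intro sum.cong refl)
    fix l assume "l \<in> {..<m}"
    then show "A $$ (i, l) * Z $$ (l, j) = \<sigma> * cnj (Z $$ (j, l) * A $$ (l, i))"
      using A[of i l] Z[of l j] that by simp
  qed
  have ZA: "(\<Sum>l<m. Z $$ (i, l) * A $$ (l, j)) = \<sigma> * cnj (\<Sum>l<m. A $$ (j, l) * Z $$ (l, i))"
    if "i < m" "j < m" for i j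
    unfolding cnj_sum sum_distrib_left
  proof (intro sum.cong refl)
    fix l assume "l \<in> {..<m}"
    then show "Z $$ (i, l) * A $$ (l, j) = \<sigma> * cnj (A $$ (j, l) * Z $$ (l, i))"
      using A[of l j] Z[of i l] that by simp
  qed
  have "mcomm A Z $$ (i, j) = (- \<sigma>) * cnj (mcomm A Z $$ (j, i))" if "i < m" "j < m" for i j
    unfolding idx[OF that] idx[OF that(2,1)] AZ[OF that] ZA[OF that] by (simp add: algebra_simps)
  moreover have "- \<sigma> \<in> {1, -1}" using \<sigma> by auto
  ultimately show ?thesis unfolding skew_or_hermitian_def by blast
qed

text \<open>Schur's test: the absolute values of the entries form a symmetric matrix, so column sums also
  bound row sums.\<close>

lemma form_bound_columns:
  assumes M: "M \<in> carrier_mat m m" "skew_or_hermitian m M"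
    and col: "\<And>s. s < m \<Longrightarrow> s \<in> K \<Longrightarrow> (\<Sum>r<m. cmod (M $$ (r, s))) \<le> c" and c: "0 \<le> c"
  shows "form_bound m K c M"
  unfolding form_bound_def
proof (intro allI impI)
  fix \<phi> \<psi> assume \<phi>: "sector_state m K \<phi>" and \<psi>: "sector_state m K \<psi>"
  have sym: "cmod (M $$ (r, s)) = cmod (M $$ (s, r))" if "r < m" "s < m" for r s
  proof -
    obtain \<sigma> where "\<sigma> = 1 \<or> \<sigma> = -1" "M $$ (r, s) = \<sigma> * cnj (M $$ (s, r))"
      using M(2) \<open>r < m\<close> \<open>s < m\<close> unfolding skew_or_hermitian_def by blast
    then show ?thesis by (auto simp: norm_mult)
  qed
  have weighted: "(\<Sum>s<m. (\<Sum>r<m. cmod (M $$ (r, s))) * (cmod (\<chi> $ s))\<^sup>2) \<le> c"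
    if \<chi>: "sector_state m K \<chi>" for \<chi> :: "complex Matrix.vec"
  proof -
    have "(\<Sum>s<m. (\<Sum>r<m. cmod (M $$ (r, s))) * (cmod (\<chi> $ s))\<^sup>2) \<le> (\<Sum>s<m. c * (cmod (\<chi> $ s))\<^sup>2)"
    proof (intro sum_mono)
      fix s assume s: "s \<in> {..<m}"
      show "(\<Sum>r<m. cmod (M $$ (r, s))) * (cmod (\<chi> $ s))\<^sup>2 \<le> c * (cmod (\<chi> $ s))\<^sup>2"
      proof (cases "s \<in> K")
        case True
        then show ?thesis using col[of s] s by (intro mult_right_mono) auto
      next
        case False
        then have "\<chi> $ s = 0" using \<chi> s by (simp add: sector_state_def)
        then show ?thesis by simp
      qed
    qed
    also have "\<dots> = c" using \<chi> by (simp add: sector_state_def flip: sum_distrib_left)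
    finally show ?thesis .
  qed
  have "cmod (cip m \<phi> (M *\<^sub>v \<psi>)) \<le> (\<Sum>r<m. \<Sum>s<m. cmod (\<phi> $ r) * cmod (M $$ (r, s)) * cmod (\<psi> $ s))"
    unfolding cip_def
  proof (rule sum_norm_le)
    fix r assume "r \<in> {..<m}"
    then have "cnj (\<phi> $ r) * (M *\<^sub>v \<psi>) $ r = (\<Sum>s<m. cnj (\<phi> $ r) * (M $$ (r, s) * \<psi> $ s))"
      using mult_vec_index[OF M(1) sector_state_carrier[OF \<psi>]] by (simp add: sum_distrib_left del: index_mult_mat_vec)
    then show "cmod (cnj (\<phi> $ r) * (M *\<^sub>v \<psi>) $ r) \<le> (\<Sum>s<m. cmod (\<phi> $ r) * cmod (M $$ (r, s)) * cmod (\<psi> $ s))"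
      using norm_sum[of "\<lambda>s. cnj (\<phi> $ r) * (M $$ (r, s) * \<psi> $ s)" "{..<m}"] by (simp add: norm_mult mult.assoc)
  qed
  \<comment> \<open>The inequality 2 x y \<le> x^2 + y^2 separates the two states: each half is an
    average of column sums weighted by one state, which lives on K, where column sums are
    controlled.\<close>
  also have "\<dots> \<le> (\<Sum>r<m. \<Sum>s<m. (cmod (M $$ (r, s)) * (cmod (\<phi> $ r))\<^sup>2 + cmod (M $$ (r, s)) * (cmod (\<psi> $ s))\<^sup>2) / 2)"
  proof (intro sum_mono)
    fix r s
    have "2 * (cmod (\<phi> $ r) * cmod (\<psi> $ s)) \<le> (cmod (\<phi> $ r))\<^sup>2 + (cmod (\<psi> $ s))\<^sup>2"
      using sum_squares_bound[of "cmod (\<phi> $ r)" "cmod (\<psi> $ s)"] by (simp add: mult.assoc)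
    then have "cmod (M $$ (r, s)) * (2 * (cmod (\<phi> $ r) * cmod (\<psi> $ s)))
        \<le> cmod (M $$ (r, s)) * ((cmod (\<phi> $ r))\<^sup>2 + (cmod (\<psi> $ s))\<^sup>2)" by (intro mult_left_mono) auto
    then show "cmod (\<phi> $ r) * cmod (M $$ (r, s)) * cmod (\<psi> $ s)
        \<le> (cmod (M $$ (r, s)) * (cmod (\<phi> $ r))\<^sup>2 + cmod (M $$ (r, s)) * (cmod (\<psi> $ s))\<^sup>2) / 2"
      by (simp add: algebra_simps)
  qed
  also have "\<dots> = ((\<Sum>r<m. \<Sum>s<m. cmod (M $$ (r, s)) * (cmod (\<phi> $ r))\<^sup>2)
      + (\<Sum>r<m. \<Sum>s<m. cmod (M $$ (r, s)) * (cmod (\<psi> $ s))\<^sup>2)) / 2"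
    by (simp add: sum.distrib add_divide_distrib flip: sum_divide_distrib)
  also have "(\<Sum>r<m. \<Sum>s<m. cmod (M $$ (r, s)) * (cmod (\<psi> $ s))\<^sup>2) = (\<Sum>s<m. (\<Sum>r<m. cmod (M $$ (r, s))) * (cmod (\<psi> $ s))\<^sup>2)"
    unfolding sum_distrib_right by (rule sum.swap)
  also have "(\<Sum>r<m. \<Sum>s<m. cmod (M $$ (r, s)) * (cmod (\<phi> $ r))\<^sup>2) = (\<Sum>r<m. (\<Sum>s<m. cmod (M $$ (s, r))) * (cmod (\<phi> $ r))\<^sup>2)"
    unfolding sum_distrib_right using sym by (intro sum.cong refl) auto
  finally show "cmod (cip m \<phi> (M *\<^sub>v \<psi>)) \<le> c" using weighted[OF \<phi>] weighted[OF \<psi>] by simp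
qed

section \<open>The error bounds\<close>

text \<open>For a word whose two innermost letters differ, those contribute
  \<open>D True * D False\<close>, and each of the other q letters contributes at most
  \<open>D True + D False\<close>. Words with equal innermost letters give 0.\<close>

lemma sparse_nested_bound:
  fixes \<tau> \<nu> :: "complex mat"
  assumes ham: "hamiltonian (2 ^ n) (sector n \<eta>) (hop_op n \<tau>) (int_op n \<nu>)"
    and gens: "sparse_gens n (\<lambda>b e. (if b then \<tau> else \<nu>) $$ e) D"
    and p: "p = Suc q"
    and M: "M = \<eta> * (8 ^ (p + 1) * fact (p + 1) * ((D True + D False) ^ q * (D True * D False)))"
  shows "hamiltonian.nested_bound (2 ^ n) (sector n \<eta>) (hop_op n \<tau>) (int_op n \<nu>) p M (hop_op n \<tau>)"
    and "hamiltonian.nested_bound (2 ^ n) (sector n \<eta>) (hop_op n \<tau>) (int_op n \<nu>) p M (int_op n \<nu>)"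
proof -
  let ?T = "hop_op n \<tau>" and ?V = "int_op n \<nu>"
  interpret hamiltonian "2 ^ n" "sector n \<eta>" ?T ?V by (rule ham)
  interpret SG: sparse_gens n "\<lambda>b e. (if b then \<tau> else \<nu>) $$ e" D by (rule gens)
  have D0: "0 \<le> D b" for b by (rule SG.D_nonneg)
  have M0: "0 \<le> M" unfolding M by (intro mult_nonneg_nonneg) (auto simp: D0)
  have part_rep: "rep (2 ^ n) (part b) (gen n b (\<lambda>e. (if b then \<tau> else \<nu>) $$ e))" for b
    by (cases b) (simp_all add: part_def rep_hop rep_int)
  have part_adj: "adj (part b) = part b" for b by (simp add: part_def T_adj V_adj)
  have form: "form_bound (2 ^ n) (sector n \<eta>) M Z"
    if Z: "rep (2 ^ n) Z (SG.nest bs)" "skew_or_hermitian (2 ^ n) Z" and bs: "length bs = p + 1"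
      and prod: "prod_list (map D bs) \<le> (D True + D False) ^ q * (D True * D False)" for Z bs
  proof (rule form_bound_columns[OF rep_carrier[OF Z(1)] Z(2) _ M0])
    fix s assume s: "s < 2 ^ n" "s \<in> sector n \<eta>"
    have "supported (2 ^ n) (basis_fun s)" using s by (auto simp: supported_def basis_fun_def)
    from rep_apply[OF Z(1) this] have "ap (SG.nest bs) (basis_fun s) r = Z $$ (r, s)" if "r < 2 ^ n" for r
      using that s(1) by (simp add: basis_fun_def if_distrib[of "\<lambda>x. _ * x"] cong: if_cong)
    then have "(\<Sum>r<2 ^ n. cmod (Z $$ (r, s))) = col1 (2 ^ n) s (SG.nest bs)"
      by (simp add: col1_def n1_def)
    also have "\<dots> \<le> \<eta> * (8 ^ (p + 1) * fact (p + 1) * prod_list (map D bs))"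
    proof -
      have "bs \<noteq> []" using bs by auto
      then show ?thesis using SG.col1_nest[of bs s] s bs by simp
    qed
    also have "\<dots> \<le> M" unfolding M using prod by (intro mult_left_mono) auto
    finally show "(\<Sum>r<2 ^ n. cmod (Z $$ (r, s))) \<le> M" .
  qed
  \<comment> \<open>Here r is the number of commutators still to come, and the last premise keeps a
    factor \<open>D True + D False\<close> in reserve for each. The condition r < p ensures that
    \<open>bs\<close> has at least two letters.\<close>
  have step: "nested_bound r M Z"
    if "rep (2 ^ n) Z (SG.nest bs)" "skew_or_hermitian (2 ^ n) Z" "length bs = p + 1 - r" "r < p"
      "prod_list (map D bs) * (D True + D False) ^ r \<le> (D True + D False) ^ q * (D True * D False)"
    for r bs Z
    using that
  proof (induction r arbitrary: bs Z)
    case 0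
    then show ?case using form[of Z bs] by simp
  next
    case (Suc r)
    obtain b' bs' where bs: "bs = b' # bs'" using Suc.prems(3,4) by (cases bs) auto
    have P0: "0 \<le> prod_list (map D bs)" by (rule prod_list_nonneg) (auto simp: D0)
    have "nested_bound r M (mcomm (part b) Z)" for b
    proof (rule Suc.IH[of _ "b # bs"])
      show "rep (2 ^ n) (mcomm (part b) Z) (SG.nest (b # bs))"
        unfolding bs SG.nest.simps by (rule rep_comm[OF part_rep]) (use Suc.prems(1) bs in simp)
      show "skew_or_hermitian (2 ^ n) (mcomm (part b) Z)"
        by (rule skew_or_hermitian_comm[OF part_carrier part_adj rep_carrier[OF Suc.prems(1)] Suc.prems(2)])
      show "length (b # bs) = p + 1 - r" "r < p" using Suc.prems by auto
      have "prod_list (map D (b # bs)) * (D True + D False) ^ r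
          \<le> (D True + D False) * prod_list (map D bs) * (D True + D False) ^ r"
        using P0 D0 by (cases b) (auto intro!: mult_right_mono)
      also have "\<dots> \<le> (D True + D False) ^ q * (D True * D False)"
        using Suc.prems(5) by (simp add: mult_ac)
      finally show "prod_list (map D (b # bs)) * (D True + D False) ^ r \<le> (D True + D False) ^ q * (D True * D False)" .
    qed
    from this[of True] this[of False] show ?case by (simp add: part_def)
  qed
  have herm: "skew_or_hermitian (2 ^ n) (part b)" for b
  proof -
    have "part b $$ (i, j) = 1 * cnj (part b $$ (j, i))" if "i < 2 ^ n" "j < 2 ^ n" for i j
      using adj_index[OF part_carrier that, of b] unfolding part_adj mult_1 .
    then show ?thesis unfolding skew_or_hermitian_def by blast
  qed
  have mixed: "nested_bound q M (mcomm (part b) (part b'))" if "b \<noteq> b'" for b b'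
  proof (rule step[of _ "[b, b']"])
    show "rep (2 ^ n) (mcomm (part b) (part b')) (SG.nest [b, b'])"
      unfolding SG.nest.simps by (rule rep_comm[OF part_rep part_rep])
    show "skew_or_hermitian (2 ^ n) (mcomm (part b) (part b'))"
      by (rule skew_or_hermitian_comm[OF part_carrier part_adj part_carrier herm])
    have "D b * D b' = D True * D False" using that by (cases b; cases b') auto
    then show "prod_list (map D [b, b']) * (D True + D False) ^ q \<le> (D True + D False) ^ q * (D True * D False)"
      by simp
  qed (use p in auto)
  have equal: "nested_bound q M (mcomm (part b) (part b))" for b
  proof -
    have "A - A = 0\<^sub>m (2 ^ n) (2 ^ n)" if "A \<in> carrier_mat (2 ^ n) (2 ^ n)" for A :: "complex mat"
      using that by (intro eq_matI) auto
    from this[OF mult_square_carrier[OF part_carrier[of b] part_carrier[of b]]]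
    have "mcomm (part b) (part b) = 0\<^sub>m (2 ^ n) (2 ^ n)" .
    then show ?thesis using nested_bound_zero[OF M0] by (simp only:)
  qed
  show "nested_bound p M ?T" using equal[of True] mixed[of False True] by (simp add: p part_def)
  show "nested_bound p M ?V" using equal[of False] mixed[of True False] by (simp add: p part_def)
qed

section \<open>The seminorm, the spectral norm and the maximum norm\<close>

lemma eta_state_sector: "eta_state n \<eta> \<psi> \<longleftrightarrow> sector_state (2 ^ n) (sector n \<eta>) \<psi>"
  by (simp add: eta_state_def sector_state_def)

text \<open>Makes the set in the seminorm nonempty, so that its supremum is bounded by any upper
  bound. The witness fills the first \<eta> orbitals, which is possible as \<eta> \<le> n.\<close>

lemma ex_eta_state: assumes "\<eta> \<le> n" shows "\<exists>\<psi>. eta_state n \<eta> \<psi>"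
proof -
  define s :: nat where "s = mask \<eta>"
  have "s < 2 ^ \<eta>" by (simp add: s_def mask_eq_exp_minus_1)
  also have "(2::nat) ^ \<eta> \<le> 2 ^ n" using assms by (intro power_increasing) auto
  finally have s: "s < 2 ^ n" .
  have "occ s j = of_bool (j < \<eta>)" for j
    by (simp add: occ_bit s_def bit_mask_iff)
  then have "num_el n s = card ({..<n} \<inter> {j. j < \<eta>})"
    by (simp add: num_el_def)
  also have "{..<n} \<inter> {j. j < \<eta>} = {..<\<eta>}" using assms by auto
  finally have num: "num_el n s = \<eta>" by simp
  have "eta_state n \<eta> (Matrix.vec (2 ^ n) (\<lambda>r. if r = s then 1 else 0))"
    using s num by (auto simp: eta_state_def if_distrib[of "\<lambda>z. (cmod z)\<^sup>2"] cong: if_cong)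
  then show ?thesis by blast
qed

lemma eta_seminorm_le:
  assumes "form_bound (2 ^ n) (sector n \<eta>) c X" "\<eta> \<le> n"
  shows "eta_seminorm n \<eta> X \<le> c"
  unfolding eta_seminorm_def
proof (rule cSup_least)
  show "{cmod (\<Sum>s<2 ^ n. cnj (\<phi> $ s) * (X *\<^sub>v \<psi>) $ s) | \<phi> \<psi>. eta_state n \<eta> \<phi> \<and> eta_state n \<eta> \<psi>} \<noteq> {}"
    using ex_eta_state[OF assms(2)] by blast
  fix x assume "x \<in> {cmod (\<Sum>s<2 ^ n. cnj (\<phi> $ s) * (X *\<^sub>v \<psi>) $ s) | \<phi> \<psi>. eta_state n \<eta> \<phi> \<and> eta_state n \<eta> \<psi>}"
  then show "x \<le> c" using assms(1) by (auto simp: form_bound_def eta_state_sector cip_def)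
qed

lemma vnorm_sq: "(vnorm x)\<^sup>2 = (\<Sum>i<dim_vec x. (cmod (x $ i))\<^sup>2)"
  by (simp add: vnorm_def sum_nonneg)

lemma vnorm_nonneg: "0 \<le> vnorm x"
  by (simp add: vnorm_def sum_nonneg)

lemma spec_norm_bdd:
  assumes A: "A \<in> carrier_mat n n"
  shows "bdd_above {vnorm (A *\<^sub>v x) | x. x \<in> carrier_vec (dim_col A) \<and> vnorm x = 1}"
proof (rule bdd_aboveI)
  fix y assume "y \<in> {vnorm (A *\<^sub>v x) | x. x \<in> carrier_vec (dim_col A) \<and> vnorm x = 1}"
  then obtain x where x: "y = vnorm (A *\<^sub>v x)" "x \<in> carrier_vec n" "vnorm x = 1" using A by auto
  have e: "cmod (x $ j) \<le> 1" if "j < n" for j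
  proof -
    have "(cmod (x $ j))\<^sup>2 \<le> (vnorm x)\<^sup>2"
      unfolding vnorm_sq by (rule member_le_sum) (use that x in auto)
    then show ?thesis by (simp add: x(3) abs_square_le_1)
  qed
  have "y\<^sup>2 = (\<Sum>i<n. (cmod (\<Sum>j<n. A $$ (i, j) * x $ j))\<^sup>2)"
    unfolding x(1) vnorm_sq using A x(2)
    by (intro sum.cong) (auto simp: mult_vec_index simp del: index_mult_mat_vec)
  also have "\<dots> \<le> (\<Sum>i<n. (\<Sum>j<n. cmod (A $$ (i, j)))\<^sup>2)"
    using e by (intro sum_mono power_mono sum_norm_le) (auto simp: norm_mult intro: mult_left_le)
  finally show "y \<le> sqrt (\<Sum>i<n. (\<Sum>j<n. cmod (A $$ (i, j)))\<^sup>2)"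
    by (rule real_le_rsqrt)
qed

lemma spec_norm_bound:
  assumes A: "A \<in> carrier_mat n n" and x: "x \<in> carrier_vec n"
  shows "vnorm (A *\<^sub>v x) \<le> spec_norm A * vnorm x"
proof (cases "vnorm x = 0")
  case True
  have "(cmod (x $ j))\<^sup>2 \<le> (vnorm x)\<^sup>2" if "j < n" for j
    unfolding vnorm_sq by (rule member_le_sum) (use that x in auto)
  then have z: "x $ j = 0" if "j < n" for j using that True by simp
  have "(A *\<^sub>v x) $ i = 0" if "i < n" for i
    unfolding mult_vec_index[OF A x that] using z by (intro sum.neutral) auto
  then have "vnorm (A *\<^sub>v x) = 0" using A by (simp add: vnorm_def del: index_mult_mat_vec)
  then show ?thesis using True by simp
next
  case False
  then have pos: "0 < vnorm x" using vnorm_nonneg[of x] by simp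
  define y where "y = complex_of_real (1 / vnorm x) \<cdot>\<^sub>v x"
  have y: "y \<in> carrier_vec n" using x by (simp add: y_def)
  have scale: "vnorm (complex_of_real a \<cdot>\<^sub>v z) = a * vnorm z" if "0 \<le> a" for a z
  proof (rule power2_eq_imp_eq)
    show "(vnorm (complex_of_real a \<cdot>\<^sub>v z))\<^sup>2 = (a * vnorm z)\<^sup>2"
      by (simp add: vnorm_sq power_mult_distrib norm_mult sum_distrib_left)
  qed (use that in \<open>simp_all add: vnorm_nonneg\<close>)
  have "vnorm y = 1" unfolding y_def using scale[of "1 / vnorm x" x] pos by simp
  then have "vnorm (A *\<^sub>v y) \<le> spec_norm A"
    unfolding spec_norm_def using A y by (intro cSup_upper spec_norm_bdd[OF A]) auto
  moreover have "A *\<^sub>v y = complex_of_real (1 / vnorm x) \<cdot>\<^sub>v (A *\<^sub>v x)"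
    unfolding y_def using A x by (rule mult_mat_vec)
  ultimately have "(1 / vnorm x) * vnorm (A *\<^sub>v x) \<le> spec_norm A"
    using scale[of "1 / vnorm x" "A *\<^sub>v x"] pos by simp
  then show ?thesis using pos by (simp add: field_simps)
qed

text \<open>A unit vector is needed: for n = 0 the supremum would range over the empty set and have
  no useful value.\<close>

lemma spec_norm_nonneg:
  assumes A: "A \<in> carrier_mat n n" and n: "1 \<le> n"
  shows "0 \<le> spec_norm A"
proof -
  have "vnorm (unit_vec n 0 :: complex Matrix.vec) = 1"
    using n by (simp add: vnorm_def unit_vec_def if_distrib[of "\<lambda>z. (cmod z)\<^sup>2"] cong: if_cong)
  then have "vnorm (A *\<^sub>v unit_vec n 0) \<le> spec_norm A"
    using spec_norm_bound[OF A, of "unit_vec n 0"] by simp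
  then show ?thesis using vnorm_nonneg[of "A *\<^sub>v unit_vec n 0"] by linarith
qed

lemma spec_norm_sum:
  assumes A: "A \<in> carrier_mat n n" and n: "1 \<le> n"
  shows "(\<Sum>j<n. (cmod (\<Sum>k<n. A $$ (j, k) * g k))\<^sup>2) \<le> (spec_norm A)\<^sup>2 * (\<Sum>k<n. (cmod (g k))\<^sup>2)"
proof -
  let ?x = "Matrix.vec n g"
  have "(\<Sum>j<n. (cmod (\<Sum>k<n. A $$ (j, k) * g k))\<^sup>2) = (vnorm (A *\<^sub>v ?x))\<^sup>2"
    unfolding vnorm_sq using A
    by (intro sum.cong) (auto simp: mult_vec_index[of _ n] simp del: index_mult_mat_vec)
  also have "\<dots> \<le> (spec_norm A * vnorm ?x)\<^sup>2"
    by (intro power_mono spec_norm_bound[OF A] vnorm_nonneg) simp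
  also have "\<dots> = (spec_norm A)\<^sup>2 * (\<Sum>k<n. (cmod (g k))\<^sup>2)"
    by (simp add: power_mult_distrib vnorm_sq)
  finally show ?thesis .
qed

lemma finite_entries: "finite {cmod (A $$ (j, k)) | j k. j < dim_row A \<and> k < dim_col A}"
proof -
  have "{cmod (A $$ (j, k)) | j k. j < dim_row A \<and> k < dim_col A}
      = (\<lambda>(j, k). cmod (A $$ (j, k))) ` ({..<dim_row A} \<times> {..<dim_col A})" by auto
  then show ?thesis by simp
qed

lemma max_norm_nonneg: "0 \<le> max_norm A"
  unfolding max_norm_def by (rule Max_ge) (use finite_entries[of A] in auto)

lemma max_norm_entry: "A \<in> carrier_mat n n \<Longrightarrow> j < n \<Longrightarrow> k < n \<Longrightarrow> cmod (A $$ (j, k)) \<le> max_norm A"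
  unfolding max_norm_def by (rule Max_ge) (use finite_entries[of A] in auto)

lemma sum_le_card_nonzero:
  fixes f :: "nat \<Rightarrow> complex"
  assumes "card {k. k < n \<and> f k \<noteq> 0} \<le> d" "\<And>k. k < n \<Longrightarrow> cmod (f k) \<le> \<mu>" "0 \<le> \<mu>"
  shows "(\<Sum>k<n. cmod (f k)) \<le> d * \<mu>"
proof -
  have "(\<Sum>k<n. cmod (f k)) = (\<Sum>k\<in>{k. k < n \<and> f k \<noteq> 0}. cmod (f k))"
    by (intro sum.mono_neutral_right) auto
  also have "\<dots> \<le> card {k. k < n \<and> f k \<noteq> 0} * \<mu>"
    using assms(2) by (intro sum_bounded_above) auto
  also have "\<dots> \<le> d * \<mu>" using assms by (intro mult_right_mono) auto
  finally show ?thesis .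
qed

lemma sparse_gens_sparse_mat:
  assumes "\<tau> \<in> carrier_mat n n" "\<nu> \<in> carrier_mat n n" "sparse_mat d \<tau>" "sparse_mat d \<nu>"
  shows "sparse_gens n (\<lambda>b e. (if b then \<tau> else \<nu>) $$ e) (\<lambda>b. d * max_norm (if b then \<tau> else \<nu>))"
proof
  fix b
  let ?A = "if b then \<tau> else \<nu>"
  have A: "?A \<in> carrier_mat n n" "sparse_mat d ?A" using assms by auto
  show "0 \<le> d * max_norm ?A" by (simp add: max_norm_nonneg)
  fix j assume j: "j < n"
  show "(\<Sum>k<n. cmod (?A $$ (j, k))) \<le> d * max_norm ?A"
    by (rule sum_le_card_nonzero) (use A j in \<open>auto simp: sparse_mat_def max_norm_nonneg intro!: max_norm_entry\<close>)
  show "(\<Sum>k<n. cmod (?A $$ (k, j))) \<le> d * max_norm ?A"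
    by (rule sum_le_card_nonzero) (use A j in \<open>auto simp: sparse_mat_def max_norm_nonneg intro!: max_norm_entry\<close>)
qed

definition factors :: "(real \<times> real) list \<Rightarrow> (real \<times> bool) list" where
  "factors cs = concat (map (\<lambda>(a, b). [(a, True), (b, False)]) cs)"

lemma (in hamiltonian) prod_formula_S: "prod_formula m cs t T V = S (factors cs) (of_real t)"
proof (induction cs)
  case Nil
  then show ?case by (simp add: factors_def)
next
  case (Cons ab cs)
  obtain a b where ab: "ab = (a, b)" by (cases ab)
  let ?A = "prop_op a True (of_real t)" and ?B = "prop_op b False (of_real t)"
  have "S (factors (ab # cs)) (of_real t) = ?A * (?B * S (factors cs) (of_real t))"
    by (simp add: ab factors_def)
  also have "\<dots> = ?A * ?B * S (factors cs) (of_real t)" by (simp add: sq_simps)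
  also have "\<dots> = prod_formula m (ab # cs) t T V"
    by (simp add: ab Cons.IH expo_def part_def mult_ac)
  finally show ?case by simp
qed

theorem theorem1:
  fixes p :: nat and cs :: "(real \<times> real) list"
  assumes "p \<ge> 1" and "is_product_formula p cs"
  shows "\<exists>C1 > 0. \<exists>C2 > 0.
    \<forall>n \<ge> 1. \<forall>\<eta> \<le> n. \<forall>\<tau> \<nu> (t::real).
      \<tau> \<in> carrier_mat n n \<longrightarrow> \<nu> \<in> carrier_mat n n \<longrightarrow>
      adj (hop_op n \<tau>) = hop_op n \<tau> \<longrightarrow> adj (int_op n \<nu>) = int_op n \<nu> \<longrightarrow> t \<ge> 0 \<longrightarrow>
      eta_seminorm n \<eta> (prod_formula (2 ^ n) cs t (hop_op n \<tau>) (int_op n \<nu>)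
          - mexp ((- \<i> * of_real t) \<cdot>\<^sub>m (hop_op n \<tau> + int_op n \<nu>)))
        \<le> C1 * (spec_norm \<tau> + max_norm \<nu> * real \<eta>) ^ (p - 1) * spec_norm \<tau> * max_norm \<nu>
             * real \<eta> ^ 2 * t ^ (p + 1)
      \<and> (\<forall>d::nat. sparse_mat d \<tau> \<longrightarrow> sparse_mat d \<nu> \<longrightarrow>
          eta_seminorm n \<eta> (prod_formula (2 ^ n) cs t (hop_op n \<tau>) (int_op n \<nu>)
              - mexp ((- \<i> * of_real t) \<cdot>\<^sub>m (hop_op n \<tau> + int_op n \<nu>)))
            \<le> C2 * (max_norm \<tau> + max_norm \<nu>) ^ (p - 1) * max_norm \<tau> * max_norm \<nu>
                 * real d ^ (p + 1) * real \<eta> * t ^ (p + 1))"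
proof -
  obtain q where p: "p = Suc q" using assms(1) by (cases p) auto
  define \<kappa> where "\<kappa> = formula_const p (factors cs)"
  have \<kappa>: "0 \<le> \<kappa>" by (simp add: \<kappa>_def formula_const_nonneg)
  \<comment> \<open>Both constants are fixed before n, \<eta>, t and the matrices, being built from
    p and the formula alone. The summand 1 secures positivity without showing that \<kappa> is
    positive.\<close>
  define C1 where "C1 = \<kappa> * ((4 * real (p + 1)) ^ q * 4) + 1"
  define C2 where "C2 = \<kappa> * (8 ^ (p + 1) * fact (p + 1)) + 1"
  have C: "0 < C1" "0 < C2" unfolding C1_def C2_def using \<kappa> by (auto intro!: add_nonneg_pos)
  have main: "eta_seminorm n \<eta> (prod_formula (2 ^ n) cs t (hop_op n \<tau>) (int_op n \<nu>)
          - mexp ((- \<i> * of_real t) \<cdot>\<^sub>m (hop_op n \<tau> + int_op n \<nu>)))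
        \<le> C1 * (spec_norm \<tau> + max_norm \<nu> * real \<eta>) ^ (p - 1) * spec_norm \<tau> * max_norm \<nu>
             * real \<eta> ^ 2 * t ^ (p + 1)" (is "?norm \<le> ?R1")
    and sparse: "sparse_mat d \<tau> \<Longrightarrow> sparse_mat d \<nu> \<Longrightarrow>
      eta_seminorm n \<eta> (prod_formula (2 ^ n) cs t (hop_op n \<tau>) (int_op n \<nu>)
          - mexp ((- \<i> * of_real t) \<cdot>\<^sub>m (hop_op n \<tau> + int_op n \<nu>)))
        \<le> C2 * (max_norm \<tau> + max_norm \<nu>) ^ (p - 1) * max_norm \<tau> * max_norm \<nu>
             * real d ^ (p + 1) * real \<eta> * t ^ (p + 1)" (is "_ \<Longrightarrow> _ \<Longrightarrow> _ \<le> ?R2")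
    if n: "1 \<le> n" and \<eta>: "\<eta> \<le> n" and \<tau>: "\<tau> \<in> carrier_mat n n" and \<nu>: "\<nu> \<in> carrier_mat n n"
      and T: "adj (hop_op n \<tau>) = hop_op n \<tau>" and V: "adj (int_op n \<nu>) = int_op n \<nu>" and t: "t \<ge> 0"
    for n \<eta> \<tau> \<nu> t d
  proof -
    let ?T = "hop_op n \<tau>" and ?V = "int_op n \<nu>"
    have ham: "hamiltonian (2 ^ n) (sector n \<eta>) ?T ?V"
      by standard (use rep_carrier[OF rep_hop] rep_carrier[OF rep_int] T V
        sector_op_preserves[OF rep_hop sector_op_gen] sector_op_preserves[OF rep_int sector_op_gen] in auto)
    interpret hamiltonian "2 ^ n" "sector n \<eta>" ?T ?V by (rule ham)
    have S: "prod_formula (2 ^ n) cs s ?T ?V - mexp ((- \<i> * of_real s) \<cdot>\<^sub>m (?T + ?V))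
        = S (factors cs) (of_real s) - U (of_real s)" for s
      by (simp add: prod_formula_S expo_def)
    have order: "\<exists>C. \<forall>\<^sub>F s in at (0::real). cmod ((S (factors cs) (of_real s) - U (of_real s)) $$ (i, j)) \<le> C * \<bar>s\<bar> ^ Suc p"
      if ij: "i < 2 ^ n" "j < 2 ^ n" for i j
    proof -
      obtain c where "\<forall>\<^sub>F s in at (0::real). \<forall>i<2 ^ n. \<forall>j<2 ^ n.
          cmod ((prod_formula (2 ^ n) cs s ?T ?V - mexp ((- \<i> * of_real s) \<cdot>\<^sub>m (?T + ?V))) $$ (i, j)) \<le> c * \<bar>s\<bar> ^ (p + 1)"
        using assms(2) T_carrier V_carrier unfolding is_product_formula_def by blast
      then show ?thesis unfolding S
        by (intro exI[of _ c]) (auto elim!: eventually_mono simp: ij)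
    qed
    have bound: "?norm \<le> \<kappa> * M * t ^ Suc p" if "0 \<le> M" "nested_bound p M ?T" "nested_bound p M ?V" for M
      unfolding S \<kappa>_def
      by (rule eta_seminorm_le[OF product_formula_error[OF order assms(1) that t] \<eta>])
    show "?norm \<le> ?R1"
    proof -
      let ?\<alpha> = "spec_norm \<tau>" and ?\<beta> = "max_norm \<nu>"
      have \<alpha>: "0 \<le> ?\<alpha>" by (rule spec_norm_nonneg[OF \<tau> n])
      have \<beta>: "0 \<le> ?\<beta>" by (rule max_norm_nonneg)
      define M where "M = (4 * real (p + 1) * (?\<alpha> + \<eta> * ?\<beta>)) ^ q * (4 * ?\<alpha> * ?\<beta> * (real \<eta>)\<^sup>2)"
      have M0: "0 \<le> M" unfolding M_def using \<alpha> \<beta> by simp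
      have "?norm \<le> \<kappa> * M * t ^ Suc p"
        by (rule bound[OF M0 dense_nested_bound[OF ham spec_norm_sum[OF \<tau> n] \<alpha> \<beta> max_norm_entry[OF \<nu>] p M_def]])
      also have "\<dots> = (\<kappa> * ((4 * real (p + 1)) ^ q * 4)) * ((?\<alpha> + ?\<beta> * \<eta>) ^ q * ?\<alpha> * ?\<beta> * \<eta>\<^sup>2 * t ^ Suc p)"
        unfolding M_def power_mult_distrib by (simp add: mult_ac)
      also have "\<dots> \<le> C1 * ((?\<alpha> + ?\<beta> * \<eta>) ^ q * ?\<alpha> * ?\<beta> * \<eta>\<^sup>2 * t ^ Suc p)"
        using \<alpha> \<beta> t by (intro mult_right_mono) (auto simp: C1_def)
      finally show ?thesis by (simp add: p mult_ac)
    qed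
    show "?norm \<le> ?R2" if sp: "sparse_mat d \<tau>" "sparse_mat d \<nu>"
    proof -
      let ?\<alpha> = "max_norm \<tau>" and ?\<beta> = "max_norm \<nu>"
      have \<alpha>: "0 \<le> ?\<alpha>" and \<beta>: "0 \<le> ?\<beta>" by (rule max_norm_nonneg)+
      define D where "D b = d * max_norm (if b then \<tau> else \<nu>)" for b
      define M where "M = \<eta> * (8 ^ (p + 1) * fact (p + 1) * ((D True + D False) ^ q * (D True * D False)))"
      have M0: "0 \<le> M" unfolding M_def D_def using \<alpha> \<beta> by simp
      have gens: "sparse_gens n (\<lambda>b e. (if b then \<tau> else \<nu>) $$ e) D"
        using sparse_gens_sparse_mat[OF \<tau> \<nu> sp] unfolding D_def[abs_def] .
      have "?norm \<le> \<kappa> * M * t ^ Suc p"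
        by (rule bound[OF M0 sparse_nested_bound[OF ham gens p M_def]])
      \<comment> \<open>Each of the q factors \<open>D True + D False\<close> carries one d and the
        product \<open>D True * D False\<close> carries two: q + 2 = p + 1 powers in all.\<close>
      also have "M = \<eta> * (8 ^ (p + 1) * fact (p + 1) * (d ^ (p + 1) * ((?\<alpha> + ?\<beta>) ^ q * (?\<alpha> * ?\<beta>))))"
      proof -
        have "D True + D False = d * (?\<alpha> + ?\<beta>)" by (simp add: D_def distrib_left)
        then show ?thesis unfolding M_def by (simp add: power_mult_distrib D_def p mult_ac)
      qed
      also have "\<kappa> * (\<eta> * (8 ^ (p + 1) * fact (p + 1) * (d ^ (p + 1) * ((?\<alpha> + ?\<beta>) ^ q * (?\<alpha> * ?\<beta>))))) * t ^ Suc p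
          = (\<kappa> * (8 ^ (p + 1) * fact (p + 1))) * ((?\<alpha> + ?\<beta>) ^ q * ?\<alpha> * ?\<beta> * d ^ (p + 1) * \<eta> * t ^ Suc p)"
        by (simp add: mult_ac)
      also have "\<dots> \<le> C2 * ((?\<alpha> + ?\<beta>) ^ q * ?\<alpha> * ?\<beta> * d ^ (p + 1) * \<eta> * t ^ Suc p)"
        using \<alpha> \<beta> t by (intro mult_right_mono) (auto simp: C2_def)
      finally show ?thesis by (simp add: p mult_ac)
    qed
  qed
  show ?thesis
    by (rule exI[of _ C1], rule conjI[OF C(1)], rule exI[of _ C2], rule conjI[OF C(2)])
      (intro allI impI conjI main sparse)
qed

end
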